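(* Let $G$ be a finite connected simple graph. Then the following are equivalent: (a) $G$ is a Taylor graph of a Cohen-Macaulay monomial ideal of codimension $2$ with linear resolution; that is, labelling the vertices of $G$ by $[m+1]=\{1,\dots,m+1\}$, there exist a polynomial ring $S$ over a field $K$ in finitely many variables and a Cohen-Macaulay monomial ideal $I\subset S$ of codimension $2$ with linear resolution, with minimal monomial generators labelled $u_1,\dots,u_{m+1}$, such that $G=G(I)$. (b) $G$ is a chordal graph with the property that any two distinct maximal cliques of $G$ have at most one vertex in common.
   Context: An ideal $I\subset S$ is Cohen-Macaulay if $S/I$ is Cohen-Macaulay; its codimension is its height. $I$ has a linear resolution if, for some $d$, it is generated in degree $d$ and all the matrices of maps in its minimal graded free resolution have only linear forms (or zero) as entries. Let $I$ be a Cohen-Macaulay monomial ideal of codimension $2$ with unique minimal set of monomial generators $u_1,\dots,u_{m+1}$ (in a fixed labelling). Let $U$ be the kernel of the map $S^{m+1}=\bigoplus_{i=1}^{m+1} Se_i\to S$, $e_i\mapsto u_i$; $U$ is a free $S$-module of rank $m$. For $i<j$ the Taylor relation is $r_{ij}=u_{ji}e_j-u_{ij}e_i\in U$, where $u_{ji}=u_i/\gcd(u_i,u_j)$ and $u_{ij}=u_j/\gcd(u_i,u_j)$. The Taylor relations generate $U$. A Hilbert-Burch matrix of $I$ is an $m\times(m+1)$ matrix whose rows are $m$ Taylor relations forming a minimal system of generators (equivalently a basis) of $U$. To such a matrix one assigns the graph on the vertex set $[m+1]$ whose edges are the pairs $\{i,j\}$ for which $r_{ij}$ is a row of the matrix;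 this graph is a tree, called a relation tree of $I$. $\mathcal{T}(I)$ denotes the set of all relation trees of $I$. The Taylor graph $G(I)$ is the graph on $[m+1]$ whose edge set is $\bigcup_{\Gamma\in\mathcal{T}(I)}E(\Gamma)$, where $E(\Gamma)$ is the edge set of $\Gamma$. A clique of $G$ is a subset $C$ of the vertex set such that $\{i,j\}\in E(G)$ for all $i,j\in C$ with $i\neq j$; maximal cliques are maximal with respect to inclusion. A graph is chordal if every cycle of length at least $4$ has a chord.
   Formalization: The graph G is assumed to have at least two vertices, since for the one-vertex graph (b) holds but (a) fails, as an ideal with a single monomial generator never has codimension 2. *)

theory Defs
  imports
    "HOL-Library.Extended_Nat"
    "HOL-Library.Poly_Mapping"
    "HOL-Algebra.QuotRing"
    "Jordan_Normal_Form.Matrix"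
    "Graph_Theory.Graph_Theory"
begin

definition prime_chain :: "('a, 'b) ring_scheme \<Rightarrow> (nat \<Rightarrow> 'a set) \<Rightarrow> nat \<Rightarrow> bool" where
  "prime_chain R P k \<longleftrightarrow> (\<forall>i\<le>k. primeideal (P i) R) \<and> (\<forall>i<k. P i \<subset> P (Suc i))"

definition krull_dim :: "('a, 'b) ring_scheme \<Rightarrow> enat" where
  "krull_dim R = Sup {enat k | k. \<exists>P. prime_chain R P k}"

definition prime_height :: "('a, 'b) ring_scheme \<Rightarrow> 'a set \<Rightarrow> enat" where
  "prime_height R Q = Sup {enat k | k. \<exists>P. prime_chain R P k \<and> P k = Q}"

definition ideal_height :: "('a, 'b) ring_scheme \<Rightarrow> 'a set \<Rightarrow> enat" where
  "ideal_height R I = Inf {prime_height R Q | Q. primeideal Q R \<and> I \<subseteq> Q}"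

text \<open>
  \<open>fs\<close> is a regular sequence on the \<open>R\<close>-module \<open>R/I\<close>: each \<open>fs ! k\<close> is a nonzerodivisor
  modulo \<open>I + (fs ! 0, \<dots>, fs ! (k - 1))\<close>, and \<open>R/(I + (fs))\<close> is nonzero.
\<close>

definition regular_seq :: "('a, 'b) ring_scheme \<Rightarrow> 'a set \<Rightarrow> 'a list \<Rightarrow> bool" where
  "regular_seq R I fs \<longleftrightarrow>
     set fs \<subseteq> carrier R \<and>
     (\<forall>k<length fs. \<forall>a\<in>carrier R.
        fs ! k \<otimes>\<^bsub>R\<^esub> a \<in> genideal R (I \<union> set (take k fs)) \<longrightarrow>
        a \<in> genideal R (I \<union> set (take k fs))) \<and>
     genideal R (I \<union> set fs) \<noteq> carrier R"


text \<open>
  Exponents of monomials are finitely supported maps \<open>nat \<Rightarrow>\<^sub>0 nat\<close>; \<open>poly_ring n\<close> is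
  \<open>K[x\<^sub>0, \<dots>, x\<^bsub>n-1\<^esub>]\<close> for the field \<open>K\<close> given by the type \<open>'k\<close>.
\<close>

type_synonym expo = "nat \<Rightarrow>\<^sub>0 nat"
type_synonym 'k mpoly = "expo \<Rightarrow>\<^sub>0 'k"

definition poly_ring :: "nat \<Rightarrow> ('k::field) mpoly ring" where
  "poly_ring n = \<lparr>carrier = {p. \<forall>t\<in>Poly_Mapping.keys p. Poly_Mapping.keys t \<subseteq> {..<n}},
                 monoid.mult = (*), one = 1, zero = 0, add = (+)\<rparr>"

definition xmon :: "expo \<Rightarrow> ('k::field) mpoly" where
  "xmon t = Poly_Mapping.single t 1"

definition poly_var :: "nat \<Rightarrow> ('k::field) mpoly" where
  "poly_var i = xmon (Poly_Mapping.single i 1)"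

definition irrelevant_ideal :: "nat \<Rightarrow> ('k::field) mpoly set" where
  "irrelevant_ideal n = genideal (poly_ring n) (poly_var ` {..<n})"

definition expo_deg :: "expo \<Rightarrow> nat" where
  "expo_deg t = (\<Sum>i\<in>Poly_Mapping.keys t. Poly_Mapping.lookup t i)"

text \<open>The zero polynomial is homogeneous of every degree; degrees may be negative because of shifts.\<close>

definition homogeneous :: "int \<Rightarrow> ('k::field) mpoly \<Rightarrow> bool" where
  "homogeneous d p \<longleftrightarrow> (\<forall>t\<in>Poly_Mapping.keys p. int (expo_deg t) = d)"

lift_definition expo_gcd :: "expo \<Rightarrow> expo \<Rightarrow> expo" is "\<lambda>s t i. min (s i) (t i)"
  by (rule finite_subset) auto

lemma carrier_poly_ring_iff: "p \<in> carrier (poly_ring n) \<longleftrightarrow> (\<forall>t\<in>Poly_Mapping.keys p. Poly_Mapping.keys t \<subseteq> {..<n})"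
  by (simp add: poly_ring_def)

lemma cring_poly_ring: "cring (poly_ring n :: ('k::field) mpoly ring)"
proof (rule cringI)
  show "abelian_group (poly_ring n :: 'k mpoly ring)"
  proof (rule abelian_groupI)
    fix p q :: "'k mpoly" assume "p \<in> carrier (poly_ring n)" "q \<in> carrier (poly_ring n)"
    then show "p \<oplus>\<^bsub>poly_ring n\<^esub> q \<in> carrier (poly_ring n)"
      using keys_add[of p q] by (fastforce simp: poly_ring_def)
  next
    fix p :: "'k mpoly" assume "p \<in> carrier (poly_ring n)"
    then show "\<exists>q\<in>carrier (poly_ring n). q \<oplus>\<^bsub>poly_ring n\<^esub> p = \<zero>\<^bsub>poly_ring n\<^esub>"
      by (intro bexI[of _ "- p"]) (auto simp: poly_ring_def)
  qed (auto simp: poly_ring_def add_ac)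
  show "Group.comm_monoid (poly_ring n :: 'k mpoly ring)"
  proof (rule comm_monoidI)
    fix p q :: "'k mpoly" assume pq: "p \<in> carrier (poly_ring n)" "q \<in> carrier (poly_ring n)"
    have "Poly_Mapping.keys t \<subseteq> {..<n}" if t: "t \<in> Poly_Mapping.keys (p * q)" for t
    proof -
      obtain a b where "t = a + b" "a \<in> Poly_Mapping.keys p" "b \<in> Poly_Mapping.keys q"
        using t keys_mult[of p q] by blast
      then show ?thesis using pq keys_add[of a b] by (fastforce simp: poly_ring_def)
    qed
    then show "p \<otimes>\<^bsub>poly_ring n\<^esub> q \<in> carrier (poly_ring n)" by (simp add: poly_ring_def)
  qed (auto simp: poly_ring_def mult_ac)
qed (auto simp: poly_ring_def algebra_simps)


text \<open>
  For the polynomial ring \<open>S\<close> and a homogeneous ideal \<open>I\<close>, \<open>S/I\<close> is graded, and its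
  depth is the maximal length of a regular sequence contained in the graded maximal ideal.
\<close>

definition depth_quot :: "nat \<Rightarrow> ('k::field) mpoly set \<Rightarrow> enat" where
  "depth_quot n I =
     Sup {enat (length fs) | fs. set fs \<subseteq> irrelevant_ideal n \<and> regular_seq (poly_ring n) I fs}"

definition cohen_macaulay :: "nat \<Rightarrow> ('k::field) mpoly set \<Rightarrow> bool" where
  "cohen_macaulay n I \<longleftrightarrow> depth_quot n I = krull_dim (poly_ring n Quot I)"

definition free_mod :: "nat \<Rightarrow> nat \<Rightarrow> ('k::field) mpoly vec set" where
  "free_mod n k = {v \<in> carrier_vec k. \<forall>i<k. v $ i \<in> carrier (poly_ring n)}"

definition poly_mat :: "nat \<Rightarrow> nat \<Rightarrow> nat \<Rightarrow> ('k::field) mpoly mat set" where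
  "poly_mat n k l = {A \<in> carrier_mat k l. \<forall>i<k. \<forall>j<l. A $$ (i, j) \<in> carrier (poly_ring n)}"

inductive_set submod_span :: "nat \<Rightarrow> nat \<Rightarrow> ('k::field) mpoly vec set \<Rightarrow> 'k mpoly vec set"
  for n k A where
  zero: "0\<^sub>v k \<in> submod_span n k A"
| step: "\<lbrakk>a \<in> A; c \<in> carrier (poly_ring n); v \<in> submod_span n k A\<rbrakk>
         \<Longrightarrow> c \<cdot>\<^sub>v a + v \<in> submod_span n k A"

text \<open>
  A graded free resolution
  \<open>\<dots> \<longrightarrow> F\<^sub>2 \<longrightarrow> F\<^sub>1 \<longrightarrow> F\<^sub>0 \<longrightarrow> I \<longrightarrow> 0\<close>.
  Here \<open>F\<^sub>i\<close> has basis elements of degrees \<open>a i 0, \<dots>, a i (b i - 1)\<close>, the map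
  \<open>F\<^sub>0 \<longrightarrow> I\<close> sends the \<open>j\<close>-th basis element to \<open>g $ j\<close>, and \<open>\<phi> i\<close> is the matrix (acting on
  column vectors) of \<open>F\<^bsub>i+1\<^esub> \<longrightarrow> F\<^sub>i\<close>. It is minimal if every \<open>\<phi> i\<close> maps into \<open>\<mm>F\<^sub>i\<close>,
  where \<open>\<mm>\<close> is the irrelevant ideal.
\<close>

definition graded_free_resolution ::
  "nat \<Rightarrow> ('k::field) mpoly set \<Rightarrow> (nat \<Rightarrow> nat) \<Rightarrow> (nat \<Rightarrow> nat \<Rightarrow> int) \<Rightarrow>
   'k mpoly vec \<Rightarrow> (nat \<Rightarrow> 'k mpoly mat) \<Rightarrow> bool" where
  "graded_free_resolution n I b a g \<phi> \<longleftrightarrow>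
     g \<in> free_mod n (b 0) \<and>
     (\<forall>j<b 0. homogeneous (a 0 j) (g $ j)) \<and>
     (\<forall>i. \<phi> i \<in> poly_mat n (b i) (b (Suc i))) \<and>
     (\<forall>i. \<forall>p<b i. \<forall>q<b (Suc i). homogeneous (a (Suc i) q - a i p) (\<phi> i $$ (p, q))) \<and>
     (\<lambda>v. g \<bullet> v) ` free_mod n (b 0) = I \<and>
     {v \<in> free_mod n (b 0). g \<bullet> v = 0} = (\<lambda>w. \<phi> 0 *\<^sub>v w) ` free_mod n (b 1) \<and>
     (\<forall>i. {v \<in> free_mod n (b (Suc i)). \<phi> i *\<^sub>v v = 0\<^sub>v (b i)} =
          (\<lambda>w. \<phi> (Suc i) *\<^sub>v w) ` free_mod n (b (Suc (Suc i))))"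

definition minimal_graded_free_resolution ::
  "nat \<Rightarrow> ('k::field) mpoly set \<Rightarrow> (nat \<Rightarrow> nat) \<Rightarrow> (nat \<Rightarrow> nat \<Rightarrow> int) \<Rightarrow>
   'k mpoly vec \<Rightarrow> (nat \<Rightarrow> 'k mpoly mat) \<Rightarrow> bool" where
  "minimal_graded_free_resolution n I b a g \<phi> \<longleftrightarrow>
     graded_free_resolution n I b a g \<phi> \<and>
     (\<forall>i. \<forall>p<b i. \<forall>q<b (Suc i). \<phi> i $$ (p, q) \<in> irrelevant_ideal n)"

definition generated_in_degree :: "nat \<Rightarrow> nat \<Rightarrow> ('k::field) mpoly set \<Rightarrow> bool" where
  "generated_in_degree n d I \<longleftrightarrow>
     (\<exists>F \<subseteq> carrier (poly_ring n). (\<forall>f\<in>F. homogeneous (int d) f) \<and> I = genideal (poly_ring n) F)"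

text \<open>
  The minimal graded free resolution is unique up to graded isomorphism, which does not affect
  the degrees of the matrix entries; so it suffices to ask for one.
\<close>

definition linear_resolution :: "nat \<Rightarrow> ('k::field) mpoly set \<Rightarrow> bool" where
  "linear_resolution n I \<longleftrightarrow>
     (\<exists>d. generated_in_degree n d I) \<and>
     (\<exists>b a g \<phi>. minimal_graded_free_resolution n I b a g \<phi> \<and>
        (\<forall>i. \<forall>p<b i. \<forall>q<b (Suc i). homogeneous 1 (\<phi> i $$ (p, q))))"


text \<open>
  The labels of the minimal monomial generators are the positions
  \<open>0, \<dots>, m\<close> in the list \<open>us\<close> of exponents, instead of \<open>1, \<dots>, m + 1\<close>.
\<close>

definition ideal_of_monomials :: "nat \<Rightarrow> expo set \<Rightarrow> ('k::field) mpoly set" where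
  "ideal_of_monomials n M = genideal (poly_ring n) (xmon ` M)"

definition minimal_monomial_generators :: "nat \<Rightarrow> ('k::field) mpoly set \<Rightarrow> expo list \<Rightarrow> bool" where
  "minimal_monomial_generators n I us \<longleftrightarrow>
     distinct us \<and> (\<forall>u\<in>set us. Poly_Mapping.keys u \<subseteq> {..<n}) \<and>
     I = ideal_of_monomials n (set us) \<and>
     (\<forall>M. M \<subset> set us \<longrightarrow> ideal_of_monomials n M \<noteq> I)"

definition syzygies :: "nat \<Rightarrow> expo list \<Rightarrow> ('k::field) mpoly vec set" where
  "syzygies n us =
     {v \<in> free_mod n (length us). (\<Sum>i<length us. v $ i * xmon (us ! i)) = 0}"

text \<open>Subtraction of exponents is division of monomials; \<open>cofactor us i j\<close> is \<open>u\<^sub>i / gcd(u\<^sub>i, u\<^sub>j)\<close>.\<close>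

definition cofactor :: "expo list \<Rightarrow> nat \<Rightarrow> nat \<Rightarrow> ('k::field) mpoly" where
  "cofactor us i j = xmon (us ! i - expo_gcd (us ! i) (us ! j))"

definition taylor_relation :: "expo list \<Rightarrow> nat \<Rightarrow> nat \<Rightarrow> ('k::field) mpoly vec" where
  "taylor_relation us i j =
     cofactor us i j \<cdot>\<^sub>v unit_vec (length us) j - cofactor us j i \<cdot>\<^sub>v unit_vec (length us) i"

definition hilbert_burch_matrix :: "nat \<Rightarrow> expo list \<Rightarrow> ('k::field) mpoly mat \<Rightarrow> bool" where
  "hilbert_burch_matrix n us H \<longleftrightarrow>
     H \<in> carrier_mat (length us - 1) (length us) \<and>
     (\<forall>r\<in>set (rows H). \<exists>i j. i < j \<and> j < length us \<and> r = taylor_relation us i j) \<and>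
     distinct (rows H) \<and>
     submod_span n (length us) (set (rows H)) = syzygies n us \<and>
     (\<forall>B. B \<subset> set (rows H) \<longrightarrow> submod_span n (length us) B \<noteq> syzygies n us)"

definition relation_tree_edges :: "expo list \<Rightarrow> ('k::field) mpoly mat \<Rightarrow> (nat \<times> nat) set" where
  "relation_tree_edges us H =
     {(i, j). i < j \<and> j < length us \<and> taylor_relation us i j \<in> set (rows H)}"

text \<open>Undirected graphs are symmetric digraphs.\<close>

definition relation_tree :: "expo list \<Rightarrow> ('k::field) mpoly mat \<Rightarrow> nat pair_pre_digraph" where
  "relation_tree us H =
     \<lparr>pverts = {..<length us},
      parcs = relation_tree_edges us H \<union> (relation_tree_edges us H)\<inverse>\<rparr>"

definition relation_trees ::
  "('k::field) itself \<Rightarrow> nat \<Rightarrow> expo list \<Rightarrow> nat pair_pre_digraph set" where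
  "relation_trees K n us =
     {relation_tree us H | H :: 'k mpoly mat. hilbert_burch_matrix n us H}"

definition taylor_graph :: "('k::field) itself \<Rightarrow> nat \<Rightarrow> expo list \<Rightarrow> nat pair_pre_digraph" where
  "taylor_graph K n us =
     \<lparr>pverts = {..<length us}, parcs = (\<Union>\<Gamma>\<in>relation_trees K n us. parcs \<Gamma>)\<rparr>"

definition relabel :: "('a \<Rightarrow> 'b) \<Rightarrow> 'a pair_pre_digraph \<Rightarrow> 'b pair_pre_digraph" where
  "relabel f G = \<lparr>pverts = f ` pverts G, parcs = map_prod f f ` parcs G\<rparr>"


definition is_clique :: "'a pair_pre_digraph \<Rightarrow> 'a set \<Rightarrow> bool" where
  "is_clique G C \<longleftrightarrow> C \<subseteq> pverts G \<and> (\<forall>i\<in>C. \<forall>j\<in>C. i \<noteq> j \<longrightarrow> (i, j) \<in> parcs G)"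

definition maximal_clique :: "'a pair_pre_digraph \<Rightarrow> 'a set \<Rightarrow> bool" where
  "maximal_clique G C \<longleftrightarrow> is_clique G C \<and> (\<forall>D. is_clique G D \<and> C \<subseteq> D \<longrightarrow> D = C)"

text \<open>Cycles are given by the list of their distinct vertices in cyclic order.\<close>

definition vertex_cycle :: "'a pair_pre_digraph \<Rightarrow> 'a list \<Rightarrow> bool" where
  "vertex_cycle G vs \<longleftrightarrow>
     3 \<le> length vs \<and> distinct vs \<and> set vs \<subseteq> pverts G \<and>
     (\<forall>i<length vs. (vs ! i, vs ! (Suc i mod length vs)) \<in> parcs G)"

definition has_chord :: "'a pair_pre_digraph \<Rightarrow> 'a list \<Rightarrow> bool" where
  "has_chord G vs \<longleftrightarrow>
     (\<exists>i<length vs. \<exists>j<length vs. i \<noteq> j \<and> j \<noteq> Suc i mod length vs \<and> i \<noteq> Suc j mod length vs \<and>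
        (vs ! i, vs ! j) \<in> parcs G)"

definition chordal :: "'a pair_pre_digraph \<Rightarrow> bool" where
  "chordal G \<longleftrightarrow> (\<forall>vs. vertex_cycle G vs \<and> 4 \<le> length vs \<longrightarrow> has_chord G vs)"

end

theory Submission
  imports Defs "HOL-Computational_Algebra.Factorial_Ring"
begin

text \<open>
  Let \<open>I\<close> have a linear resolution, with minimal monomial generators \<open>u\<^sub>v\<close>. They all have the
  same degree \<open>d\<close>, and the linear relations among the rows of a Hilbert-Burch matrix already generate
  all syzygies, so every Taylor relation in every relation tree is linear: its edge \<open>{i, j}\<close> satisfies
  \<open>deg lcm(u\<^sub>i, u\<^sub>j) = d + 1\<close> (\<open>minimal_generators_same_degree\<close>, \<open>linear_resolution_syzygies\<close>,
  \<open>hb_edges_linear\<close>). Fix one relation tree \<open>T\<close> and colour its edges by these least common multiples.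
  The relation \<open>r\<^sub>i\<^sub>j\<close> belongs to some relation tree if and only if \<open>i\<close> and \<open>j\<close> are joined in \<open>T\<close>
  by a path of a single colour (\<open>taylor_graph_arcs\<close>). Along such a path the Taylor relations
  telescope, so \<open>r\<^sub>i\<^sub>j\<close> can replace any edge of the path; conversely, the part of \<open>r\<^sub>i\<^sub>j\<close> in
  multidegree \<open>lcm(u\<^sub>i, u\<^sub>j)\<close> can only be generated by edges whose colour divides that monomial, and
  by degree reasons equals it.

  Hence the Taylor graph is the union of the complete graphs on the monochromatic components of a
  tree. Removing one edge of \<open>T\<close> splits the vertices in two, and the only Taylor edges that cross this
  cut lie in the component of the removed edge. A cycle crosses the cut twice and a clique cannot
  cross it and then leave the component, which gives (b)
  (\<open>chordal_and_cliques_if_separated_classes\<close>, \<open>taylor_graph_block_graph\<close>).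

  For the converse, number the vertices of a graph as in (b) by \<open>0, \<dots>, m\<close> so that every initial
  segment is connected. The earlier neighbours of a vertex \<open>j > 0\<close> then form a clique, hence lie in
  one maximal clique, whose first two vertices are called \<open>p j\<close> and \<open>s j\<close>
  (\<open>block_parents_exist\<close>). Take variables \<open>y\<^sub>j\<close> and \<open>z\<^sub>s\<close> and put
  \<open>u\<^sub>0 = y\<^sub>1 \<cdots> y\<^sub>m\<close> and \<open>u\<^sub>j = u\<^bsub>p j\<^esub> z\<^bsub>s j\<^esub> / y\<^sub>j\<close>. Since \<open>u\<^sub>m\<close> is the only generator not
  divisible by \<open>y\<^sub>m\<close>, induction on \<open>m\<close> shows that the linear relations
  \<open>y\<^sub>j e\<^sub>j - z\<^bsub>s j\<^esub> e\<^bsub>p j\<^esub>\<close> form a basis of the syzygies (\<open>block_syzygies\<close>). This is the minimal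
  resolution. It also yields one relation tree, whose edge \<open>{p j, j}\<close> has the colour
  \<open>u\<^bsub>p j\<^esub> z\<^bsub>s j\<^esub>\<close>, so that the edges of one colour connect the vertices of one maximal clique (\<open>taylor_graph_eq\<close>).

  It remains to see that \<open>S/I\<close> is Cohen-Macaulay and \<open>I\<close> has height two. The syzygy argument uses
  only that the variables are pairwise non-associated primes. It therefore survives replacing
  variables \<open>x\<^sub>k\<close> one at a time by the primes \<open>x\<^sub>0 + x\<^sub>1\<^sup>k\<close>, where \<open>x\<^sub>0\<close> and \<open>x\<^sub>1\<close> do not occur in the
  generators, and this makes the elements \<open>x\<^sub>k - (x\<^sub>0 + x\<^sub>1\<^sup>k)\<close>, \<open>2 \<le> k < n\<close>, a regular sequence of
  length \<open>n - 2\<close> (\<open>theta_nzd\<close>). The upper bounds for depth, dimension and height come from a single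
  mechanism: a nonzerodivisor added to a family that is algebraically independent modulo a larger
  ideal keeps it independent modulo the smaller one (\<open>alg_indep_mod_extend\<close>), so regular sequences and
  strict chains of primes produce algebraically independent families, and counting monomials bounds
  the size of such a family (\<open>alg_indep_length_le\<close>).
\<close>

section \<open>Chordal graphs whose maximal cliques share at most one vertex\<close>

text \<open>
  Here \<open>K\<close> is a family of cliques covering all edges, and for any two vertices of a class there is a
  bipartition \<open>f\<close> that separates them and is crossed only by edges inside that class. A cycle crossing
  the cut along one edge must cross it again, and both crossing edges have their ends in the same
  clique. Likewise every vertex of a clique through \<open>x\<close> and \<open>y\<close> is across the cut from \<open>x\<close> or from
  \<open>y\<close>, hence lies in the class; so \<open>x\<close> and \<open>y\<close> determine the maximal clique containing them.
\<close>

lemma chordal_and_cliques_if_separated_classes: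
  fixes G :: "'a pair_pre_digraph"
  assumes arcs: "\<And>x y. (x, y) \<in> parcs G \<longleftrightarrow> x \<noteq> y \<and> (\<exists>C\<in>K. x \<in> C \<and> y \<in> C)"
    and sub: "\<And>C. C \<in> K \<Longrightarrow> C \<subseteq> pverts G"
    and sep: "\<And>C x y. C \<in> K \<Longrightarrow> x \<in> C \<Longrightarrow> y \<in> C \<Longrightarrow> x \<noteq> y \<Longrightarrow>
       \<exists>f :: 'a \<Rightarrow> bool. f x \<noteq> f y \<and> (\<forall>k l. (k, l) \<in> parcs G \<longrightarrow> f k \<noteq> f l \<longrightarrow> k \<in> C \<and> l \<in> C)"
  shows "chordal G"
    and "\<And>C D. maximal_clique G C \<Longrightarrow> maximal_clique G D \<Longrightarrow> C \<noteq> D \<Longrightarrow> card (C \<inter> D) \<le> 1"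
proof -
  show "chordal G"
    unfolding chordal_def
  proof (intro allI impI)
    fix vs assume *: "vertex_cycle G vs \<and> 4 \<le> length vs"
    define n where "n = length vs"
    have n: "4 \<le> n" and dist: "distinct vs"
      and cyc: "\<And>i. i < n \<Longrightarrow> (vs ! i, vs ! (Suc i mod n)) \<in> parcs G"
      using * by (auto simp: vertex_cycle_def n_def)
    have c01: "(vs ! 0, vs ! 1) \<in> parcs G" using cyc[of 0] n by simp
    then obtain C where C: "C \<in> K" "vs ! 0 \<in> C" "vs ! 1 \<in> C" "vs ! 0 \<noteq> vs ! 1"
      using arcs by blast
    from sep[OF C(1,2,3,4)] obtain f :: "'a \<Rightarrow> bool" where f: "f (vs ! 0) \<noteq> f (vs ! 1)"
      and f': "\<forall>k l. (k, l) \<in> parcs G \<longrightarrow> f k \<noteq> f l \<longrightarrow> k \<in> C \<and> l \<in> C" by blast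
    have fC: "k \<in> C \<and> l \<in> C" if "(k, l) \<in> parcs G" "f k \<noteq> f l" for k l by (rule f'[rule_format, OF that])
    \<comment> \<open>Otherwise f would be constant along the path from vertex 1 around the cycle back to vertex 0.\<close>
    have "\<exists>i. 1 \<le> i \<and> i < n \<and> f (vs ! i) \<noteq> f (vs ! (Suc i mod n))"
    proof (rule ccontr)
      assume "\<not> ?thesis"
      then have no: "f (vs ! i) = f (vs ! (Suc i mod n))" if "1 \<le> i" "i < n" for i using that by metis
      have "f (vs ! i) = f (vs ! 1)" if "1 \<le> i" "i < n" for i
        using that
      proof (induction i rule: nat_induct_at_least)
        case (Suc k)
        have "f (vs ! k) = f (vs ! (Suc k mod n))" by (rule no) (use Suc in auto)
        moreover have "Suc k mod n = Suc k" using Suc by simp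
        moreover have "f (vs ! k) = f (vs ! 1)" using Suc by simp
        ultimately show ?case by metis
      qed simp
      from this[of "n - 1"] have "f (vs ! (n - 1)) = f (vs ! 1)" using n by simp
      moreover have "f (vs ! (n - 1)) = f (vs ! (Suc (n - 1) mod n))" by (rule no) (use n in auto)
      moreover have "Suc (n - 1) mod n = 0" using n by simp
      ultimately show False using f by simp
    qed
    then obtain i where i: "1 \<le> i" "i < n" "f (vs ! i) \<noteq> f (vs ! (Suc i mod n))" by blast
    have iC: "vs ! i \<in> C" "vs ! (Suc i mod n) \<in> C" using fC[OF cyc[OF i(2)] i(3)] by auto
    have arc: "(vs ! a, vs ! b) \<in> parcs G" if "vs ! a \<in> C" "vs ! b \<in> C" "a < n" "b < n" "a \<noteq> b" for a b
      using that arcs C dist by (auto simp: n_def nth_eq_iff_index_eq)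
    \<comment> \<open>In each case, an end of the edge 01 and an end of the second crossing edge are not neighbours on the cycle.\<close>
    consider "i = 1" | "2 \<le> i" "i \<le> n - 2" | "i = n - 1" using i by linarith
    then show "has_chord G vs"
    proof cases
      case 1
      then have "(vs ! 0, vs ! 2) \<in> parcs G" using arc[of 0 2] iC n C by (simp add: numeral_2_eq_2)
      then show ?thesis unfolding has_chord_def using n by (intro exI[of _ 0] exI[of _ 2] conjI) (auto simp: n_def mod_Suc)
    next
      case 2
      then have "(vs ! 0, vs ! i) \<in> parcs G" using arc[of 0 i] iC i n C by auto
      then show ?thesis unfolding has_chord_def using n 2 by (intro exI[of _ 0] exI[of _ i] conjI) (auto simp: n_def mod_Suc)
    next
      case 3
      then have "(vs ! 1, vs ! i) \<in> parcs G" using arc[of 1 i] iC i n C by auto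
      then show ?thesis unfolding has_chord_def using n 3 by (intro exI[of _ 1] exI[of _ i] conjI) (auto simp: n_def mod_Suc)
    qed
  qed
next
  fix C D assume C: "maximal_clique G C" and D: "maximal_clique G D" and "C \<noteq> D"
  show "card (C \<inter> D) \<le> 1"
  proof (rule ccontr)
    assume "\<not> ?thesis"
    then have "\<not> card (C \<inter> D) \<le> Suc 0" by simp
    then have fin: "finite (C \<inter> D)" and "\<not> (\<forall>a\<in>C \<inter> D. \<forall>b\<in>C \<inter> D. a = b)"
      using card_le_Suc0_iff_eq[of "C \<inter> D"] by (metis card.infinite zero_le)+
    then obtain a b where ab: "a \<in> C" "a \<in> D" "b \<in> C" "b \<in> D" "a \<noteq> b" by blast
    have "(a, b) \<in> parcs G" using C ab by (auto simp: maximal_clique_def is_clique_def)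
    then obtain Z where Z: "Z \<in> K" "a \<in> Z" "b \<in> Z" using arcs by blast
    from sep[OF Z ab(5)] obtain f :: "'a \<Rightarrow> bool" where f: "f a \<noteq> f b"
      and f': "\<forall>k l. (k, l) \<in> parcs G \<longrightarrow> f k \<noteq> f l \<longrightarrow> k \<in> Z \<and> l \<in> Z" by blast
    have fZ: "k \<in> Z \<and> l \<in> Z" if "(k, l) \<in> parcs G" "f k \<noteq> f l" for k l by (rule f'[rule_format, OF that])
    have "E = Z" if E: "maximal_clique G E" "a \<in> E" "b \<in> E" for E
    proof -
      have "c \<in> Z" if "c \<in> E" for c
      proof (cases "c = a \<or> c = b")
        case False
        then have "(c, a) \<in> parcs G" "(c, b) \<in> parcs G" using E that by (auto simp: maximal_clique_def is_clique_def)
        then show ?thesis using f fZ[of c a] fZ[of c b] by auto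
      qed (use Z in auto)
      moreover have "is_clique G Z" using arcs sub Z by (auto simp: is_clique_def)
      ultimately show ?thesis using E unfolding maximal_clique_def by blast
    qed
    then show False using C D ab \<open>C \<noteq> D\<close> by metis
  qed
qed

text \<open>
  The triangles \<open>{a, b, c}\<close> and \<open>{a, b, d}\<close> extend to maximal cliques with two common vertices, so these
  cliques coincide.
\<close>

lemma cliques_share_edge_diamond:
  fixes G :: "'a pair_pre_digraph"
  assumes fin: "finite (pverts G)" and sym: "sym (parcs G)" and wf: "parcs G \<subseteq> pverts G \<times> pverts G"
    and cl: "\<And>C D. maximal_clique G C \<Longrightarrow> maximal_clique G D \<Longrightarrow> C \<noteq> D \<Longrightarrow> card (C \<inter> D) \<le> 1"
    and ab: "(a, b) \<in> parcs G" "a \<noteq> b"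
    and c: "(c, a) \<in> parcs G" "(c, b) \<in> parcs G" and d: "(d, a) \<in> parcs G" "(d, b) \<in> parcs G"
    and cd: "c \<noteq> d"
  shows "(c, d) \<in> parcs G"
proof -
  have ext: "\<exists>D. maximal_clique G D \<and> C \<subseteq> D" if C: "is_clique G C" for C
  proof -
    have "finite {D. is_clique G D}"
      by (rule finite_subset[of _ "Pow (pverts G)"]) (use fin in \<open>auto simp: is_clique_def\<close>)
    from finite_has_maximal2[OF this, of C] C obtain D where
      "is_clique G D" "C \<subseteq> D" "\<forall>E. is_clique G E \<longrightarrow> D \<subseteq> E \<longrightarrow> D = E" by auto
    then show ?thesis unfolding maximal_clique_def by blast
  qed
  have sym': "(x, y) \<in> parcs G \<Longrightarrow> (y, x) \<in> parcs G" for x y using sym by (meson symD)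
  have "is_clique G {a, b, c}" "is_clique G {a, b, d}"
    using ab c d wf sym' by (auto simp: is_clique_def)
  from ext[OF this(1)] ext[OF this(2)]
  obtain C D where C: "maximal_clique G C" "{a, b, c} \<subseteq> C" and D: "maximal_clique G D" "{a, b, d} \<subseteq> D"
    by (elim exE conjE)
  have "C = D"
  proof (rule ccontr)
    assume "C \<noteq> D"
    then have "card (C \<inter> D) \<le> 1" using cl C D by blast
    moreover have "finite (C \<inter> D)" using C fin by (auto simp: maximal_clique_def is_clique_def intro: finite_subset)
    then have "card {a, b} \<le> card (C \<inter> D)" using C D by (intro card_mono) auto
    ultimately show False using ab by simp
  qed
  then show ?thesis using C D cd unfolding maximal_clique_def is_clique_def by auto
qed

text \<open>
  Take a counterexample walk of minimal length. It has no shortcuts, since these would give a shorter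
  walk with the same ends, and \<open>v\<close> has no neighbour in its interior: by induction such a neighbour is
  adjacent to both ends, and the diamond condition joins the ends. Hence \<open>v\<close> closes the walk to a
  chordless cycle of length \<open>k + 2\<close>.
\<close>

lemma chordal_diamond_free_walk_closes:
  fixes G :: "'a pair_pre_digraph"
  assumes sym: "sym (parcs G)" and wf: "parcs G \<subseteq> pverts G \<times> pverts G"
    and chordal: "chordal G"
    and diamond: "\<And>a b c d. (a, b) \<in> parcs G \<Longrightarrow> (c, a) \<in> parcs G \<Longrightarrow> (c, b) \<in> parcs G \<Longrightarrow>
      (d, a) \<in> parcs G \<Longrightarrow> (d, b) \<in> parcs G \<Longrightarrow> c \<noteq> d \<Longrightarrow> (c, d) \<in> parcs G"
    and walk: "\<forall>i<k. (w i, w (Suc i)) \<in> parcs G" and avoid: "\<forall>i\<le>k. w i \<noteq> v"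
    and ends: "(v, w 0) \<in> parcs G" "(v, w k) \<in> parcs G"
  shows "w 0 = w k \<or> (w 0, w k) \<in> parcs G"
  using walk avoid ends
proof (induction k arbitrary: w rule: less_induct)
  case (less k)
  let ?E = "parcs G"
  have sym': "(x, y) \<in> ?E \<Longrightarrow> (y, x) \<in> ?E" for x y using sym by (meson symD)
  show ?case
  proof (rule ccontr)
    assume neg: "\<not> ?case"
    have k2: "2 \<le> k"
    proof (rule ccontr)
      assume "\<not> 2 \<le> k" then have "k = 0 \<or> k = 1" by linarith
      then show False using neg less.prems(1) by auto
    qed
    have short: False if ij: "i < j" "j \<le> k" and s: "w i = w j \<or> ((w i, w j) \<in> ?E \<and> Suc i < j)" for i j
    proof -
      \<comment> \<open>The walk \<open>w'\<close> jumps from position i directly to position j; when \<open>w i = w j\<close>, the vertex is kept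
        once instead of using an edge, which is the offset e.\<close>
      define e where "e = (if w i = w j then 0 else 1 :: nat)"
      have e: "j = i + (j - i)" "e < j - i" using ij s by (auto simp: e_def)
      define w' where "w' t = (if t \<le> i then w t else w (t + (j - i) - e))" for t
      define k' where "k' = k - (j - i) + e"
      have k': "k' < k" using e ij by (auto simp: k'_def)
      have "\<forall>t<k'. (w' t, w' (Suc t)) \<in> ?E"
      proof (intro allI impI)
        fix t assume t: "t < k'"
        consider "t < i" | "t = i" | "t > i" by linarith
        then show "(w' t, w' (Suc t)) \<in> ?E"
        proof cases
          case 1 then show ?thesis using less.prems(1) ij by (auto simp: w'_def)
        next
          case 2
          show ?thesis
          proof (cases "w i = w j")
            case True
            then have "j < k" using t 2 ij by (auto simp: k'_def e_def)
            then show ?thesis using less.prems(1) True 2 ij by (auto simp: w'_def e_def)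
          next
            case False then show ?thesis using s 2 ij by (auto simp: w'_def e_def)
          qed
        next
          case 3
          then have "t + (j - i) - e < k" "Suc t + (j - i) - e = Suc (t + (j - i) - e)"
            using t ij e by (auto simp: k'_def)
          then show ?thesis using less.prems(1) 3 by (auto simp: w'_def)
        qed
      qed
      moreover have "\<forall>t\<le>k'. w' t \<noteq> v"
        using less.prems(2) ij e by (auto simp: w'_def k'_def)
      moreover have "w' 0 = w 0" by (simp add: w'_def)
      moreover have "w' k' = w k"
      proof (cases "k' \<le> i")
        case True
        then have "k' = i" "j = k" "e = 0" using ij e by (auto simp: k'_def)
        then show ?thesis using s by (auto simp: w'_def e_def split: if_splits)
      next
        case False then show ?thesis using ij e by (auto simp: w'_def k'_def)
      qed
      ultimately show False using less.IH[OF k', of w'] less.prems neg by auto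
    qed
    have inner: False if i: "0 < i" "i < k" "(v, w i) \<in> ?E" for i
    proof -
      have "w 0 = w i \<or> (w 0, w i) \<in> ?E" using less.IH[of i w] less.prems i by auto
      moreover have "\<not> (w 0 = w i)" using short[of 0 i] i by auto
      moreover have "\<not> ((w 0, w i) \<in> ?E \<and> Suc 0 < i)" using short[of 0 i] i by auto
      ultimately have e1: "(w 0, w i) \<in> ?E" "i = 1" using i by auto
      have "w i = w k \<or> (w i, w k) \<in> ?E"
        using less.IH[of "k - i" "\<lambda>t. w (t + i)"] less.prems i by auto
      moreover have "\<not> (w i = w k)" using short[of i k] i by auto
      moreover have "\<not> ((w i, w k) \<in> ?E \<and> Suc i < k)" using short[of i k] i by auto
      ultimately have e2: "(w i, w k) \<in> ?E" "Suc i = k" using i by auto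
      have "(w 0, w k) \<in> ?E"
        using diamond[of v "w i" "w 0" "w k"] e1 e2 i less.prems(3,4) sym' neg by blast
      then show False using neg by blast
    qed
    define vs where "vs = v # map w [0..<Suc k]"
    have len: "length vs = k + 2" by (simp add: vs_def)
    have vs0: "vs ! 0 = v" and vsS: "i \<le> k \<Longrightarrow> vs ! Suc i = w i" for i
      by (auto simp: vs_def simp del: upt_Suc)
    have "vertex_cycle G vs"
      unfolding vertex_cycle_def
    proof (intro conjI allI impI)
      show "3 \<le> length vs" using len k2 by simp
      have "inj_on w {0..<Suc k}"
        by (rule linorder_inj_onI) (use short less_Suc_eq_le in \<open>metis atLeastLessThan_iff\<close>, auto)
      then show "distinct vs" using less.prems(2) by (auto simp: vs_def distinct_map less_Suc_eq_le simp del: upt_Suc)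
      have "w i \<in> pverts G" if "i \<le> k" for i
        using that wf less.prems(1,4) by (cases "i = k") (use le_neq_implies_less in \<open>blast+\<close>)
      then show "set vs \<subseteq> pverts G" using wf less.prems(3) by (auto simp: vs_def simp del: upt_Suc)
      fix i assume i: "i < length vs"
      consider "i = 0" | "i = Suc k" | j where "i = Suc j" "j < k"
        using i len by (cases i) (auto, force)
      then show "(vs ! i, vs ! (Suc i mod length vs)) \<in> ?E"
        by cases (use less.prems sym' vs0 vsS len in auto)
    qed
    then have "has_chord G vs" using chordal len k2 unfolding chordal_def by auto
    then obtain i j where c: "i < k + 2" "j < k + 2" "i \<noteq> j" "j \<noteq> Suc i mod (k + 2)" "i \<noteq> Suc j mod (k + 2)"
       "(vs ! i, vs ! j) \<in> ?E" unfolding has_chord_def len by blast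
    have no: False if c: "i < j" "j < k + 2" "j \<noteq> Suc i mod (k + 2)" "i \<noteq> Suc j mod (k + 2)"
       "(vs ! i, vs ! j) \<in> ?E" for i j
    proof (cases i)
      case 0
      then have "j \<noteq> 1" "j \<noteq> Suc k" using c by auto
      then obtain l where "j = Suc l" "0 < l" "l < k" using c 0 by (cases j) auto
      then show False using inner[of l] vs0 vsS[of l] c 0 by auto
    next
      case (Suc i')
      then obtain j' where j': "j = Suc j'" using c by (cases j) auto
      have "Suc i' \<noteq> j'" "i' < j'" "j' \<le> k" using c Suc j' by auto
      then show False using short[of i' j'] vsS[of i'] vsS[of j'] c Suc j' by auto
    qed
    show False using no[of i j] no[of j i] c sym' by (metis linorder_neqE_nat)
  qed
qed

section \<open>Rooted block structures\<close>

text \<open>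
  The encoding of a graph whose maximal cliques share at most one vertex, on the vertices \<open>0, \<dots>, m\<close>: the
  maximal clique that contains \<open>j\<close> together with an earlier vertex starts with \<open>p j\<close> and has \<open>s j\<close> as its
  second vertex. So \<open>s j = j\<close> if \<open>j\<close> is itself the second vertex, and the value \<open>s j\<close> serves as the name
  of the clique.
\<close>

definition block_parents :: "nat \<Rightarrow> (nat \<Rightarrow> nat) \<Rightarrow> (nat \<Rightarrow> nat) \<Rightarrow> bool" where
  "block_parents m p s \<longleftrightarrow>
     (\<forall>j\<in>{1..m}. p j < j \<and> 1 \<le> s j \<and> s j \<le> j \<and> s (s j) = s j \<and> p (s j) = p j)"

text \<open>
  Adjacent pairs, smaller vertex first: either \<open>i\<close> is the first vertex of the clique in which \<open>j\<close> is new, or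
  both are non-first vertices of the same clique. The guard \<open>1 \<le> i\<close> is there because \<open>s 0\<close> is arbitrary.
\<close>

definition block_adj :: "nat \<Rightarrow> (nat \<Rightarrow> nat) \<Rightarrow> (nat \<Rightarrow> nat) \<Rightarrow> (nat \<times> nat) set" where
  "block_adj m p s = {(i, j). i < j \<and> j \<le> m \<and> (i = p j \<or> 1 \<le> i \<and> s i = s j)}"

lemma connected_pair_graph_crossing:
  assumes "pair_graph G" and "connected (with_proj G)" and "W \<subseteq> pverts G" "W \<noteq> {}" "W \<noteq> pverts G"
  shows "\<exists>a b. (a, b) \<in> parcs G \<and> a \<in> W \<and> b \<in> pverts G - W"
proof (rule ccontr)
  assume no: "\<not> ?thesis"
  interpret pair_graph G by fact
  have sym: "sym (parcs G)" using pair_sym_arcs by (simp add: symmetric_def)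
  obtain x y where xy: "x \<in> W" "y \<in> pverts G" "y \<notin> W" using assms by blast
  have "(x, y) \<in> rtrancl_on (pverts G) (parcs (mk_symmetric (with_proj G)))"
    using assms(2,3) xy by (auto simp: connected_def strongly_connected_def reachable_def)
  moreover have "parcs (mk_symmetric (with_proj G)) = parcs G"
    using sym by (auto simp: parcs_mk_symmetric sym_def)
  ultimately have "(x, y) \<in> rtrancl_on (pverts G) (parcs G)" by simp
  then have "y \<in> W"
  proof (induction rule: rtrancl_on_induct)
    case (step y z)
    then show ?case using no by blast
  qed (use xy in simp)
  then show False using xy by simp
qed

text \<open>
  Numberings all of whose initial segments are connected, built by adding a neighbour of the vertices
  already numbered.
\<close>

lemma connected_pair_graph_order:
  assumes "pair_graph G" and "connected (with_proj G)" and "1 \<le> k" "k \<le> card (pverts G)"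
  shows "\<exists>xs. length xs = k \<and> distinct xs \<and> set xs \<subseteq> pverts G \<and>
           (\<forall>j<k. 1 \<le> j \<longrightarrow> (\<exists>i<j. (xs ! i, xs ! j) \<in> parcs G))"
  using assms(3,4)
proof (induction k rule: nat_induct_at_least)
  case base
  then obtain x where "x \<in> pverts G" by fastforce
  then show ?case by (intro exI[of _ "[x]"]) auto
next
  case (Suc k)
  then obtain xs where xs: "length xs = k" "distinct xs" "set xs \<subseteq> pverts G"
    "\<forall>j<k. 1 \<le> j \<longrightarrow> (\<exists>i<j. (xs ! i, xs ! j) \<in> parcs G)" by auto
  have "card (set xs) = k" using xs distinct_card by metis
  then have "set xs \<noteq> pverts G" "set xs \<noteq> {}" using Suc by auto
  then obtain a b where ab: "(a, b) \<in> parcs G" "a \<in> set xs" "b \<in> pverts G - set xs"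
    using connected_pair_graph_crossing[OF assms(1,2) xs(3)] by blast
  then obtain i where i: "i < k" "xs ! i = a" using xs by (auto simp: in_set_conv_nth)
  have "\<exists>i<j. ((xs @ [b]) ! i, (xs @ [b]) ! j) \<in> parcs G" if j: "j < Suc k" "1 \<le> j" for j
  proof (cases "j = k")
    case True
    then show ?thesis using i ab xs by (intro exI[of _ i]) (auto simp: nth_append)
  next
    case False
    then obtain i' where "i' < j" "(xs ! i', xs ! j) \<in> parcs G" using xs(4)[rule_format, of j] j by (metis less_Suc_eq)
    then show ?thesis using xs j False by (intro exI[of _ i']) (auto simp: nth_append)
  qed
  then show ?case using xs ab by (intro exI[of _ "xs @ [b]"]) auto
qed

text \<open>
  In an order with connected initial segments, two earlier neighbours of \<open>j\<close> are joined by a walk through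
  vertices before \<open>j\<close>, which avoids \<open>j\<close>; so they are adjacent by \<open>chordal_diamond_free_walk_closes\<close>.
  Hence \<open>j\<close> and its earlier neighbours \<open>N j\<close> form a clique, and \<open>p j\<close> and \<open>s j\<close> are its two least
  elements.
\<close>

lemma block_parents_exist:
  fixes G :: "'a pair_pre_digraph"
  assumes pg: "pair_graph G" and conn: "connected (with_proj G)" and two: "2 \<le> card (pverts G)"
    and chordal: "chordal G"
    and cl: "\<And>C D. maximal_clique G C \<Longrightarrow> maximal_clique G D \<Longrightarrow> C \<noteq> D \<Longrightarrow> card (C \<inter> D) \<le> 1"
  obtains m lab p s where "1 \<le> m" "bij_betw lab (pverts G) {..m}" "block_parents m p s"
    "\<And>x y. x \<in> pverts G \<Longrightarrow> y \<in> pverts G \<Longrightarrow> (x, y) \<in> parcs G \<longleftrightarrow>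
       (lab x, lab y) \<in> block_adj m p s \<or> (lab y, lab x) \<in> block_adj m p s"
proof -
  interpret pair_graph G by fact
  let ?V = "pverts G" and ?E = "parcs G"
  have sym: "sym ?E" using pair_sym_arcs by (simp add: symmetric_def)
  then have sym': "(x, y) \<in> ?E \<Longrightarrow> (y, x) \<in> ?E" for x y by (meson symD)
  have wf: "?E \<subseteq> ?V \<times> ?V" using in_arcsD1 in_arcsD2 by auto
  have irr: "(x, x) \<notin> ?E" for x using pair_no_loops by fastforce
  have diamond: "(c, d) \<in> ?E" if "(a, b) \<in> ?E" "(c, a) \<in> ?E" "(c, b) \<in> ?E" "(d, a) \<in> ?E" "(d, b) \<in> ?E" "c \<noteq> d"
    for a b c d
    using cliques_share_edge_diamond[OF pair_finite_verts sym wf cl that(1) _ that(2-)] irr that(1) by blast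
  define m where "m = card ?V - 1"
  obtain xs where xs: "length xs = card ?V" "distinct xs" "set xs \<subseteq> ?V"
    and earlier: "\<And>j. j < card ?V \<Longrightarrow> 1 \<le> j \<Longrightarrow> \<exists>i<j. (xs ! i, xs ! j) \<in> ?E"
    using connected_pair_graph_order[OF pg conn, of "card ?V"] two by auto
  have setxs: "set xs = ?V" using xs pair_finite_verts by (metis card_subset_eq distinct_card)
  have cV: "card ?V = Suc m" using two by (simp add: m_def)
  define E where "E = {(i, j). i \<le> m \<and> j \<le> m \<and> (xs ! i, xs ! j) \<in> ?E}"
  have Esym: "(i, j) \<in> E \<Longrightarrow> (j, i) \<in> E" for i j using sym' by (auto simp: E_def)
  have Eirr: "(i, i) \<notin> E" for i using irr by (auto simp: E_def)
  have Ediam: "(c, d) \<in> E" if "(a, b) \<in> E" "(c, a) \<in> E" "(c, b) \<in> E" "(d, a) \<in> E" "(d, b) \<in> E" "c \<noteq> d"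
    for a b c d
    using diamond[of "xs ! a" "xs ! b" "xs ! c" "xs ! d"] that xs cV
    by (auto simp: E_def nth_eq_iff_index_eq)
  have clique: "(a, b) \<in> E" if a: "(a, j) \<in> E" "a < j" and b: "(b, j) \<in> E" "b < j" and ab: "a \<noteq> b" for a b j
  proof -
    define R where "R = {(x, y). x < j \<and> y < j \<and> (x, y) \<in> E}"
    have Rsym: "sym (R\<^sup>*)" using Esym by (intro sym_rtrancl) (auto simp: R_def sym_def)
    have "(x, 0) \<in> R\<^sup>*" if "x < j" for x
      using that
    proof (induction x rule: less_induct)
      case (less x)
      show ?case
      proof (cases "x = 0")
        case False
        have "j \<le> m" using a by (simp add: E_def)
        then obtain i where "i < x" "(xs ! i, xs ! x) \<in> ?E" using earlier[of x] less.prems False cV by auto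
        then have "(x, i) \<in> R" "(i, 0) \<in> R\<^sup>*" using less \<open>j \<le> m\<close> sym' by (auto simp: R_def E_def)
        then show ?thesis by (rule converse_rtrancl_into_rtrancl)
      qed simp
    qed
    then have "(a, b) \<in> R\<^sup>*" using a b Rsym by (meson rtrancl_trans symD)
    then obtain k where "(a, b) \<in> R ^^ k" using rtrancl_imp_relpow by blast
    then obtain f where f: "f 0 = a" "f k = b" "\<And>i. i < k \<Longrightarrow> (f i, f (Suc i)) \<in> R"
      by (auto simp: relpow_fun_conv)
    have fj: "f i < j" if "i \<le> k" for i
      using that f(1,3) a f(2) b by (cases "i = k") (auto simp: R_def dest: le_neq_implies_less)
    have "xs ! f 0 = xs ! f k \<or> (xs ! f 0, xs ! f k) \<in> ?E"
    proof (rule chordal_diamond_free_walk_closes[OF sym wf chordal, where k = k and w = "\<lambda>i. xs ! f i" and v = "xs ! j"])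
      show "(c, d) \<in> ?E" if "(a, b) \<in> ?E" "(c, a) \<in> ?E" "(c, b) \<in> ?E" "(d, a) \<in> ?E" "(d, b) \<in> ?E" "c \<noteq> d" for a b c d
        using diamond[OF that] .
      show "\<forall>i<k. (xs ! f i, xs ! f (Suc i)) \<in> ?E" using f by (auto simp: R_def E_def)
      show "\<forall>i\<le>k. xs ! f i \<noteq> xs ! j"
      proof (intro allI impI)
        fix i assume "i \<le> k"
        then have "f i < j" "j \<le> m" using fj a by (auto simp: E_def)
        then show "xs ! f i \<noteq> xs ! j" using xs cV by (simp add: nth_eq_iff_index_eq)
      qed
      show "(xs ! j, xs ! f 0) \<in> ?E" "(xs ! j, xs ! f k) \<in> ?E" using f a b sym' by (auto simp: E_def)
    qed
    then show ?thesis using f ab a b xs cV by (auto simp: E_def nth_eq_iff_index_eq)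
  qed
  define N where "N j = {i. i < j \<and> (i, j) \<in> E}" for j
  define p where "p j = Min (N j)" for j
  define s where "s j = Min (insert j (N j) - {p j})" for j
  have finN: "finite (N j)" for j by (rule finite_subset[of _ "{..<j}"]) (auto simp: N_def)
  have pN: "p j \<in> N j" if j: "j \<in> {1..m}" for j
  proof -
    obtain i where "i < j" "(xs ! i, xs ! j) \<in> ?E" using earlier[of j] j cV by auto
    then have "i \<in> N j" using j by (auto simp: N_def E_def)
    then have "N j \<noteq> {}" by blast
    then show ?thesis using finN unfolding p_def by simp
  qed
  have p_le: "p j \<le> i" if "i \<in> N j" for i j using that finN by (simp add: p_def)
  have sN: "s j \<in> insert j (N j) - {p j}" if "j \<in> {1..m}" for j
  proof -
    have "j \<in> insert j (N j) - {p j}" using pN[OF that] by (auto simp: N_def)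
    then show ?thesis unfolding s_def using finN by (intro Min_in) auto
  qed
  have s_le: "s j \<le> i" if "i \<in> insert j (N j) - {p j}" for i j using that finN by (simp add: s_def)
  \<comment> \<open>An earlier neighbour i of j other than \<open>p j\<close> sees the same clique: \<open>p j\<close> and i are both adjacent to
    the vertices concerned, so the diamond condition identifies \<open>N i\<close> with the part of \<open>N j\<close> before i.\<close>
  have block: "p i = p j \<and> s i = s j" if j: "j \<in> {1..m}" and i: "i \<in> N j" "i \<noteq> p j" for i j
  proof -
    have ij: "i < j" "(i, j) \<in> E" using i by (auto simp: N_def)
    have pj: "p j < j" "(p j, j) \<in> E" "p j < i" using pN[OF j] p_le[OF i(1)] i by (auto simp: N_def)
    have e: "(p j, i) \<in> E" using clique[OF pj(2,1) ij(2,1)] i by blast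
    then have pjNi: "p j \<in> N i" using pj by (simp add: N_def)
    have i1: "i \<in> {1..m}" using pj ij j by auto
    have pi: "p i < i" "(p i, i) \<in> E" using pN[OF i1] by (auto simp: N_def)
    have iff: "k \<in> N i \<longleftrightarrow> k \<in> N j" if "k < i" "k \<noteq> p j" for k
    proof
      assume "k \<in> N i"
      then have "(k, i) \<in> E" by (simp add: N_def)
      moreover then have "(k, p j) \<in> E" using clique[of k i "p j"] that e pj by auto
      ultimately have "(k, j) \<in> E" using Ediam[of "p j" i k j] e that pj ij Esym by auto
      then show "k \<in> N j" using that ij by (simp add: N_def)
    next
      assume "k \<in> N j"
      then have "(k, i) \<in> E" using clique[of k j i] ij that by (auto simp: N_def)
      then show "k \<in> N i" using that by (simp add: N_def)
    qed
    have pp: "p i = p j"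
    proof (rule ccontr)
      assume ne: "p i \<noteq> p j"
      then have "p i \<in> N j" using iff[of "p i"] pi pN[OF i1] by auto
      then show False using p_le[OF pjNi] p_le[of "p i" j] ne by simp
    qed
    have "s i = s j"
    proof (rule antisym)
      have sj: "s j \<in> insert j (N j)" "s j \<noteq> p j" using sN[OF j] by auto
      have "s j \<le> i" using s_le[of i j] i by auto
      then have "s j \<in> insert i (N i) - {p i}" using sj iff[of "s j"] ij pp by (cases "s j = i") auto
      then show "s i \<le> s j" by (rule s_le)
      have si: "s i \<in> insert i (N i)" "s i \<noteq> p i" using sN[OF i1] by auto
      then have "s i \<in> insert j (N j) - {p j}" using iff[of "s i"] i pp by (cases "s i = i") (auto simp: N_def)
      then show "s j \<le> s i" by (rule s_le)
    qed
    then show ?thesis using pp by simp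
  qed
  have bp: "block_parents m p s"
    unfolding block_parents_def
  proof (intro ballI conjI)
    fix j assume j: "j \<in> {1..m}"
    show "p j < j" using pN[OF j] by (simp add: N_def)
    show "s j \<le> j" using s_le[of j j] pN[OF j] by (auto simp: N_def)
    have "p j < s j" using sN[OF j] p_le[of "s j" j] \<open>p j < j\<close> by fastforce
    then show "1 \<le> s j" by simp
    show "s (s j) = s j" "p (s j) = p j" using sN[OF j] block[OF j, of "s j"] by auto
  qed
  have adj: "(i, j) \<in> E \<longleftrightarrow> (i, j) \<in> block_adj m p s" if ij: "i < j" "j \<le> m" for i j
  proof
    assume "(i, j) \<in> E"
    then have "i \<in> N j" using ij by (simp add: N_def)
    then have "i = p j \<or> p j < i \<and> s i = s j" using block[of j i] p_le[of i j] ij by fastforce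
    then show "(i, j) \<in> block_adj m p s" using ij by (auto simp: block_adj_def)
  next
    assume "(i, j) \<in> block_adj m p s"
    then consider "i = p j" | "1 \<le> i" "s i = s j" by (auto simp: block_adj_def)
    then show "(i, j) \<in> E"
    proof cases
      case 1 then show ?thesis using pN[of j] ij by (auto simp: N_def)
    next
      case 2
      have j1: "j \<in> {1..m}" and i1: "i \<in> {1..m}" using 2 ij by auto
      have si: "s i \<in> insert i (N i) - {p i}" and sj: "s i \<in> insert j (N j) - {p j}"
        using sN[OF i1] sN[OF j1] 2 by auto
      have "s i \<le> i" using bp i1 by (auto simp: block_parents_def)
      then have siNj: "s i \<in> N j" using sj ij by auto
      show ?thesis
      proof (cases "s i = i")
        case True then show ?thesis using siNj by (simp add: N_def)
      next
        case False
        then have siNi: "s i \<in> N i" using si by auto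
        have pp: "p i = p j" using bp i1 j1 2 unfolding block_parents_def by metis
        have "(s i, i) \<in> E" "(s i, j) \<in> E" "(p i, i) \<in> E" "(p i, j) \<in> E"
          using siNi siNj pN[OF i1] pN[OF j1] pp by (auto simp: N_def)
        moreover have "(p i, s i) \<in> E" using clique[of "p i" i "s i"] siNi pN[OF i1] si by (auto simp: N_def)
        ultimately show ?thesis using Ediam[of "p i" "s i" i j] Esym ij by blast
      qed
    qed
  qed
  define lab where "lab = the_inv_into {..m} ((!) xs)"
  have bij: "bij_betw ((!) xs) {..m} ?V"
    using bij_betw_nth[OF xs(2)] setxs xs(1) cV by (metis lessThan_Suc_atMost)
  have labbij: "bij_betw lab ?V {..m}" unfolding lab_def by (rule bij_betw_the_inv_into[OF bij])
  have xslab: "xs ! lab x = x" "lab x \<le> m" if "x \<in> ?V" for x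
    using that bij labbij unfolding lab_def
    by (auto simp: bij_betw_def f_the_inv_into_f)
  show thesis
  proof (rule that[of m lab p s])
    show "1 \<le> m" using two by (simp add: m_def)
    fix x y assume xy: "x \<in> ?V" "y \<in> ?V"
    have "(x, y) \<in> ?E \<longleftrightarrow> (lab x, lab y) \<in> E" using xy xslab by (simp add: E_def)
    also have "\<dots> \<longleftrightarrow> (lab x, lab y) \<in> block_adj m p s \<or> (lab y, lab x) \<in> block_adj m p s"
    proof (cases "lab x" "lab y" rule: linorder_cases)
      case less then show ?thesis using adj xslab xy by (auto simp: block_adj_def)
    next
      case equal then show ?thesis using Eirr by (auto simp: block_adj_def)
    next
      case greater
      have "(lab x, lab y) \<in> E \<longleftrightarrow> (lab y, lab x) \<in> E" using Esym by blast
      then show ?thesis using adj[of "lab y" "lab x"] greater xslab xy by (auto simp: block_adj_def)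
    qed
    finally show "(x, y) \<in> ?E \<longleftrightarrow> (lab x, lab y) \<in> block_adj m p s \<or> (lab y, lab x) \<in> block_adj m p s" .
  qed (use labbij bp in auto)
qed

section \<open>Polynomials as finitely supported maps\<close>

abbreviation lookup where "lookup \<equiv> Poly_Mapping.lookup"
abbreviation keys where "keys \<equiv> Poly_Mapping.keys"
abbreviation single where "single \<equiv> Poly_Mapping.single"
abbreviation PR where "PR n \<equiv> carrier (poly_ring n)"
abbreviation Cst :: "'k::field \<Rightarrow> 'k mpoly" where "Cst c \<equiv> single 0 c"

lemma poly_ring_simps [simp]:
  "x \<otimes>\<^bsub>poly_ring n\<^esub> y = x * y" "x \<oplus>\<^bsub>poly_ring n\<^esub> y = x + y"
  "\<one>\<^bsub>poly_ring n\<^esub> = 1" "\<zero>\<^bsub>poly_ring n\<^esub> = 0"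
  by (simp_all add: poly_ring_def)

lemma sum_singles: "(\<Sum>t\<in>keys p. single t (lookup p t)) = p"
  by (rule poly_mapping_eqI)
    (auto simp: lookup_sum lookup_single when_def sum.delta' not_in_keys_iff_lookup_eq_zero)

lemma single_eq_Cst_xmon: "single t c = Cst c * xmon t"
  by (simp add: xmon_def mult_single)

lemma xmon_add: "xmon (s + t) = xmon s * xmon t"
  by (simp add: xmon_def mult_single)

lemma xmon_zero [simp]: "xmon 0 = 1"
  by (simp add: xmon_def)

lemma keys_xmon [simp]: "keys (xmon t :: 'k::field mpoly) = {t}"
  by (simp add: xmon_def)

lemma xmon_neq_0 [simp]: "xmon t \<noteq> (0 :: 'k::field mpoly)"
  by (metis keys_xmon keys_zero insert_not_empty)

lemma xmon_inject [simp]: "xmon s = (xmon t :: 'k::field mpoly) \<longleftrightarrow> s = t"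
  by (metis keys_xmon singleton_inject)

lemma lookup_xmon: "lookup (xmon t :: 'k::field mpoly) s = (if s = t then 1 else 0)"
  by (auto simp: xmon_def lookup_single when_def)

lemma keys_xmon_mult: "keys (xmon u * p) = (\<lambda>t. u + t) ` keys (p :: 'k::field mpoly)"
proof -
  have "lookup (xmon u * p) (u + t) = lookup p t" for t
  proof -
    have "xmon u * p = (\<Sum>r\<in>keys p. single (u + r) (lookup p r))"
      by (subst (1) sum_singles[of p, symmetric])
        (simp add: xmon_def sum_distrib_left mult_single)
    then show ?thesis
      by (simp add: lookup_sum lookup_single when_def sum.delta' not_in_keys_iff_lookup_eq_zero)
  qed
  moreover have "keys (xmon u * p) \<subseteq> (\<lambda>t. u + t) ` keys p"
    using keys_mult[of "xmon u" p] by auto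
  ultimately show ?thesis by (auto simp: in_keys_iff)
qed

section \<open>Carriers\<close>

lemma PR_add [simp, intro]: "p \<in> PR n \<Longrightarrow> q \<in> PR n \<Longrightarrow> p + q \<in> PR n"
  using cring.cring_simprules(1)[OF cring_poly_ring] by fastforce

lemma PR_mult [simp, intro]: "p \<in> PR n \<Longrightarrow> q \<in> PR n \<Longrightarrow> p * q \<in> PR n"
  using cring.cring_simprules(5)[OF cring_poly_ring] by fastforce

lemma PR_single [simp]: "keys t \<subseteq> {..<n} \<Longrightarrow> single t c \<in> PR n"
  by (auto simp: carrier_poly_ring_iff)

lemma PR_0 [simp]: "0 \<in> PR n" and PR_1 [simp]: "1 \<in> PR n"
  by (auto simp: carrier_poly_ring_iff)

lemma PR_xmon [simp]: "xmon t \<in> PR n \<longleftrightarrow> keys t \<subseteq> {..<n}"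
  by (auto simp: carrier_poly_ring_iff)

lemma PR_uminus [simp]: "- p \<in> PR n \<longleftrightarrow> p \<in> PR n"
  by (auto simp: carrier_poly_ring_iff in_keys_iff)

lemma PR_diff [simp, intro]: "p \<in> PR n \<Longrightarrow> q \<in> PR n \<Longrightarrow> p - q \<in> PR n"
  using PR_add[of p n "- q"] by simp

lemma PR_sum [simp, intro]: "(\<And>i. i \<in> A \<Longrightarrow> f i \<in> PR n) \<Longrightarrow> sum f A \<in> PR n"
  by (induction A rule: infinite_finite_induct) auto

lemma PR_prod [simp, intro]: "(\<And>i. i \<in> A \<Longrightarrow> f i \<in> PR n) \<Longrightarrow> prod f A \<in> PR n"
  by (induction A rule: infinite_finite_induct) auto

lemma PR_power [simp, intro]: "p \<in> PR n \<Longrightarrow> p ^ k \<in> PR n"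
  by (induction k) auto

lemma PR_poly_var [simp]: "poly_var i \<in> PR n \<longleftrightarrow> i < n"
  by (auto simp: poly_var_def)

lemma PR_mono: "p \<in> PR n \<Longrightarrow> n \<le> n' \<Longrightarrow> p \<in> PR n'"
  by (fastforce simp: carrier_poly_ring_iff)

section \<open>Substitution\<close>

definition mon_ev :: "(nat \<Rightarrow> 'k::field mpoly) \<Rightarrow> expo \<Rightarrow> 'k mpoly" where
  "mon_ev \<sigma> t = (\<Prod>i\<in>keys t. \<sigma> i ^ lookup t i)"

definition subst :: "(nat \<Rightarrow> 'k::field mpoly) \<Rightarrow> 'k mpoly \<Rightarrow> 'k mpoly" where
  "subst \<sigma> p = (\<Sum>t\<in>keys p. Cst (lookup p t) * mon_ev \<sigma> t)"

lemma mon_ev_superset: "finite A \<Longrightarrow> keys t \<subseteq> A \<Longrightarrow> mon_ev \<sigma> t = (\<Prod>i\<in>A. \<sigma> i ^ lookup t i)"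
  unfolding mon_ev_def
  by (intro prod.mono_neutral_left) (auto simp: in_keys_iff)

lemma mon_ev_add: "mon_ev \<sigma> (s + t) = mon_ev \<sigma> s * mon_ev \<sigma> t"
  using keys_add[of s t]
  by (simp add: mon_ev_superset[of "keys s \<union> keys t"] lookup_add power_add prod.distrib)

lemma mon_ev_0 [simp]: "mon_ev \<sigma> 0 = 1"
  by (simp add: mon_ev_def)

lemma mon_ev_single [simp]: "mon_ev \<sigma> (single i e) = \<sigma> i ^ e"
  by (simp add: mon_ev_superset[of "{i}"])

lemma mon_ev_sum: "mon_ev \<sigma> (sum f A) = (\<Prod>a\<in>A. mon_ev \<sigma> (f a))"
  by (induction A rule: infinite_finite_induct) (auto simp: mon_ev_add)

lemma mon_ev_poly_var: "mon_ev poly_var t = (xmon t :: 'k::field mpoly)"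
proof -
  have *: "xmon (sum f A) = (\<Prod>a\<in>A. (xmon (f a) :: 'k mpoly))" for f :: "nat \<Rightarrow> expo" and A
    by (induction A rule: infinite_finite_induct) (auto simp: xmon_add)
  have **: "(poly_var i :: 'k mpoly) ^ e = xmon (single i e)" for i e
    by (induction e) (auto simp: poly_var_def xmon_add[symmetric] single_add[symmetric])
  have "mon_ev poly_var t = (xmon :: expo \<Rightarrow> 'k mpoly) (\<Sum>i\<in>keys t. single i (lookup t i))"
    unfolding mon_ev_def * ** ..
  then show ?thesis by (simp add: sum_singles)
qed

lemma subst_superset:
  "finite A \<Longrightarrow> keys p \<subseteq> A \<Longrightarrow> subst \<sigma> p = (\<Sum>t\<in>A. Cst (lookup p t) * mon_ev \<sigma> t)"
  unfolding subst_def
  by (intro sum.mono_neutral_left) (auto simp: in_keys_iff)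

lemma subst_add: "subst \<sigma> (p + q) = subst \<sigma> p + subst \<sigma> q"
  using keys_add[of p q]
  by (simp add: subst_superset[of "keys p \<union> keys q"] lookup_add single_add distrib_right sum.distrib)

lemma subst_single: "subst \<sigma> (single t c) = Cst c * mon_ev \<sigma> t"
  by (simp add: subst_superset[of "{t}"])

lemma subst_0 [simp]: "subst \<sigma> 0 = 0" by (simp add: subst_def)

lemma subst_sum: "subst \<sigma> (sum f A) = (\<Sum>a\<in>A. subst \<sigma> (f a))"
  by (induction A rule: infinite_finite_induct) (auto simp: subst_add)

lemma subst_mult: "subst \<sigma> (p * q) = subst \<sigma> p * subst \<sigma> q"
proof -
  have "subst \<sigma> (p * q) =
    subst \<sigma> ((\<Sum>s\<in>keys p. single s (lookup p s)) * (\<Sum>t\<in>keys q. single t (lookup q t)))"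
    by (simp add: sum_singles)
  also have "\<dots> = (\<Sum>s\<in>keys p. \<Sum>t\<in>keys q. (Cst (lookup p s) * mon_ev \<sigma> s) * (Cst (lookup q t) * mon_ev \<sigma> t))"
    by (simp add: sum_product subst_sum mult_single subst_single mon_ev_add mult_ac)
  also have "\<dots> = subst \<sigma> p * subst \<sigma> q"
    by (simp add: subst_def sum_product)
  finally show ?thesis .
qed

lemma subst_1 [simp]: "subst \<sigma> 1 = 1"
  using subst_single[of \<sigma> 0 1] by simp

lemma subst_uminus: "subst \<sigma> (- p) = - subst \<sigma> p"
  using subst_add[of \<sigma> p "- p"] by (simp add: eq_neg_iff_add_eq_0 add.commute)

lemma subst_diff: "subst \<sigma> (p - q) = subst \<sigma> p - subst \<sigma> q"
  using subst_add[of \<sigma> p "- q"] by (simp add: subst_uminus)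

lemma subst_xmon [simp]: "subst \<sigma> (xmon t) = mon_ev \<sigma> t"
  by (simp add: xmon_def subst_single)

lemma subst_poly_var [simp]: "subst \<sigma> (poly_var i) = \<sigma> i"
  by (simp add: poly_var_def)

lemma subst_power: "subst \<sigma> (p ^ k) = subst \<sigma> p ^ k"
  by (induction k) (auto simp: subst_mult)

lemma subst_prod: "subst \<sigma> (prod f A) = (\<Prod>a\<in>A. subst \<sigma> (f a))"
  by (induction A rule: infinite_finite_induct) (auto simp: subst_mult)

lemma subst_Cst [simp]: "subst \<sigma> (Cst c) = Cst c"
  by (simp add: subst_single)

lemma subst_id [simp]: "subst poly_var p = p"
  by (simp add: subst_def mon_ev_poly_var single_eq_Cst_xmon[symmetric] sum_singles)

lemma subst_subst: "subst \<tau> (subst \<sigma> p) = subst (\<lambda>i. subst \<tau> (\<sigma> i)) p"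
  by (simp add: subst_def[of _ p] subst_def[of \<sigma> p] subst_sum subst_mult mon_ev_def subst_prod subst_power)

lemma subst_cong: "(\<And>t i. t \<in> keys p \<Longrightarrow> i \<in> keys t \<Longrightarrow> \<sigma> i = \<tau> i) \<Longrightarrow> subst \<sigma> p = subst \<tau> p"
  unfolding subst_def mon_ev_def
  by (intro sum.cong prod.cong arg_cong2[of _ _ _ _ "(*)"] refl) auto

lemma subst_cong_PR: "p \<in> PR n \<Longrightarrow> (\<And>i. i < n \<Longrightarrow> \<sigma> i = \<tau> i) \<Longrightarrow> subst \<sigma> p = subst \<tau> p"
  by (rule subst_cong) (auto simp: carrier_poly_ring_iff)

lemma subst_in_PR:
  assumes "p \<in> PR k" "\<And>i. i < k \<Longrightarrow> \<sigma> i \<in> PR n"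
  shows "subst \<sigma> p \<in> PR n"
  unfolding subst_def mon_ev_def
  by (intro PR_sum PR_mult PR_prod PR_power PR_single assms(2))
    (use assms(1) in \<open>auto simp: carrier_poly_ring_iff\<close>)

lemma subst_in_PR': "(\<And>i. \<sigma> i \<in> PR n) \<Longrightarrow> subst \<sigma> p \<in> PR n"
  unfolding subst_def mon_ev_def
  by (intro PR_sum PR_mult PR_prod PR_power PR_single) auto

section \<open>Ideals\<close>

text \<open>
  The whole type of polynomials is a commutative ring in infinitely many variables, where ideals are the
  spans of this module. Ideals of the subring in the first \<open>n\<close> variables are traces of such spans
  (\<open>genideal_poly_ring\<close>), so most computations need no carrier conditions.
\<close>

interpretation mult_module: Modules.module "(*) :: 'a::comm_ring_1 \<Rightarrow> 'a \<Rightarrow> 'a"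
  by unfold_locales (auto simp: algebra_simps)

abbreviation ispan :: "'a::comm_ring_1 set \<Rightarrow> 'a set" where "ispan \<equiv> mult_module.span"

definition retract :: "nat \<Rightarrow> 'k::field mpoly \<Rightarrow> 'k mpoly" where
  "retract n = subst (\<lambda>i. if i < n then poly_var i else 0)"

lemma retract_PR [simp]: "retract n p \<in> PR n"
  unfolding retract_def by (rule subst_in_PR') auto

lemma retract_id: "p \<in> PR n \<Longrightarrow> retract n p = p"
  unfolding retract_def using subst_cong_PR[of p n _ poly_var] by simp

lemma ideal_poly_ringI:
  assumes "J \<subseteq> PR n" "0 \<in> J" "\<And>a b. a \<in> J \<Longrightarrow> b \<in> J \<Longrightarrow> a + b \<in> J"
    "\<And>a c. a \<in> J \<Longrightarrow> c \<in> PR n \<Longrightarrow> c * a \<in> J"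
  shows "ideal J (poly_ring n)"
proof -
  interpret cring "poly_ring n :: 'a mpoly ring" by (rule cring_poly_ring)
  have inv: "\<ominus>\<^bsub>poly_ring n\<^esub> a = - a" if "a \<in> PR n" for a :: "'a mpoly"
    using that by (intro sum_zero_eq_neg[symmetric]) auto
  show ?thesis
  proof (rule idealI)
    show "ring (poly_ring n :: 'a mpoly ring)" by unfold_locales
    show "subgroup J (add_monoid (poly_ring n))"
    proof (rule add.subgroupI)
      fix a assume "a \<in> J"
      then show "\<ominus>\<^bsub>poly_ring n\<^esub> a \<in> J" using assms(4)[of a "- 1"] inv assms(1) by auto
    qed (use assms in auto)
  qed (use assms in \<open>auto simp: mult.commute\<close>)
qed

lemma ideal_poly_ringD:
  assumes "ideal J (poly_ring n)"
  shows "J \<subseteq> PR n" "0 \<in> J" "\<And>a b. a \<in> J \<Longrightarrow> b \<in> J \<Longrightarrow> a + b \<in> J"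
    "\<And>a c. a \<in> J \<Longrightarrow> c \<in> PR n \<Longrightarrow> c * a \<in> J"
    "\<And>a b. a \<in> J \<Longrightarrow> b \<in> J \<Longrightarrow> a - b \<in> J"
proof -
  interpret ideal J "poly_ring n" by fact
  show 1: "J \<subseteq> PR n" using a_subset by simp
  show "0 \<in> J" using additive_subgroup.zero_closed[OF is_additive_subgroup] by simp
  show 2: "a + b \<in> J" if "a \<in> J" "b \<in> J" for a b
    using additive_subgroup.a_closed[OF is_additive_subgroup] that by fastforce
  show 3: "c * a \<in> J" if "a \<in> J" "c \<in> PR n" for a c using I_l_closed that by fastforce
  show "a - b \<in> J" if "a \<in> J" "b \<in> J" for a b
    using 2[OF that(1) 3[OF that(2), of "- 1"]] by simp
qed

text \<open>
  Applying \<open>retract n\<close> to a representation with arbitrary coefficients yields one with coefficients in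
  the subring.
\<close>

lemma genideal_poly_ring:
  assumes "A \<subseteq> PR n"
  shows "genideal (poly_ring n) A = ispan A \<inter> PR n"
proof
  interpret cring "poly_ring n :: 'a mpoly ring" by (rule cring_poly_ring)
  have "ideal (ispan A \<inter> PR n) (poly_ring n)"
    by (rule ideal_poly_ringI) (auto intro: mult_module.span_zero mult_module.span_add mult_module.span_scale)
  then show "genideal (poly_ring n) A \<subseteq> ispan A \<inter> PR n"
    using assms by (intro genideal_minimal) (auto intro: mult_module.span_base)
  have id: "ideal (genideal (poly_ring n) A) (poly_ring n)" by (rule genideal_ideal) fact
  note J = ideal_poly_ringD[OF id]
  have "retract n x \<in> genideal (poly_ring n) A" if "x \<in> ispan A" for x
    using that
  proof (induction rule: mult_module.span_induct_alt)
    case base then show ?case using J(2) by (simp add: retract_def)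
  next
    case (step c x y)
    have "x \<in> genideal (poly_ring n) A" using step genideal_self[OF assms] by auto
    moreover have "retract n x = x" using step assms by (auto intro: retract_id)
    moreover have "retract n y \<in> genideal (poly_ring n) A" by (rule step)
    ultimately have "retract n c * x + retract n y \<in> genideal (poly_ring n) A" by (intro J(3,4)) auto
    moreover have "retract n (c * x + y) = retract n c * retract n x + retract n y"
      by (simp add: retract_def subst_add subst_mult)
    ultimately show ?case using \<open>retract n x = x\<close> by simp
  qed
  then show "ispan A \<inter> PR n \<subseteq> genideal (poly_ring n) A" using retract_id by fastforce
qed

section \<open>Divisibility of monomials and degrees\<close>

definition expo_le :: "expo \<Rightarrow> expo \<Rightarrow> bool" where
  "expo_le u t \<longleftrightarrow> (\<forall>i. lookup u i \<le> lookup t i)"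

lemma expo_le_add_diff: "expo_le u t \<Longrightarrow> u + (t - u) = t"
  by (rule poly_mapping_eqI) (simp add: expo_le_def lookup_add lookup_minus)

lemma expo_le_add [simp]: "expo_le u (u + r)"
  by (simp add: expo_le_def lookup_add)

lemma expo_le_refl [simp]: "expo_le u u" by (simp add: expo_le_def)

lemma expo_le_keys: "expo_le u t \<Longrightarrow> keys u \<subseteq> keys t"
  unfolding expo_le_def by (auto simp: in_keys_iff) (meson less_le_trans)

lemma expo_deg_superset: "finite A \<Longrightarrow> keys t \<subseteq> A \<Longrightarrow> expo_deg t = (\<Sum>i\<in>A. lookup t i)"
  unfolding expo_deg_def by (intro sum.mono_neutral_left) (auto simp: in_keys_iff)

lemma expo_deg_add: "expo_deg (s + t) = expo_deg s + expo_deg t"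
  using keys_add[of s t] by (simp add: expo_deg_superset[of "keys s \<union> keys t"] lookup_add sum.distrib)

lemma expo_deg_single [simp]: "expo_deg (single i e) = e"
  by (simp add: expo_deg_superset[of "{i}"])

lemma expo_deg_0 [simp]: "expo_deg 0 = 0" by (simp add: expo_deg_def)

lemma expo_deg_eq_0 [simp]: "expo_deg t = 0 \<longleftrightarrow> t = 0"
  by (auto simp: expo_deg_def in_keys_iff intro!: poly_mapping_eqI)

lemma expo_deg_sum: "expo_deg (sum f A) = (\<Sum>a\<in>A. expo_deg (f a))"
  by (induction A rule: infinite_finite_induct) (auto simp: expo_deg_add)

lemma expo_le_deg: "expo_le u t \<Longrightarrow> expo_deg u \<le> expo_deg t"
  using expo_deg_add[of u "t - u"] by (simp add: expo_le_add_diff)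

lemma expo_le_deg_eq: "expo_le u t \<Longrightarrow> expo_deg t \<le> expo_deg u \<Longrightarrow> u = t"
  using expo_deg_add[of u "t - u"] expo_le_add_diff[of u t] by auto

lemma xmon_dvd_factor:
  assumes "\<And>t. t \<in> keys p \<Longrightarrow> expo_le u t"
  shows "p = xmon u * (\<Sum>t\<in>keys p. single (t - u) (lookup p t))"
proof -
  have "p = (\<Sum>t\<in>keys p. single t (lookup p t))" by (simp add: sum_singles)
  also have "\<dots> = (\<Sum>t\<in>keys p. xmon u * single (t - u) (lookup p t))"
    using assms by (intro sum.cong) (auto simp: xmon_def mult_single expo_le_add_diff)
  finally show ?thesis by (simp add: sum_distrib_left)
qed

lemma keys_multD: "t \<in> keys (p * q) \<Longrightarrow> \<exists>r s. r \<in> keys p \<and> s \<in> keys q \<and> t = r + (s :: expo)"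
  using keys_mult[of p q] by blast

lemma lookup_Cst_mult: "lookup (Cst c * p) t = c * lookup p t"
proof -
  have "Cst c * p = (\<Sum>s\<in>keys p. single s (c * lookup p s))"
    by (subst (1) sum_singles[of p, symmetric]) (simp add: sum_distrib_left mult_single)
  then show ?thesis
    by (simp add: lookup_sum lookup_single when_def sum.delta' not_in_keys_iff_lookup_eq_zero)
qed

text \<open>
  When no monomial of \<open>g\<close> has degree below that of \<open>t\<close>, only the constant term of \<open>B\<close> can contribute to
  the coefficient of \<open>t\<close> in \<open>B * g\<close>.
\<close>

lemma lookup_mult_low_degree:
  fixes B g :: "'k::field mpoly"
  assumes "\<And>s. s \<in> keys g \<Longrightarrow> expo_deg t \<le> expo_deg s"
  shows "lookup (B * g) t = lookup B 0 * lookup g t"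
proof -
  define B' where "B' = B - Cst (lookup B 0)"
  have "t \<notin> keys (B' * g)"
  proof
    assume "t \<in> keys (B' * g)"
    then obtain r s where rs: "r \<in> keys B'" "s \<in> keys g" "t = r + s" using keys_multD by blast
    then have "r = 0" using assms[of s] by (simp add: expo_deg_add)
    then show False using rs by (simp add: B'_def in_keys_iff lookup_minus)
  qed
  moreover have "B * g = Cst (lookup B 0) * g + B' * g" by (simp add: B'_def algebra_simps)
  ultimately show ?thesis by (simp add: lookup_add lookup_Cst_mult in_keys_iff)
qed

lemma ideal_of_monomials_iff:
  assumes "\<And>u. u \<in> M \<Longrightarrow> keys u \<subseteq> {..<n}"
  shows "p \<in> ideal_of_monomials n M \<longleftrightarrow> p \<in> PR n \<and> (\<forall>t\<in>keys p. \<exists>u\<in>M. expo_le u t)"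
proof -
  have eq: "ideal_of_monomials n M = ispan (xmon ` M) \<inter> PR n"
    unfolding ideal_of_monomials_def by (rule genideal_poly_ring) (use assms in auto)
  have "\<forall>t\<in>keys p. \<exists>u\<in>M. expo_le u t" if "p \<in> ispan (xmon ` M)"
    using that
  proof (induction rule: mult_module.span_induct_alt)
    case (step c x y)
    then obtain u where u: "u \<in> M" "x = xmon u" by auto
    show ?case
    proof
      fix t assume "t \<in> keys (c * x + y)"
      then have "t \<in> keys (x * c) \<or> t \<in> keys y" using keys_add[of "c * x" y] by (auto simp: mult.commute)
      then show "\<exists>u\<in>M. expo_le u t"
      proof
        assume "t \<in> keys (x * c)"
        then show ?thesis using u by (intro bexI[of _ u]) (auto simp: keys_xmon_mult)
      qed (use step in auto)
    qed
  qed auto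
  moreover have "p \<in> ispan (xmon ` M)" if *: "\<forall>t\<in>keys p. \<exists>u\<in>M. expo_le u t"
  proof -
    have "single t (lookup p t) \<in> ispan (xmon ` M)" if t: "t \<in> keys p" for t
    proof -
      obtain u where "u \<in> M" "expo_le u t" using * t by blast
      then have "single t (lookup p t) = single (t - u) (lookup p t) * xmon u"
        by (simp add: xmon_def mult_single expo_le_add_diff add.commute)
      then show ?thesis using \<open>u \<in> M\<close> by (auto intro: mult_module.span_scale mult_module.span_base)
    qed
    then have "(\<Sum>t\<in>keys p. single t (lookup p t)) \<in> ispan (xmon ` M)" by (rule mult_module.span_sum)
    then show ?thesis by (simp add: sum_singles)
  qed
  ultimately show ?thesis using eq by auto
qed

section \<open>Splitting a polynomial by its monomials\<close>

definition mrestrict :: "(expo \<Rightarrow> bool) \<Rightarrow> 'k::field mpoly \<Rightarrow> 'k mpoly" where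
  "mrestrict P p = (\<Sum>t\<in>{t\<in>keys p. P t}. single t (lookup p t))"

lemma lookup_mrestrict: "lookup (mrestrict P p) t = (if P t then lookup p t else 0)"
  by (auto simp: mrestrict_def lookup_sum lookup_single when_def sum.delta' not_in_keys_iff_lookup_eq_zero)

lemma keys_mrestrict: "keys (mrestrict P p) = {t\<in>keys p. P t}"
  by (auto simp: in_keys_iff lookup_mrestrict split: if_splits)

lemma mrestrict_split: "p = mrestrict P p + mrestrict (\<lambda>t. \<not> P t) p"
  by (rule poly_mapping_eqI) (simp add: lookup_add lookup_mrestrict)

lemma mrestrict_PR: "p \<in> PR n \<Longrightarrow> mrestrict P p \<in> PR n"
  by (auto simp: carrier_poly_ring_iff keys_mrestrict)

lemma xmon_dvd_factor_PR:
  fixes p :: "'k::field mpoly"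
  assumes "\<And>t. t \<in> keys p \<Longrightarrow> expo_le u t" "p \<in> PR n"
  obtains q where "p = xmon u * q" "q \<in> PR n"
proof -
  let ?q = "\<Sum>t\<in>keys p. single (t - u) (lookup p t) :: 'k mpoly"
  have "p = xmon u * ?q" using assms(1) by (rule xmon_dvd_factor)
  moreover have "keys (t - u) \<subseteq> keys t" for t :: expo by (auto simp: in_keys_iff lookup_minus)
  then have "?q \<in> PR n" using assms(2) by (intro PR_sum PR_single) (auto simp: carrier_poly_ring_iff)
  ultimately show ?thesis by (rule that)
qed

lemma poly_var_power: "(poly_var i :: 'k::field mpoly) ^ e = xmon (single i e)"
  using mon_ev_poly_var[of "single i e", where 'k = 'k] by simp

lemma expo_le_single_iff: "expo_le (single i e) t \<longleftrightarrow> e \<le> lookup t i"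
  by (auto simp: expo_le_def lookup_single when_def)

text \<open>
  \<open>poly_var r ^ e\<close> is the largest power of the last variable dividing \<open>F\<close>, and \<open>G0\<close> is the part of the
  quotient that is free of this variable.
\<close>

lemma factor_var_power:
  fixes F :: "'k::field mpoly"
  assumes F: "F \<in> PR (Suc r)" "F \<noteq> 0"
  obtains e G0 G1 where "F = poly_var r ^ e * (G0 + poly_var r * G1)" "G0 \<in> PR r" "G0 \<noteq> 0" "G1 \<in> PR (Suc r)"
proof -
  let ?L = "(\<lambda>t. lookup t r) ` keys F"
  define e where "e = Min ?L"
  have "keys F \<noteq> {}" using F(2) by (metis sum_singles sum.empty)
  then have emin: "e \<in> ?L" "\<And>t. t \<in> keys F \<Longrightarrow> e \<le> lookup t r" unfolding e_def by (auto intro: Min_in)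
  then obtain t0 where t0: "t0 \<in> keys F" "lookup t0 r = e" by auto
  obtain G where G: "F = xmon (single r e) * G" "G \<in> PR (Suc r)"
    using xmon_dvd_factor_PR[of F "single r e" "Suc r"] emin(2) F(1) by (metis expo_le_single_iff)
  define G0 where "G0 = mrestrict (\<lambda>t. lookup t r = 0) G"
  have "mrestrict (\<lambda>t. lookup t r \<noteq> 0) G \<in> PR (Suc r)" using G by (simp add: mrestrict_PR)
  then obtain G1 where G1: "mrestrict (\<lambda>t. lookup t r \<noteq> 0) G = xmon (single r 1) * G1" "G1 \<in> PR (Suc r)"
    by (rule xmon_dvd_factor_PR[of _ "single r 1" "Suc r", rotated]) (auto simp: keys_mrestrict expo_le_single_iff)
  obtain t1 where t1: "t1 \<in> keys G" "t0 = single r e + t1" using t0(1) G(1) by (auto simp: keys_xmon_mult)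
  then have "lookup t1 r = 0" using t0(2) by (simp add: lookup_add)
  then have "lookup G0 t1 \<noteq> 0" using t1 by (simp add: G0_def lookup_mrestrict in_keys_iff)
  then have "G0 \<noteq> 0" by auto
  moreover have "G0 \<in> PR r"
    unfolding carrier_poly_ring_iff
  proof (intro ballI subsetI)
    fix t i assume "t \<in> keys G0" "i \<in> keys t"
    then have "t \<in> keys G" "lookup t r = 0" "i \<in> keys t" by (auto simp: G0_def keys_mrestrict)
    then have "keys t \<subseteq> {..<Suc r}" "i \<noteq> r" using G(2) by (auto simp: carrier_poly_ring_iff in_keys_iff)
    then have "i < Suc r" "i \<noteq> r" using \<open>i \<in> keys t\<close> by auto
    then show "i \<in> {..<r}" by simp
  qed
  moreover have "F = poly_var r ^ e * (G0 + poly_var r * G1)"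
    using G(1) G1(1) mrestrict_split[of G "\<lambda>t. lookup t r = 0"]
    by (simp add: poly_var_power G0_def) (simp add: poly_var_def)
  ultimately show ?thesis using G1(2) that by blast
qed

section \<open>Algebraic independence modulo an ideal\<close>

definition alg_indep_mod :: "'k::field mpoly set \<Rightarrow> 'k mpoly list \<Rightarrow> bool" where
  "alg_indep_mod J fs \<longleftrightarrow> (\<forall>F\<in>PR (length fs). subst (nth fs) F \<in> J \<longrightarrow> F = 0)"

lemma alg_indep_mod_mono: "alg_indep_mod Q fs \<Longrightarrow> J \<subseteq> Q \<Longrightarrow> alg_indep_mod J fs"
  unfolding alg_indep_mod_def by blast

lemma subst_nth_PR: "set fs \<subseteq> PR n \<Longrightarrow> F \<in> PR (length fs) \<Longrightarrow> subst (nth fs) F \<in> PR n"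
  by (rule subst_in_PR) (auto dest: nth_mem)

lemma PR_0_Cst:
  assumes "F \<in> PR 0"
  shows "F = Cst (lookup F 0)"
proof (rule poly_mapping_eqI)
  fix t
  have "t = 0" if "t \<in> keys F" using assms that by (auto simp: carrier_poly_ring_iff in_keys_iff intro!: poly_mapping_eqI)
  then show "lookup F t = lookup (Cst (lookup F 0)) t"
    by (cases "t = 0") (auto simp: lookup_single when_def in_keys_iff)
qed

lemma alg_indep_mod_Nil:
  assumes "ideal Q (poly_ring n)" "1 \<notin> Q"
  shows "alg_indep_mod Q []"
  unfolding alg_indep_mod_def
proof (intro ballI impI)
  fix F :: "'a mpoly" assume F: "F \<in> PR (length [])" "subst (nth []) F \<in> Q"
  then have FC: "F = Cst (lookup F 0)" using PR_0_Cst by simp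
  then have "Cst (lookup F 0) \<in> Q" using F(2) by (metis subst_Cst)
  then have *: "Cst (1 / lookup F 0) * Cst (lookup F 0) \<in> Q" by (intro ideal_poly_ringD(4)[OF assms(1)]) auto
  have "lookup F 0 = 0"
  proof (rule ccontr)
    assume "lookup F 0 \<noteq> 0"
    then have "Cst (1 / lookup F 0) * Cst (lookup F 0) = 1" by (simp add: mult_single)
    then show False using * assms(2) by simp
  qed
  then show "F = 0" using FC by simp
qed

text \<open>
  Let \<open>F(fs, f) \<in> J\<close>. The largest power of the last variable dividing \<open>F\<close> can be cancelled because \<open>f\<close> is a
  nonzerodivisor modulo \<open>J\<close>; reducing the rest modulo \<open>Q\<close>, which contains \<open>f\<close>, leaves a nontrivial relation
  among \<open>fs\<close> modulo \<open>Q\<close>.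
\<close>

lemma alg_indep_mod_extend:
  assumes Q: "ideal Q (poly_ring n)" and J: "J \<subseteq> Q"
    and f: "f \<in> Q" and fs: "set fs \<subseteq> PR n"
    and nzd: "\<And>a. a \<in> PR n \<Longrightarrow> f * a \<in> J \<Longrightarrow> a \<in> J"
    and indep: "alg_indep_mod Q fs"
  shows "alg_indep_mod J (fs @ [f])"
  unfolding alg_indep_mod_def
proof (intro ballI impI)
  let ?r = "length fs" let ?\<phi> = "subst (nth (fs @ [f]))"
  fix F :: "'a mpoly" assume F: "F \<in> PR (length (fs @ [f]))" "?\<phi> F \<in> J"
  show "F = 0"
  proof (rule ccontr)
    assume "F \<noteq> 0"
    with F(1) obtain e G0 G1 where G: "F = poly_var ?r ^ e * (G0 + poly_var ?r * G1)"
      "G0 \<in> PR ?r" "G0 \<noteq> 0" "G1 \<in> PR (Suc ?r)" using factor_var_power[of F ?r] by auto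
    have fn: "f \<in> PR n" using f ideal_poly_ringD(1)[OF Q] by blast
    have H: "?\<phi> (G0 + poly_var ?r * G1) \<in> PR n"
      by (rule subst_nth_PR) (use fn fs G(4) PR_mono[OF G(2), of "Suc ?r"] in auto)
    have pow: "f ^ k * a \<in> J \<Longrightarrow> a \<in> PR n \<Longrightarrow> a \<in> J" for k a
    proof (induction k)
      case (Suc k)
      have "f * (f ^ k * a) \<in> J" using Suc.prems(1) by (simp only: power_Suc mult.assoc)
      then have "f ^ k * a \<in> J" using nzd[of "f ^ k * a"] fn Suc.prems(2) by blast
      then show ?case using Suc by blast
    qed simp
    have eJ: "f ^ e * ?\<phi> (G0 + poly_var ?r * G1) \<in> J" using F(2) G(1) by (simp add: subst_mult subst_power nth_append)
    have "?\<phi> (G0 + poly_var ?r * G1) \<in> Q" by (rule subsetD[OF J pow[OF eJ H]])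
    moreover have "?\<phi> G1 \<in> PR n" by (rule subst_nth_PR) (use fn fs G(4) in auto)
    then have "?\<phi> G1 * f \<in> Q" using ideal_poly_ringD(4)[OF Q] f by blast
    ultimately have "?\<phi> (G0 + poly_var ?r * G1) - ?\<phi> G1 * f \<in> Q" by (rule ideal_poly_ringD(5)[OF Q])
    moreover have "?\<phi> G0 = subst (nth fs) G0"
      by (rule subst_cong_PR[OF G(2)]) (simp add: nth_append)
    ultimately have "subst (nth fs) G0 \<in> Q"
      by (simp add: subst_add subst_mult nth_append mult.commute)
    then show False using indep G(2,3) unfolding alg_indep_mod_def by blast
  qed
qed

section \<open>Counting monomials\<close>

definition expo_box :: "nat set \<Rightarrow> nat \<Rightarrow> expo set" where
  "expo_box X N = {t. keys t \<subseteq> X \<and> (\<forall>x. lookup t x < N)}"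

lemma card_expo_box:
  assumes "finite X" "1 \<le> N"
  shows "finite (expo_box X N)" "card (expo_box X N) = N ^ card X"
proof -
  have "bij_betw (\<lambda>t. restrict (lookup t) X) (expo_box X N) (PiE X (\<lambda>_. {..<N}))"
  proof (rule bij_betwI')
    fix s t assume st: "s \<in> expo_box X N" "t \<in> expo_box X N"
    show "restrict (lookup s) X = restrict (lookup t) X \<longleftrightarrow> s = t"
    proof
      assume eq: "restrict (lookup s) X = restrict (lookup t) X"
      show "s = t"
      proof (rule poly_mapping_eqI)
        fix x show "lookup s x = lookup t x"
        proof (cases "x \<in> X")
          case True then show ?thesis using fun_cong[OF eq, of x] by simp
        next
          case False
          then have "x \<notin> keys s" "x \<notin> keys t" using st by (auto simp: expo_box_def)
          then show ?thesis by (simp add: in_keys_iff)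
        qed
      qed
    qed simp
  next
    fix t assume "t \<in> expo_box X N"
    then show "restrict (lookup t) X \<in> PiE X (\<lambda>_. {..<N})" by (auto simp: expo_box_def)
  next
    fix f assume f: "f \<in> PiE X (\<lambda>_. {..<N})"
    define t where "t = Abs_poly_mapping (\<lambda>x. if x \<in> X then f x else (0::nat))"
    have lt: "lookup t = (\<lambda>x. if x \<in> X then f x else 0)"
      unfolding t_def by (rule lookup_Abs_poly_mapping) (rule finite_subset[OF _ assms(1)], auto)
    have "t \<in> expo_box X N" using f assms(2) by (auto simp: expo_box_def lt in_keys_iff split: if_splits)
    moreover have "f = restrict (lookup t) X" using f by (auto simp: lt PiE_def extensional_def restrict_def)
    ultimately show "\<exists>t\<in>expo_box X N. f = restrict (lookup t) X" by blast
  qed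
  then show "finite (expo_box X N)" "card (expo_box X N) = N ^ card X"
    using assms(1) by (auto simp: bij_betw_finite bij_betw_same_card card_PiE finite_PiE)
qed

definition keys_bounded :: "nat set \<Rightarrow> nat \<Rightarrow> 'k::field mpoly \<Rightarrow> bool" where
  "keys_bounded X d p \<longleftrightarrow> (\<forall>t\<in>keys p. keys t \<subseteq> X \<and> expo_deg t \<le> d)"

lemma keys_bounded_mult:
  assumes "keys_bounded X d p" "keys_bounded X d' q"
  shows "keys_bounded X (d + d') (p * q)"
  unfolding keys_bounded_def
proof
  fix t assume "t \<in> keys (p * q)"
  then obtain r s where rs: "r \<in> keys p" "s \<in> keys q" "t = r + s" using keys_multD by blast
  then show "keys t \<subseteq> X \<and> expo_deg t \<le> d + d'"
    using assms keys_add[of r s] unfolding keys_bounded_def by (fastforce simp: expo_deg_add intro: add_mono)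
qed

lemma keys_bounded_1: "keys_bounded X 0 1"
  by (simp add: keys_bounded_def)

lemma keys_bounded_power: "keys_bounded X d p \<Longrightarrow> keys_bounded X (d * k) (p ^ k)"
proof (induction k)
  case (Suc k)
  then show ?case using keys_bounded_mult[of X d p "d * k" "p ^ k"] by simp
qed (simp add: keys_bounded_1)

lemma keys_bounded_mon_ev:
  assumes "\<And>i. i \<in> keys t \<Longrightarrow> keys_bounded X d (\<sigma> i)"
  shows "keys_bounded X (d * expo_deg t) (mon_ev \<sigma> t)"
proof -
  have "keys_bounded X (\<Sum>i\<in>A. d * lookup t i) (\<Prod>i\<in>A. \<sigma> i ^ lookup t i)" if "finite A" "A \<subseteq> keys t" for A
    using that by (induction A rule: finite_induct)
      (auto simp: keys_bounded_1 intro!: keys_bounded_mult keys_bounded_power assms)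
  from this[of "keys t"] show ?thesis by (simp add: mon_ev_def expo_deg_def sum_distrib_left)
qed

interpretation mpoly_vs: vector_space "\<lambda>(c::'k::field) (p::'k mpoly). Cst c * p"
  by unfold_locales
    (simp_all add: distrib_left distrib_right single_add mult_single mult.assoc[symmetric])

text \<open>
  If all members of \<open>fs\<close> have degree at most \<open>D\<close>, the \<open>N ^ r\<close> products of their powers with exponents below
  \<open>N\<close> are linearly independent and lie in a space of dimension at most \<open>(D * r * N + 1) ^ card X\<close>. For large
  \<open>N\<close> this forces \<open>r \<le> card X\<close>.
\<close>

lemma alg_indep_length_le:
  fixes fs :: "'k::field mpoly list"
  assumes X: "finite X" and fs: "\<And>f t. f \<in> set fs \<Longrightarrow> t \<in> keys f \<Longrightarrow> keys t \<subseteq> X"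
    and indep: "alg_indep_mod {0} fs"
  shows "length fs \<le> card X"
proof (rule ccontr)
  assume "\<not> ?thesis"
  then have long: "Suc (card X) \<le> length fs" by simp
  define r where "r = length fs"
  define D where "D = (\<Sum>f\<in>set fs. \<Sum>t\<in>keys f. expo_deg t)"
  have bd: "keys_bounded X D (fs ! i)" if "i < r" for i
  proof -
    have "expo_deg t \<le> D" if t: "t \<in> keys (fs ! i)" for t
    proof -
      have "expo_deg t \<le> (\<Sum>t\<in>keys (fs ! i). expo_deg t)" using t by (intro member_le_sum) auto
      also have "\<dots> \<le> D" unfolding D_def
        by (rule member_le_sum[where f = "\<lambda>f. \<Sum>t\<in>keys f. expo_deg t"]) (use \<open>i < r\<close> in \<open>auto simp: r_def\<close>)
      finally show ?thesis .
    qed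
    then show ?thesis using fs that by (auto simp: keys_bounded_def r_def) (meson nth_mem subsetD)
  qed
  \<comment> \<open>Chosen to beat the constant in \<open>(D * r * N + 1) ^ card X \<le> (D * r + 1) ^ card X * N ^ card X\<close>.\<close>
  define N where "N = (D * r + 1) ^ card X + 1"
  define M where "M = mon_ev (nth fs)"
  let ?E = "expo_box {..<r} N" and ?T = "xmon ` expo_box X (D * r * N + 1) :: 'k mpoly set"
  have N1: "1 \<le> N" by (simp add: N_def)
  have E: "finite ?E" "card ?E = N ^ r" using card_expo_box[of "{..<r}" N] N1 by auto
  have PRE: "single e c \<in> PR r" if "e \<in> ?E" for e and c :: 'k using that by (auto simp: expo_box_def)
  have subM: "subst (nth fs) (single e c) = Cst c * M e" for e c by (simp add: subst_single M_def)
  have inj: "inj_on M ?E"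
  proof (rule inj_onI)
    fix e e' assume ee: "e \<in> ?E" "e' \<in> ?E" "M e = M e'"
    then have "subst (nth fs) (single e 1 - single e' 1) \<in> {0}" by (simp add: subst_diff subM)
    then have "single e (1::'k) - single e' 1 = 0"
      using indep PRE ee unfolding alg_indep_mod_def r_def by (meson PR_diff)
    then show "e = e'" by (simp add: xmon_def[symmetric])
  qed
  have "mpoly_vs.independent (M ` ?E)"
    unfolding mpoly_vs.independent_explicit_module
  proof (intro allI impI)
    fix t u v assume t: "finite t" "t \<subseteq> M ` ?E" "(\<Sum>v\<in>t. Cst (u v) * v) = 0" "v \<in> t"
    define B where "B = {e\<in>?E. M e \<in> t}"
    have B: "B \<subseteq> ?E" "finite B" "t = M ` B" using t(2) E(1) by (auto simp: B_def)
    then have injB: "inj_on M B" using inj inj_on_subset by blast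
    define F where "F = (\<Sum>e\<in>B. single e (u (M e)))"
    have "subst (nth fs) F = (\<Sum>e\<in>B. Cst (u (M e)) * M e)" by (simp add: F_def subst_sum subM)
    also have "\<dots> = (\<Sum>v\<in>t. Cst (u v) * v)" by (simp add: B(3) sum.reindex[OF injB])
    finally have "subst (nth fs) F \<in> {0}" using t(3) by simp
    moreover have "F \<in> PR (length fs)" unfolding F_def r_def[symmetric] using B PRE by (intro PR_sum) auto
    ultimately have "F = 0" using indep unfolding alg_indep_mod_def by blast
    moreover obtain e where e: "e \<in> B" "v = M e" using t(4) B(3) by blast
    have "lookup F e = u (M e)" using e B(2) by (simp add: F_def lookup_sum lookup_single when_def sum.delta')
    ultimately show "u v = 0" using e by simp
  qed
  moreover have "M ` ?E \<subseteq> mpoly_vs.span ?T"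
  proof
    fix p assume "p \<in> M ` ?E"
    then obtain e where e: "e \<in> ?E" "p = M e" by blast
    have "keys_bounded X (D * expo_deg e) p"
      unfolding e(2) M_def by (rule keys_bounded_mon_ev) (use bd e(1) in \<open>auto simp: expo_box_def\<close>)
    moreover have "expo_deg e = (\<Sum>i<r. lookup e i)" using e(1) by (intro expo_deg_superset) (auto simp: expo_box_def)
    then have "expo_deg e \<le> r * N" using sum_bounded_above[of "{..<r}" "lookup e" N] e(1)
      by (simp add: expo_box_def less_imp_le)
    then have "D * expo_deg e \<le> D * r * N" by (simp add: mult.assoc mult_le_mono2)
    ultimately have p: "keys t \<subseteq> X" "expo_deg t \<le> D * r * N" if "t \<in> keys p" for t
      using that by (auto simp: keys_bounded_def intro: order_trans)
    have le: "lookup t x \<le> expo_deg t" for t :: expo and x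
    proof (cases "x \<in> keys t")
      case True then show ?thesis unfolding expo_deg_def by (intro member_le_sum) auto
    qed (simp add: in_keys_iff)
    have "t \<in> expo_box X (D * r * N + 1)" if "t \<in> keys p" for t
      using p[OF that] le[of t] unfolding expo_box_def by (auto simp: less_Suc_eq_le intro: order_trans)
    then have "(\<Sum>t\<in>keys p. Cst (lookup p t) * xmon t) \<in> mpoly_vs.span ?T"
      by (intro mpoly_vs.span_sum mpoly_vs.span_scale mpoly_vs.span_base) auto
    then show "p \<in> mpoly_vs.span ?T" by (simp add: single_eq_Cst_xmon[symmetric] sum_singles)
  qed
  moreover have T: "finite (expo_box X (D * r * N + 1))" "card (expo_box X (D * r * N + 1)) = (D * r * N + 1) ^ card X"
    using card_expo_box[OF X, of "D * r * N + 1"] by auto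
  ultimately have "card (M ` ?E) \<le> card ?T" using mpoly_vs.independent_span_bound by blast
  then have "N ^ r \<le> (D * r * N + 1) ^ card X"
    using T E card_image[OF inj] card_image_le[OF T(1), of "xmon :: expo \<Rightarrow> 'k mpoly"] by simp
  also have "\<dots> \<le> ((D * r + 1) * N) ^ card X" using N1 by (intro power_mono) (auto simp: algebra_simps)
  also have "\<dots> = (D * r + 1) ^ card X * N ^ card X" by (rule power_mult_distrib)
  also have "\<dots> < N * N ^ card X" by (rule mult_strict_right_mono) (simp_all add: N_def)
  also have "\<dots> = N ^ Suc (card X)" by simp
  also have "\<dots> \<le> N ^ r" using long N1 by (intro power_increasing) (auto simp: r_def)
  finally show False by simp
qed

section \<open>Ideals generated by variables\<close>

definition kill :: "nat set \<Rightarrow> nat \<Rightarrow> 'k::field mpoly" where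
  "kill Z i = (if i \<in> Z then 0 else poly_var i)"

lemma subst_kill: "subst (kill Z) p = mrestrict (\<lambda>t. keys t \<inter> Z = {}) p"
proof -
  have ev: "mon_ev (kill Z) t = (if keys t \<inter> Z = {} then xmon t else (0 :: 'a mpoly))" for t
  proof (cases "keys t \<inter> Z = {}")
    case True
    then have "mon_ev (kill Z) t = mon_ev (poly_var :: nat \<Rightarrow> 'a mpoly) t"
      unfolding mon_ev_def by (intro prod.cong) (auto simp: kill_def)
    then show ?thesis using True by (simp add: mon_ev_poly_var)
  next
    case False
    then obtain i where "i \<in> keys t" "i \<in> Z" by blast
    then have "\<exists>i\<in>keys t. kill Z i ^ lookup t i = (0 :: 'a mpoly)"
      by (intro bexI[of _ i]) (auto simp: kill_def in_keys_iff)
    then show ?thesis using False unfolding mon_ev_def by (simp add: prod_zero_iff)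
  qed
  have "subst (kill Z) p = (\<Sum>t\<in>keys p. if keys t \<inter> Z = {} then single t (lookup p t) else 0)"
    unfolding subst_def ev by (intro sum.cong) (auto simp: single_eq_Cst_xmon[symmetric])
  also have "\<dots> = mrestrict (\<lambda>t. keys t \<inter> Z = {}) p"
    unfolding mrestrict_def by (simp add: sum.inter_filter)
  finally show ?thesis .
qed

text \<open>
  The ideal generated by the variables with index in \<open>Z\<close>, defined as the kernel of the substitution that
  kills these variables; this makes it visibly prime.
\<close>

definition var_ideal :: "nat \<Rightarrow> nat set \<Rightarrow> 'k::field mpoly set" where
  "var_ideal n Z = {p \<in> PR n. subst (kill Z) p = 0}"

lemma var_ideal_iff: "p \<in> var_ideal n Z \<longleftrightarrow> p \<in> PR n \<and> (\<forall>t\<in>keys p. keys t \<inter> Z \<noteq> {})"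
proof -
  have "subst (kill Z) p = 0 \<longleftrightarrow> (\<forall>t\<in>keys p. keys t \<inter> Z \<noteq> {})"
    unfolding subst_kill poly_mapping_eq_iff fun_eq_iff
    by (auto simp: lookup_mrestrict in_keys_iff split: if_splits)
  then show ?thesis by (simp add: var_ideal_def)
qed

lemma primeideal_var_ideal: "primeideal (var_ideal n Z :: 'k::field mpoly set) (poly_ring n)"
proof (rule primeidealI)
  show "ideal (var_ideal n Z :: 'k mpoly set) (poly_ring n)"
    by (rule ideal_poly_ringI) (auto simp: var_ideal_def subst_add subst_mult)
  show "cring (poly_ring n :: 'k mpoly ring)" by (rule cring_poly_ring)
  have "(1 :: 'k mpoly) \<notin> var_ideal n Z" by (simp add: var_ideal_def)
  then show "PR n \<noteq> (var_ideal n Z :: 'k mpoly set)" using PR_1 by metis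
qed (auto simp: var_ideal_def subst_mult)

text \<open>
  Killing the variables in \<open>Z\<close> leaves independent polynomials in the other variables.
\<close>

lemma alg_indep_mod_var_ideal_length:
  assumes Z: "Z \<subseteq> {..<n}" and fs: "set fs \<subseteq> PR n" and indep: "alg_indep_mod (var_ideal n Z) fs"
  shows "length fs \<le> n - card Z"
proof -
  define gs where "gs = map (subst (kill Z)) fs"
  have "length gs \<le> card ({..<n} - Z)"
  proof (rule alg_indep_length_le)
    fix g t assume "g \<in> set gs" "t \<in> keys g"
    then show "keys t \<subseteq> {..<n} - Z"
      using fs by (fastforce simp: gs_def subst_kill keys_mrestrict carrier_poly_ring_iff)
  next
    show "alg_indep_mod {0} gs"
      unfolding alg_indep_mod_def
    proof (intro ballI impI)
      fix F assume F: "F \<in> PR (length gs)" "subst (nth gs) F \<in> {0}"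
      have "subst (kill Z) (subst (nth fs) F) = subst (nth gs) F"
        unfolding subst_subst by (rule subst_cong_PR[OF F(1)]) (simp add: gs_def)
      then have "subst (nth fs) F \<in> var_ideal n Z"
        using F subst_nth_PR[OF fs, of F] by (simp add: var_ideal_def gs_def)
      then show "F = 0" using indep F(1) by (simp add: alg_indep_mod_def gs_def)
    qed
  qed simp
  then show ?thesis using Z by (simp add: gs_def card_Diff_subset finite_subset)
qed

lemma alg_indep_mod_var_ideal_vars:
  assumes Z: "Z \<subseteq> {..<n}"
  obtains fs :: "'k::field mpoly list"
    where "length fs = n - card Z" "set fs \<subseteq> PR n" "alg_indep_mod (var_ideal n Z) fs"
proof -
  define xs where "xs = sorted_list_of_set ({..<n} - Z)"
  have xs: "set xs = {..<n} - Z" "distinct xs" by (auto simp: xs_def)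
  have len: "length xs = n - card Z" using Z by (simp add: xs_def card_Diff_subset finite_subset)
  define fs :: "'k mpoly list" where "fs = map poly_var xs"
  define \<tau> :: "nat \<Rightarrow> 'k mpoly" where "\<tau> x = poly_var (the_inv_into {..<length xs} (nth xs) x)" for x
  have inj: "inj_on (nth xs) {..<length xs}" using xs by (auto simp: inj_on_def nth_eq_iff_index_eq)
  have "alg_indep_mod (var_ideal n Z) fs"
    unfolding alg_indep_mod_def
  proof (intro ballI impI)
    fix F :: "'k mpoly" assume F: "F \<in> PR (length fs)" "subst (nth fs) F \<in> var_ideal n Z"
    have l: "length fs = length xs" by (simp add: fs_def)
    have notZ: "xs ! i \<notin> Z" if "i < length fs" for i using that l xs nth_mem[of i xs] by auto
    have fsi: "fs ! i = poly_var (xs ! i)" "\<tau> (xs ! i) = poly_var i" if "i < length fs" for i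
      using that l the_inv_into_f_f[OF inj, of i] by (simp_all add: fs_def \<tau>_def)
    have "subst (kill Z) (subst (nth fs) F) = subst (nth fs) F"
      unfolding subst_subst by (rule subst_cong_PR[OF F(1)]) (simp add: fsi notZ kill_def)
    then have "0 = subst \<tau> (subst (nth fs) F)" using F by (simp add: var_ideal_def)
    also have "\<dots> = subst poly_var F"
      unfolding subst_subst by (rule subst_cong_PR[OF F(1)]) (simp add: fsi)
    finally show "F = 0" by simp
  qed
  moreover have "length fs = n - card Z" "set fs \<subseteq> PR n"
    unfolding fs_def using len xs(1) by (simp, force)
  ultimately show ?thesis using that by blast
qed

text \<open>
  Going down the chain, an element of \<open>P (Suc i)\<close> outside \<open>P i\<close> is a nonzerodivisor modulo \<open>P i\<close>, so every
  step adds one element by \<open>alg_indep_mod_extend\<close>.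
\<close>

lemma prime_chain_alg_indep:
  assumes "prime_chain (poly_ring n) P k" "set fs \<subseteq> PR n" "alg_indep_mod (P k) fs"
  shows "\<exists>gs. length gs = length fs + k \<and> set gs \<subseteq> PR n \<and> alg_indep_mod (P 0) gs"
  using assms
proof (induction k arbitrary: P)
  case 0
  then show ?case by auto
next
  case (Suc k)
  have "prime_chain (poly_ring n) (\<lambda>i. P (Suc i)) k" using Suc.prems(1) by (auto simp: prime_chain_def)
  from Suc.IH[OF this] Suc.prems obtain gs where gs: "length gs = length fs + k" "set gs \<subseteq> PR n"
    "alg_indep_mod (P (Suc 0)) gs" by auto
  have pr: "primeideal (P 0) (poly_ring n)" "primeideal (P 1) (poly_ring n)" and sub: "P 0 \<subset> P 1"
    using Suc.prems(1) by (auto simp: prime_chain_def)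
  then obtain f where f: "f \<in> P 1" "f \<notin> P 0" by blast
  interpret P0: primeideal "P 0" "poly_ring n" by fact
  have id: "ideal (P 1) (poly_ring n)" using pr(2) by (simp add: primeideal_def)
  have fn: "f \<in> PR n" using f ideal_poly_ringD(1)[OF id] by blast
  have nzd: "a \<in> P 0" if "a \<in> PR n" "f * a \<in> P 0" for a
    using P0.I_prime[OF fn that(1)] that(2) f by simp
  have "alg_indep_mod (P 1) gs" using gs by simp
  then have "alg_indep_mod (P 0) (gs @ [f])"
    using sub by (intro alg_indep_mod_extend[OF id _ f(1) gs(2) nzd]) auto
  then show ?case using gs fn by (intro exI[of _ "gs @ [f]"]) auto
qed

text \<open>
  The sequence is added from its last element to its first, starting from the empty family modulo the
  proper ideal generated by \<open>I\<close> and the whole sequence.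
\<close>

lemma regular_seq_alg_indep:
  assumes reg: "regular_seq (poly_ring n) I fs" and I: "I \<subseteq> PR n"
  shows "\<exists>gs. length gs = length fs \<and> set gs \<subseteq> PR n \<and> alg_indep_mod I gs"
proof -
  interpret cring "poly_ring n :: 'a mpoly ring" by (rule cring_poly_ring)
  let ?J = "\<lambda>k. genideal (poly_ring n) (I \<union> set (take k fs))"
  have fs: "set fs \<subseteq> PR n" using reg by (simp add: regular_seq_def)
  have sub: "I \<union> set (take k fs) \<subseteq> PR n" for k using I fs set_take_subset by fastforce
  have id: "ideal (?J k) (poly_ring n)" for k using sub by (intro genideal_ideal) simp
  have "\<exists>gs. length gs = length fs - k \<and> set gs \<subseteq> PR n \<and> alg_indep_mod (?J k) gs" if "k \<le> length fs" for k
    using that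
  proof (induction k rule: inc_induct)
    case base
    have "1 \<notin> ?J (length fs)"
    proof
      assume "1 \<in> ?J (length fs)"
      then have "?J (length fs) = PR n" using ideal.one_imp_carrier[OF id[of "length fs"]] by simp
      then show False using reg by (simp add: regular_seq_def)
    qed
    then show ?case using alg_indep_mod_Nil[OF id[of "length fs"]] by (intro exI[of _ "[]"]) auto
  next
    case (step k)
    then obtain gs where gs: "length gs = length fs - Suc k" "set gs \<subseteq> PR n" "alg_indep_mod (?J (Suc k)) gs" by auto
    have kin: "fs ! k \<in> ?J (Suc k)"
      using genideal_self[OF sub[of "Suc k"]] step by (auto simp: take_Suc_conv_app_nth)
    have "I \<union> set (take k fs) \<subseteq> ?J (Suc k)"
      using genideal_self[OF sub[of "Suc k"]] step by (auto simp: take_Suc_conv_app_nth)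
    then have sub': "?J k \<subseteq> ?J (Suc k)" by (rule genideal_minimal[OF id])
    have nzd: "a \<in> ?J k" if "a \<in> PR n" "fs ! k * a \<in> ?J k" for a
      using reg that step by (simp add: regular_seq_def)
    have "alg_indep_mod (?J k) (gs @ [fs ! k])"
      by (rule alg_indep_mod_extend[OF id sub' kin gs(2) nzd gs(3)])
    moreover have "fs ! k \<in> PR n" using fs step by auto
    ultimately show ?case using gs step by (intro exI[of _ "gs @ [fs ! k]"]) auto
  qed
  from this[of 0] obtain gs where "length gs = length fs" "set gs \<subseteq> PR n" "alg_indep_mod (?J 0) gs" by auto
  moreover have "I \<subseteq> ?J 0" using genideal_self[of I] I by simp
  ultimately show ?thesis using alg_indep_mod_mono by blast
qed

section \<open>Prime ideals of a quotient\<close>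

text \<open>
  Prime ideals of the quotient correspond to prime ideals containing \<open>I\<close>, by preimage and image.
\<close>

lemma (in cring) prime_chain_Quot_iff:
  assumes I: "ideal I R"
  shows "(\<exists>P. prime_chain (R Quot I) P k) \<longleftrightarrow> (\<exists>P. prime_chain R P k \<and> I \<subseteq> P 0)"
proof
  interpret h: ring_hom_ring R "R Quot I" "(+>) I" by (rule ideal.rcos_ring_hom_ring[OF I])
  assume "\<exists>P. prime_chain (R Quot I) P k"
  then obtain P where P: "prime_chain (R Quot I) P k" ..
  define Q where "Q i = {r \<in> carrier R. I +> r \<in> P i}" for i
  have prP: "primeideal (P i) (R Quot I)" if "i \<le> k" for i using P that by (simp add: prime_chain_def)
  have "primeideal (Q i) R" if "i \<le> k" for i
    unfolding Q_def using prP[OF that] is_cring by (intro h.primeideal_vimage)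
  moreover have "Q i \<subset> Q (Suc i)" if i: "i < k" for i
  proof -
    have "P i \<subset> P (Suc i)" using P i by (simp add: prime_chain_def)
    then obtain x where x: "x \<in> P (Suc i)" "x \<notin> P i" "P i \<subseteq> P (Suc i)" by blast
    have "P (Suc i) \<subseteq> carrier (R Quot I)"
      using prP[of "Suc i"] i by (metis Suc_leI primeideal.axioms(1) ideal.axioms(1) additive_subgroup.a_subset)
    then obtain r where "r \<in> carrier R" "x = I +> r"
      using x unfolding FactRing_def using A_RCOSETS_def'[of R I] by auto
    then have "r \<in> Q (Suc i)" "r \<notin> Q i" using x by (auto simp: Q_def)
    then show ?thesis using x by (auto simp: Q_def)
  qed
  moreover have "I \<subseteq> Q 0"
  proof
    fix r assume r: "r \<in> I"
    then have rR: "r \<in> carrier R" using I by (simp add: ideal.Icarr)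
    have "\<zero>\<^bsub>R Quot I\<^esub> = I" unfolding FactRing_def by simp
    moreover have "I +> r = I"
      by (rule a_coset_join2[OF rR additive_subgroup.a_subgroup[OF ideal.axioms(1)[OF I]] r])
    ultimately have "I +> r = \<zero>\<^bsub>R Quot I\<^esub>" by (rule trans[rotated, OF sym])
    moreover have "\<zero>\<^bsub>R Quot I\<^esub> \<in> P 0"
      using prP[of 0] by (simp add: additive_subgroup.zero_closed ideal.axioms(1) primeideal.axioms(1))
    ultimately show "r \<in> Q 0" using rR by (simp add: Q_def)
  qed
  ultimately show "\<exists>P. prime_chain R P k \<and> I \<subseteq> P 0" unfolding prime_chain_def by blast
next
  assume "\<exists>P. prime_chain R P k \<and> I \<subseteq> P 0"
  then obtain P where P: "prime_chain R P k" "I \<subseteq> P 0" by blast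
  interpret h: ring_hom_ring R "R Quot I" "(+>) I" by (rule ideal.rcos_ring_hom_ring[OF I])
  define Q where "Q i = (+>) I ` P i" for i
  have prP: "primeideal (P i) R" if "i \<le> k" for i using P that by (simp add: prime_chain_def)
  then have idP: "ideal (P i) R" if "i \<le> k" for i using that by (simp add: primeideal.axioms(1))
  have IP: "I \<subseteq> P i" if "i \<le> k" for i
    using that
  proof (induction i)
    case (Suc i)
    then have "P i \<subset> P (Suc i)" using P(1) by (simp add: prime_chain_def)
    then show ?case using Suc by auto
  qed (use P in simp)
  have idQ: "ideal (Q i) (R Quot I)" if "i \<le> k" for i
    unfolding Q_def by (rule ring_ideal_imp_quot_ideal[OF I idP[OF that]])
  have mem: "I +> a \<in> Q i \<longleftrightarrow> a \<in> P i" if "i \<le> k" "a \<in> carrier R" for a i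
  proof -
    have "\<Union> (Q i) = P i" using ideal_incl_iff[OF I idP[OF that(1)]] IP[OF that(1)] by (simp add: Q_def)
    moreover have "Q i \<subseteq> carrier (R Quot I)" using idQ[OF that(1)] by (simp add: ideal.axioms(1) additive_subgroup.a_subset)
    ultimately show ?thesis using canonical_proj_vimage_mem_iff[OF I _ that(2), of "Q i"] by simp
  qed
  have rep: "\<exists>r\<in>carrier R. x = I +> r" if "x \<in> carrier (R Quot I)" for x
    using that unfolding FactRing_def using A_RCOSETS_def'[of R I] by auto
  have "primeideal (Q i) (R Quot I)" if i: "i \<le> k" for i
  proof (rule primeidealI[OF idQ[OF i]])
    show "cring (R Quot I)" by (rule ideal.quotient_is_cring[OF I is_cring])
    have "\<one> \<notin> P i" using primeideal.I_notcarr[OF prP[OF i]] ideal.one_imp_carrier[OF idP[OF i]] by metis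
    then have "I +> \<one> \<notin> Q i" using mem[OF i, of \<one>] by blast
    then show "carrier (R Quot I) \<noteq> Q i" using h.hom_closed[of \<one>] by blast
  next
    fix x y assume xy: "x \<in> carrier (R Quot I)" "y \<in> carrier (R Quot I)" "x \<otimes>\<^bsub>R Quot I\<^esub> y \<in> Q i"
    then obtain a b where ab: "a \<in> carrier R" "x = I +> a" "b \<in> carrier R" "y = I +> b" using rep by meson
    then have "I +> (a \<otimes> b) \<in> Q i" using xy(3) h.hom_mult[of a b] by metis
    then have "a \<otimes> b \<in> P i" using mem[OF i, of "a \<otimes> b"] ab by blast
    then show "x \<in> Q i \<or> y \<in> Q i" using primeideal.I_prime[OF prP[OF i]] ab mem[OF i] by metis
  qed
  moreover have "Q i \<subset> Q (Suc i)" if i: "i < k" for i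
  proof -
    have "P i \<subset> P (Suc i)" using P(1) i by (simp add: prime_chain_def)
    then obtain a where "a \<in> P (Suc i)" "a \<notin> P i" "P i \<subseteq> P (Suc i)" by blast
    moreover then have "a \<in> carrier R" using idP[of "Suc i"] i by (simp add: ideal.Icarr)
    ultimately have "I +> a \<in> Q (Suc i)" "I +> a \<notin> Q i" "Q i \<subseteq> Q (Suc i)"
      using mem[of i a] i by (auto simp: Q_def)
    then show ?thesis by blast
  qed
  ultimately show "\<exists>P. prime_chain (R Quot I) P k" unfolding prime_chain_def by blast
qed

section \<open>Submodules spanned by vectors\<close>

lemma submod_span_carrier:
  assumes "A \<subseteq> carrier_vec k" "w \<in> submod_span n k A"
  shows "w \<in> carrier_vec k"
  using assms(2) by induction (use assms(1) in auto)

lemma submod_span_base: "a \<in> A \<Longrightarrow> A \<subseteq> carrier_vec k \<Longrightarrow> a \<in> submod_span n k A"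
  using submod_span.step[of a A 1 n "0\<^sub>v k" k] submod_span.zero[of k n A] by auto

lemma submod_span_add:
  assumes A: "A \<subseteq> carrier_vec k" and v: "v \<in> submod_span n k A" and w: "w \<in> submod_span n k A"
  shows "v + w \<in> submod_span n k A"
  using v
proof induction
  case zero
  then show ?case using submod_span_carrier[OF A w] w by simp
next
  case (step a c v)
  have "c \<cdot>\<^sub>v a + v + w = c \<cdot>\<^sub>v a + (v + w)"
    using step A submod_span_carrier[OF A step(3)] submod_span_carrier[OF A w] by (intro assoc_add_vec) auto
  then show ?case using step by (auto intro: submod_span.step)
qed

lemma submod_span_smult:
  assumes A: "A \<subseteq> carrier_vec k" and v: "v \<in> submod_span n k A" and c: "c \<in> PR n"
  shows "c \<cdot>\<^sub>v v \<in> submod_span n k A"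
  using v
proof induction
  case zero
  have "c \<cdot>\<^sub>v 0\<^sub>v k = 0\<^sub>v k" by auto
  then show ?case by (simp add: submod_span.zero)
next
  case (step a c' v)
  have "c \<cdot>\<^sub>v (c' \<cdot>\<^sub>v a + v) = (c * c') \<cdot>\<^sub>v a + c \<cdot>\<^sub>v v"
    using step A submod_span_carrier[OF A step(3)]
    by (subst smult_add_distrib_vec[of _ k]) (auto simp: smult_smult_assoc)
  then show ?case using step c by (auto intro!: submod_span.step)
qed

lemma submod_span_uminus:
  assumes A: "A \<subseteq> carrier_vec k" and v: "v \<in> submod_span n k A"
  shows "- v \<in> submod_span n k A"
proof -
  have "- v = (- 1) \<cdot>\<^sub>v v" using submod_span_carrier[OF A v] by auto
  then show ?thesis using submod_span_smult[OF A v, of "- 1"] by simp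
qed

lemma submod_span_minimal:
  assumes A: "A \<subseteq> carrier_vec k" and B: "B \<subseteq> submod_span n k A"
  shows "submod_span n k B \<subseteq> submod_span n k A"
proof
  fix w assume "w \<in> submod_span n k B"
  then show "w \<in> submod_span n k A"
    by induction (use A B in \<open>auto intro!: submod_span.zero submod_span_add submod_span_smult\<close>)
qed

lemma submod_span_mono: "A \<subseteq> B \<Longrightarrow> B \<subseteq> carrier_vec k \<Longrightarrow> submod_span n k A \<subseteq> submod_span n k B"
  by (intro submod_span_minimal) (auto intro: submod_span_base)

lemma submod_span_sum:
  assumes T: "finite T" and r: "\<And>e. e \<in> T \<Longrightarrow> r e \<in> submod_span n k A" and A: "A \<subseteq> carrier_vec k"
    and c: "\<And>e. e \<in> T \<Longrightarrow> c e \<in> PR n"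
    and w: "w \<in> carrier_vec k" "\<And>v. v < k \<Longrightarrow> w $ v = (\<Sum>e\<in>T. c e * (r e $ v))"
  shows "w \<in> submod_span n k A"
proof -
  have "vec k (\<lambda>v. \<Sum>e\<in>S. c e * (r e $ v)) \<in> submod_span n k A" if "finite S" "S \<subseteq> T" for S
    using that
  proof (induction S rule: finite_induct)
    case empty
    have "vec k (\<lambda>v. \<Sum>e\<in>{}. c e * (r e $ v)) = 0\<^sub>v k" by auto
    then show ?case using submod_span.zero by metis
  next
    case (insert e S)
    have "vec k (\<lambda>v. \<Sum>e\<in>insert e S. c e * (r e $ v)) =
       c e \<cdot>\<^sub>v r e + vec k (\<lambda>v. \<Sum>e\<in>S. c e * (r e $ v))"
      using insert submod_span_carrier[OF A r[of e]] by (intro eq_vecI) auto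
    also have "\<dots> \<in> submod_span n k A"
      using insert c[of e] r[of e] by (intro submod_span_add submod_span_smult A) auto
    finally show ?case .
  qed
  from this[of T] have "vec k (\<lambda>v. \<Sum>e\<in>T. c e * (r e $ v)) \<in> submod_span n k A" using T by simp
  moreover have "w = vec k (\<lambda>v. \<Sum>e\<in>T. c e * (r e $ v))" using w by (intro eq_vecI) auto
  ultimately show ?thesis by simp
qed

lemma submod_span_image_coeffs:
  assumes T: "finite T" and r: "\<And>e. e \<in> T \<Longrightarrow> r e \<in> carrier_vec k" and w: "w \<in> submod_span n k (r ` T)"
  obtains c where "\<And>e. e \<in> T \<Longrightarrow> c e \<in> PR n" "\<And>v. v < k \<Longrightarrow> w $ v = (\<Sum>e\<in>T. c e * (r e $ v))"
proof -
  have A: "r ` T \<subseteq> carrier_vec k" using r by auto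
  have "\<exists>c. (\<forall>e\<in>T. c e \<in> PR n) \<and> (\<forall>v<k. w $ v = (\<Sum>e\<in>T. c e * (r e $ v)))"
    using w
  proof induction
    case zero
    then show ?case by (intro exI[of _ "\<lambda>_. 0"]) auto
  next
    case (step a c v)
    then obtain e d where e: "e \<in> T" "a = r e" and d: "\<And>e. e \<in> T \<Longrightarrow> d e \<in> PR n"
      "\<And>x. x < k \<Longrightarrow> v $ x = (\<Sum>e\<in>T. d e * (r e $ x))" by auto
    have "(c \<cdot>\<^sub>v a + v) $ x = (\<Sum>e'\<in>T. (d(e := c + d e)) e' * (r e' $ x))" if x: "x < k" for x
    proof -
      have "(\<Sum>e'\<in>T. (d(e := c + d e)) e' * (r e' $ x)) = (c + d e) * (r e $ x) + (\<Sum>e'\<in>T - {e}. d e' * (r e' $ x))"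
        using T e by (subst sum.remove[of _ e]) (auto intro!: sum.cong)
      also have "\<dots> = c * (r e $ x) + (\<Sum>e'\<in>T. d e' * (r e' $ x))"
        using T e by (subst (2) sum.remove[of _ e]) (auto simp: algebra_simps)
      also have "\<dots> = (c \<cdot>\<^sub>v a + v) $ x"
        using x e r[OF e(1)] d(2)[OF x] submod_span_carrier[OF A step(3)] by simp
      finally show ?thesis by simp
    qed
    then show ?case using d(1) step(2) e by (intro exI[of _ "d(e := c + d e)"]) auto
  qed
  then show ?thesis using that by blast
qed

section \<open>Taylor relations\<close>

lemma lookup_expo_gcd: "lookup (expo_gcd s t) i = min (lookup s i) (lookup t i)"
  by transfer simp

definition expo_lcm :: "expo \<Rightarrow> expo \<Rightarrow> expo" where
  "expo_lcm s t = s + (t - expo_gcd s t)"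

lemma lookup_expo_lcm: "lookup (expo_lcm s t) i = max (lookup s i) (lookup t i)"
  by (simp add: expo_lcm_def lookup_add lookup_minus lookup_expo_gcd max_def min_def)

lemma expo_le_lcm [simp]: "expo_le s (expo_lcm s t)" "expo_le t (expo_lcm s t)"
  by (simp_all add: expo_le_def lookup_expo_lcm)

lemma expo_lcm_least: "expo_le s v \<Longrightarrow> expo_le t v \<Longrightarrow> expo_le (expo_lcm s t) v"
  by (simp add: expo_le_def lookup_expo_lcm)

abbreviation elcm :: "expo list \<Rightarrow> nat \<times> nat \<Rightarrow> expo" where
  "elcm us e \<equiv> expo_lcm (us ! fst e) (us ! snd e)"

definition trel :: "expo list \<Rightarrow> nat \<times> nat \<Rightarrow> ('k::field) mpoly vec" where
  "trel us e = taylor_relation us (fst e) (snd e)"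

text \<open>
  The syzygy \<open>(\<sigma> / u\<^sub>j) e\<^sub>j - (\<sigma> / u\<^sub>i) e\<^sub>i\<close> of multidegree \<open>\<sigma>\<close>. For a fixed \<open>\<sigma>\<close> these telescope along
  paths, and for \<open>\<sigma> = lcm(u\<^sub>i, u\<^sub>j)\<close> one obtains the Taylor relation.
\<close>

definition scaled_diff :: "expo list \<Rightarrow> expo \<Rightarrow> nat \<Rightarrow> nat \<Rightarrow> ('k::field) mpoly vec" where
  "scaled_diff us \<sigma> i j = vec (length us)
     (\<lambda>v. (if v = j then xmon (\<sigma> - us ! j) else 0) - (if v = i then xmon (\<sigma> - us ! i) else 0))"

lemma scaled_diff_carrier [simp]: "scaled_diff us \<sigma> i j \<in> carrier_vec (length us)"
  by (simp add: scaled_diff_def)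

lemma trel_eq_scaled_diff:
  assumes "i \<noteq> j"
  shows "trel us (i, j) = scaled_diff us (expo_lcm (us ! i) (us ! j)) i j"
proof -
  have "us ! i - expo_gcd (us ! i) (us ! j) = expo_lcm (us ! i) (us ! j) - us ! j"
    "us ! j - expo_gcd (us ! j) (us ! i) = expo_lcm (us ! i) (us ! j) - us ! i"
    by (auto intro!: poly_mapping_eqI simp: lookup_minus lookup_expo_lcm lookup_expo_gcd)
  then show ?thesis
    using assms by (intro eq_vecI) (auto simp: trel_def taylor_relation_def cofactor_def scaled_diff_def unit_vec_def)
qed

lemma trel_carrier [simp]: "trel us e \<in> carrier_vec (length us)"
  by (simp add: trel_def taylor_relation_def)

lemma scaled_diff_refl: "scaled_diff us \<sigma> i i = 0\<^sub>v (length us)"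
  by (intro eq_vecI) (auto simp: scaled_diff_def)

lemma scaled_diff_swap: "scaled_diff us \<sigma> j i = - scaled_diff us \<sigma> i j"
  by (intro eq_vecI) (auto simp: scaled_diff_def)

lemma scaled_diff_add: "scaled_diff us \<sigma> i j + scaled_diff us \<sigma> j k = scaled_diff us \<sigma> i k"
  by (intro eq_vecI) (auto simp: scaled_diff_def)

lemma xmon_diff_mult: "expo_le u \<sigma> \<Longrightarrow> xmon (\<sigma> - u) * xmon u = xmon \<sigma>"
  by (simp add: xmon_add[symmetric] add.commute expo_le_add_diff)

lemma trel_entry_mult:
  assumes "i \<noteq> j" "v < length us"
  shows "trel us (i, j) $ v * xmon (us ! v) =
    (if v = j then xmon (elcm us (i, j)) else 0) - (if v = i then xmon (elcm us (i, j)) else (0 :: 'k::field mpoly))"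
  using assms by (auto simp: trel_eq_scaled_diff scaled_diff_def xmon_diff_mult)

definition edge_pairs :: "nat \<Rightarrow> (nat \<times> nat) set" where
  "edge_pairs N = {(i, j). i < j \<and> j < N}"

lemma finite_edge_pairs [simp]: "finite (edge_pairs N)"
  by (rule finite_subset[of _ "{..<N} \<times> {..<N}"]) (auto simp: edge_pairs_def)

text \<open>
  Edges are stored once, with the smaller vertex first; walks use both directions.
\<close>

definition symc :: "'a rel \<Rightarrow> 'a rel" where "symc R = R \<union> R\<inverse>"

lemma sym_symc_rtrancl: "(x, y) \<in> (symc R)\<^sup>* \<Longrightarrow> (y, x) \<in> (symc R)\<^sup>*"
  by (rule symD[OF sym_rtrancl]) (auto simp: symc_def sym_def)

lemma symc_rtrancl_mono: "(x, y) \<in> (symc R)\<^sup>* \<Longrightarrow> R \<subseteq> S \<Longrightarrow> (x, y) \<in> (symc S)\<^sup>*"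
  by (rule subsetD[OF rtrancl_mono]) (auto simp: symc_def)

text \<open>
  On a syzygy \<open>w\<close>, the functional \<open>\<Sum>v\<in>A. (coefficient of \<sigma> in w\<^sub>v u\<^sub>v)\<close> vanishes on multiples of a Taylor
  relation whose two ends lie on the same side of the cut \<open>A\<close>, because the two contributions cancel; and
  multiples of a relation whose multidegree does not divide \<open>\<sigma>\<close> do not contribute at all.
\<close>

lemma sum_over_cut_eq_0:
  fixes w :: "'k::field mpoly vec"
  assumes T: "T \<subseteq> edge_pairs (length us)" and A: "A \<subseteq> {..<length us}"
    and closed: "\<And>i j. (i, j) \<in> T \<Longrightarrow> expo_le (elcm us (i, j)) \<sigma> \<Longrightarrow> i \<in> A \<longleftrightarrow> j \<in> A"
    and w: "w \<in> submod_span n (length us) (trel us ` T)"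
  shows "(\<Sum>v\<in>A. lookup (w $ v * xmon (us ! v)) \<sigma>) = 0"
  using w
proof induction
  case zero
  then show ?case using A by (auto intro!: sum.neutral)
next
  case (step a c w)
  then obtain i j where ij: "(i, j) \<in> T" "a = trel us (i, j)" by auto
  then have ne: "i \<noteq> j" using T by (auto simp: edge_pairs_def)
  have fin: "finite A" using A finite_subset by blast
  have w: "w \<in> carrier_vec (length us)" by (rule submod_span_carrier[OF _ step(3)]) auto
  have a: "a \<in> carrier_vec (length us)" using ij by simp
  define \<kappa> where "\<kappa> = lookup (c * xmon (elcm us (i, j))) \<sigma>"
  have "(\<Sum>v\<in>A. lookup ((c \<cdot>\<^sub>v a + w) $ v * xmon (us ! v)) \<sigma>) =
    (\<Sum>v\<in>A. ((if v = j then \<kappa> else 0) - (if v = i then \<kappa> else 0)) + lookup (w $ v * xmon (us ! v)) \<sigma>)"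
  proof (rule sum.cong)
    fix v assume "v \<in> A"
    then have v: "v < length us" using A by auto
    then have "(c \<cdot>\<^sub>v a + w) $ v * xmon (us ! v) = c * (a $ v * xmon (us ! v)) + w $ v * xmon (us ! v)"
      using carrier_vecD[OF w] carrier_vecD[OF a]
      by (simp only: index_add_vec index_smult_vec distrib_right mult.assoc)
    then show "lookup ((c \<cdot>\<^sub>v a + w) $ v * xmon (us ! v)) \<sigma> =
      (if v = j then \<kappa> else 0) - (if v = i then \<kappa> else 0) + lookup (w $ v * xmon (us ! v)) \<sigma>"
      using trel_entry_mult[OF ne v, where 'k = 'k] ij by (simp add: lookup_add \<kappa>_def right_diff_distrib)
  qed simp
  also have "\<dots> = (if j \<in> A then \<kappa> else 0) - (if i \<in> A then \<kappa> else 0)"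
    using fin step by (simp add: sum.distrib sum_subtractf)
  also have "\<dots> = 0"
  proof (cases "\<kappa> = 0")
    case False
    then have "\<sigma> \<in> keys (xmon (elcm us (i, j)) * c)" by (simp add: \<kappa>_def in_keys_iff mult.commute)
    then have "expo_le (elcm us (i, j)) \<sigma>" by (auto simp: keys_xmon_mult)
    then show ?thesis using closed[OF ij(1)] by auto
  qed simp
  finally show ?case .
qed

text \<open>
  Apply \<open>sum_over_cut_eq_0\<close> in multidegree \<open>lcm(u\<^sub>i, u\<^sub>j)\<close> to the component \<open>A\<close> of \<open>i\<close>: the functional
  takes the value \<open>[j \<in> A] - [i \<in> A]\<close> on the relation of \<open>i\<close> and \<open>j\<close>.
\<close>

lemma trel_in_span_connected:
  assumes T: "T \<subseteq> edge_pairs (length us)" and ij: "i \<noteq> j" "i < length us" "j < length us"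
    and w: "(trel us (i, j) :: 'k::field mpoly vec) \<in> submod_span n (length us) (trel us ` T)"
  shows "(i, j) \<in> (symc {e \<in> T. expo_le (elcm us e) (elcm us (i, j))})\<^sup>*"
proof -
  let ?\<sigma> = "elcm us (i, j)" let ?R = "symc {e \<in> T. expo_le (elcm us e) ?\<sigma>}"
  define A where "A = {v. v < length us \<and> (i, v) \<in> ?R\<^sup>*}"
  have "(\<Sum>v\<in>A. lookup ((trel us (i, j) :: 'k mpoly vec) $ v * xmon (us ! v)) ?\<sigma>) = 0"
  proof (rule sum_over_cut_eq_0[OF T _ _ w])
    fix x y assume xy: "(x, y) \<in> T" "expo_le (elcm us (x, y)) ?\<sigma>"
    then have "(x, y) \<in> ?R" "(y, x) \<in> ?R" by (auto simp: symc_def)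
    moreover have "x < length us" "y < length us" using xy T by (auto simp: edge_pairs_def)
    ultimately show "x \<in> A \<longleftrightarrow> y \<in> A" by (auto simp: A_def intro: rtrancl_into_rtrancl)
  qed (auto simp: A_def)
  also have "(\<Sum>v\<in>A. lookup ((trel us (i, j) :: 'k mpoly vec) $ v * xmon (us ! v)) ?\<sigma>)
     = (\<Sum>v\<in>A. (if v = j then 1 else 0) - (if v = i then 1 else 0))"
    by (intro sum.cong refl) (use ij in \<open>auto simp: A_def trel_entry_mult lookup_xmon\<close>)
  also have "\<dots> = (if j \<in> A then 1 else 0) - (if i \<in> A then 1 else (0::'k))"
    by (simp add: sum_subtractf A_def)
  finally have "i \<in> A \<longleftrightarrow> j \<in> A" by (auto split: if_splits)
  moreover have "i \<in> A" using ij by (simp add: A_def)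
  ultimately show ?thesis by (simp add: A_def)
qed

text \<open>
  Growing a vertex set one neighbour at a time uses a new edge at every step.
\<close>

lemma connected_card_edges:
  assumes V: "finite V" "V \<noteq> {}" and T: "T \<subseteq> V \<times> V"
    and conn: "\<And>x y. x \<in> V \<Longrightarrow> y \<in> V \<Longrightarrow> (x, y) \<in> (symc T)\<^sup>*"
  shows "card V \<le> Suc (card T)"
proof -
  have finT: "finite T" using T V finite_subset by blast
  have "\<exists>A\<subseteq>V. card A = k \<and> k \<le> Suc (card (T \<inter> A \<times> A))" if "1 \<le> k" "k \<le> card V" for k
    using that
  proof (induction k rule: nat_induct_at_least)
    case base
    obtain x where "x \<in> V" using V by blast
    then show ?case by (intro exI[of _ "{x}"]) auto
  next
    case (Suc k)
    then obtain A where A: "A \<subseteq> V" "card A = k" "k \<le> Suc (card (T \<inter> A \<times> A))" by auto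
    then have "A \<noteq> V" "A \<noteq> {}" using Suc by auto
    then obtain x y where xy: "x \<in> A" "y \<in> V" "y \<notin> A" using A by blast
    have "\<exists>a b. (a, b) \<in> symc T \<and> a \<in> A \<and> b \<notin> A"
    proof (rule ccontr)
      assume no: "\<not> ?thesis"
      have "(x, y) \<in> (symc T)\<^sup>*" using conn xy A by blast
      then have "y \<in> A"
      proof (induction rule: rtrancl_induct)
        case (step b c) then show ?case using no by blast
      qed (use xy in simp)
      then show False using xy by simp
    qed
    then obtain a b where ab: "(a, b) \<in> symc T" "a \<in> A" "b \<notin> A" by blast
    then obtain e where e: "e \<in> T" "e = (a, b) \<or> e = (b, a)" by (auto simp: symc_def)
    then have bV: "b \<in> V" using T by auto
    have finA: "finite A" using A V finite_subset by blast
    have "insert e (T \<inter> A \<times> A) \<subseteq> T \<inter> (insert b A \<times> insert b A)" using e ab by auto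
    then have "card (insert e (T \<inter> A \<times> A)) \<le> card (T \<inter> (insert b A \<times> insert b A))"
      using finT by (intro card_mono) auto
    moreover have "e \<notin> T \<inter> A \<times> A" using e ab by auto
    ultimately have "Suc (card (T \<inter> A \<times> A)) \<le> card (T \<inter> (insert b A \<times> insert b A))"
      using finT by simp
    then show ?case using A ab finA bV by (intro exI[of _ "insert b A"]) auto
  qed
  from this[of "card V"] obtain A where "A \<subseteq> V" "card A = card V" "card V \<le> Suc (card (T \<inter> A \<times> A))"
    using V by (auto simp: Suc_le_eq card_gt_0_iff)
  moreover have "card (T \<inter> A \<times> A) \<le> card T" using finT by (intro card_mono) auto
  ultimately show ?thesis by linarith
qed

section \<open>Hilbert-Burch matrices as sets of edges\<close>

text \<open>
  The edge sets of relation trees. Instead of minimality as a generating set, the number of edges is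
  prescribed; the two conditions agree because generating sets of Taylor relations connect all vertices
  (\<open>spanning_edges_card\<close>).
\<close>

definition hb_edges :: "'k::field itself \<Rightarrow> nat \<Rightarrow> expo list \<Rightarrow> (nat \<times> nat) set \<Rightarrow> bool" where
  "hb_edges K n us T \<longleftrightarrow> T \<subseteq> edge_pairs (length us) \<and> card T = length us - 1 \<and>
     submod_span n (length us) (trel us ` T) = (syzygies n us :: 'k mpoly vec set)"

lemma trel_in_syzygies:
  assumes us: "\<And>u. u \<in> set us \<Longrightarrow> keys u \<subseteq> {..<n}" and ij: "i \<noteq> j" "i < length us" "j < length us"
  shows "(trel us (i, j) :: 'k::field mpoly vec) \<in> syzygies n us"
proof -
  have PR: "cofactor us a b \<in> (PR n :: 'k mpoly set)" if "a < length us" for a b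
  proof -
    have "keys (us ! a - expo_gcd (us ! a) (us ! b)) \<subseteq> keys (us ! a)" by (auto simp: in_keys_iff lookup_minus)
    then show ?thesis using us[of "us ! a"] that by (simp add: cofactor_def)
  qed
  have "trel us (i, j) \<in> (free_mod n (length us) :: 'k mpoly vec set)"
    using ij PR by (auto simp: free_mod_def trel_def taylor_relation_def)
  moreover have "(\<Sum>v<length us. (trel us (i, j) :: 'k mpoly vec) $ v * xmon (us ! v)) =
    (\<Sum>v<length us. (if v = j then xmon (elcm us (i, j)) else 0) - (if v = i then xmon (elcm us (i, j)) else 0))"
    using ij by (intro sum.cong refl trel_entry_mult) auto
  then have "(\<Sum>v<length us. (trel us (i, j) :: 'k mpoly vec) $ v * xmon (us ! v)) = 0"
    using ij by (simp add: sum_subtractf)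
  ultimately show ?thesis by (simp add: syzygies_def)
qed

text \<open>
  All Taylor relations are syzygies, so \<open>trel_in_span_connected\<close> applies to every pair of vertices.
\<close>

lemma spanning_edges_connected:
  assumes us: "\<And>u. u \<in> set us \<Longrightarrow> keys u \<subseteq> {..<n}"
    and T: "T \<subseteq> edge_pairs (length us)"
    and span: "submod_span n (length us) (trel us ` T) = (syzygies n us :: 'k::field mpoly vec set)"
    and ij: "i < length us" "j < length us"
  shows "(i, j) \<in> (symc T)\<^sup>*"
proof (cases "i = j")
  case False
  have "(trel us (i, j) :: 'k mpoly vec) \<in> submod_span n (length us) (trel us ` T)"
    using trel_in_syzygies[OF us False ij] span by simp
  from trel_in_span_connected[OF T False ij this] show ?thesis by (rule symc_rtrancl_mono) auto
qed simp

lemma spanning_edges_card: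
  assumes us: "\<And>u. u \<in> set us \<Longrightarrow> keys u \<subseteq> {..<n}"
    and T: "T \<subseteq> edge_pairs (length us)"
    and span: "submod_span n (length us) (trel us ` T) = (syzygies n us :: 'k::field mpoly vec set)"
  shows "length us - 1 \<le> card T"
proof (cases "us = []")
  case False
  have "card {..<length us} \<le> Suc (card T)"
    using False T spanning_edges_connected[OF us T span]
    by (intro connected_card_edges) (auto simp: edge_pairs_def)
  then show ?thesis by simp
qed simp

lemma trel_inj:
  assumes "(i, j) \<in> edge_pairs (length us)" "(k, l) \<in> edge_pairs (length us)"
    and eq: "trel us (i, j) = (trel us (k, l) :: 'k::field mpoly vec)"
  shows "i = k \<and> j = l"
proof -
  have nz: "(trel us (a, b) :: 'k mpoly vec) $ v \<noteq> 0 \<longleftrightarrow> v = a \<or> v = b"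
    if "(a, b) \<in> edge_pairs (length us)" "v < length us" for a b v
    using that by (auto simp: trel_eq_scaled_diff scaled_diff_def edge_pairs_def)
  have "{i, j} = {k, l}"
    using nz[OF assms(1)] nz[OF assms(2)] assms(1,2) eq by (auto simp: edge_pairs_def) (metis order.strict_trans)+
  then show ?thesis using assms(1,2) by (auto simp: edge_pairs_def doubleton_eq_iff)
qed

lemma inj_on_trel: "inj_on (trel us :: _ \<Rightarrow> 'k::field mpoly vec) (edge_pairs (length us))"
  using trel_inj[of _ _ us] by (intro inj_onI) auto

text \<open>
  Distinct edges have distinct Taylor relations, so the rows of the matrix correspond to edges. A set of
  \<open>length us - 1\<close> generating relations is minimal because fewer edges cannot connect all vertices.
\<close>

lemma hilbert_burch_matrix_iff_hb_edges:
  assumes us: "\<And>u. u \<in> set us \<Longrightarrow> keys u \<subseteq> {..<n}"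
  shows "(\<exists>H :: 'k::field mpoly mat. hilbert_burch_matrix n us H \<and> relation_tree_edges us H = T)
     \<longleftrightarrow> hb_edges TYPE('k) n us T"
proof
  assume "\<exists>H :: 'k mpoly mat. hilbert_burch_matrix n us H \<and> relation_tree_edges us H = T"
  then obtain H :: "'k mpoly mat" where H: "hilbert_burch_matrix n us H" "relation_tree_edges us H = T" by blast
  have sub: "T \<subseteq> edge_pairs (length us)" using H(2) by (auto simp: relation_tree_edges_def edge_pairs_def)
  have img: "trel us ` T = set (rows H)"
  proof
    show "trel us ` T \<subseteq> set (rows H)" using H(2) by (auto simp: relation_tree_edges_def trel_def)
    show "set (rows H) \<subseteq> trel us ` T"
    proof
      fix r assume r: "r \<in> set (rows H)"
      then obtain i j where ij: "i < j" "j < length us" "r = taylor_relation us i j"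
        using H(1) by (auto simp: hilbert_burch_matrix_def)
      then have "(i, j) \<in> T" using r H(2) by (auto simp: relation_tree_edges_def)
      then show "r \<in> trel us ` T" using ij by (intro image_eqI[of _ _ "(i, j)"]) (auto simp: trel_def)
    qed
  qed
  have "card T = card (set (rows H))"
    unfolding img[symmetric] using inj_on_subset[OF inj_on_trel sub] by (rule card_image[symmetric])
  also have "\<dots> = length us - 1"
    using H(1) by (simp add: hilbert_burch_matrix_def distinct_card) (metis carrier_matD(1) length_rows)
  finally show "hb_edges TYPE('k) n us T"
    using H(1) sub img by (simp add: hb_edges_def hilbert_burch_matrix_def)
next
  assume T: "hb_edges TYPE('k) n us T"
  then have sub: "T \<subseteq> edge_pairs (length us)" and card: "card T = length us - 1"
    and span: "submod_span n (length us) (trel us ` T) = (syzygies n us :: 'k mpoly vec set)"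
    by (auto simp: hb_edges_def)
  have finT: "finite T" by (rule finite_subset[OF sub finite_edge_pairs])
  obtain es where es: "set es = T" "distinct es" using finite_distinct_list[OF finT] by blast
  define H where "H = mat_of_rows (length us) (map (trel us) es :: 'k mpoly vec list)"
  have rows: "rows H = map (trel us) es" unfolding H_def by (rule rows_mat_of_rows) auto
  have setrows: "set (rows H) = trel us ` T" by (simp add: rows es)
  have inj: "inj_on (trel us :: _ \<Rightarrow> 'k mpoly vec) T" by (rule inj_on_subset[OF inj_on_trel sub])
  have len: "length es = length us - 1" using card es distinct_card by metis
  have tre: "relation_tree_edges us H = T"
  proof (rule Set.set_eqI)
    fix e :: "nat \<times> nat"
    obtain i j where e: "e = (i, j)" by fastforce
    have "(i, j) \<in> T" if "(i, j) \<in> edge_pairs (length us)" "(trel us (i, j) :: 'k mpoly vec) \<in> trel us ` T"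
      using that sub trel_inj[of i j us] by fastforce
    moreover have "(i, j) \<in> relation_tree_edges us H \<longleftrightarrow>
        (i, j) \<in> edge_pairs (length us) \<and> (trel us (i, j) :: 'k mpoly vec) \<in> trel us ` T"
      unfolding relation_tree_edges_def setrows by (auto simp: trel_def edge_pairs_def)
    ultimately show "e \<in> relation_tree_edges us H \<longleftrightarrow> e \<in> T"
      using sub unfolding e by blast
  qed
  have "hilbert_burch_matrix n us H"
    unfolding hilbert_burch_matrix_def
  proof (intro conjI ballI allI impI)
    show "H \<in> carrier_mat (length us - 1) (length us)" by (simp add: H_def len mat_of_rows_def)
    show "distinct (rows H)" using es inj by (simp add: rows distinct_map)
    show "submod_span n (length us) (set (rows H)) = syzygies n us" by (simp add: setrows span)
    fix r assume "r \<in> set (rows H)"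
    then obtain i j where "(i, j) \<in> T" "r = trel us (i, j)" unfolding setrows by auto
    then show "\<exists>i j. i < j \<and> j < length us \<and> r = taylor_relation us i j"
      using sub by (intro exI[of _ i] exI[of _ j]) (auto simp: trel_def edge_pairs_def)
  next
    fix B assume B: "B \<subset> set (rows H)"
    then obtain T' where T': "T' \<subseteq> T" "B = trel us ` T'" unfolding setrows using subset_image_iff[of B] by (metis psubset_imp_subset)
    then have "T' \<subset> T" using B setrows by auto
    then have "card T' < length us - 1" using card finT psubset_card_mono by metis
    then show "submod_span n (length us) B \<noteq> syzygies n us"
      using spanning_edges_card[of us n T', where 'k = 'k] us T' sub by auto
  qed
  then show "\<exists>H :: 'k mpoly mat. hilbert_burch_matrix n us H \<and> relation_tree_edges us H = T" using tre by blast
qed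

lemma parcs_taylor_graph:
  assumes us: "\<And>u. u \<in> set us \<Longrightarrow> keys u \<subseteq> {..<n}"
  shows "parcs (taylor_graph TYPE('k::field) n us) = (\<Union>T\<in>{T. hb_edges TYPE('k) n us T}. symc T)"
proof -
  have "parcs (taylor_graph TYPE('k) n us) =
    (\<Union>T\<in>{T. \<exists>H :: 'k mpoly mat. hilbert_burch_matrix n us H \<and> relation_tree_edges us H = T}. symc T)"
    by (auto simp: taylor_graph_def relation_trees_def relation_tree_def symc_def)
  then show ?thesis using hilbert_burch_matrix_iff_hb_edges[OF us, where 'k = 'k] by simp
qed

section \<open>Linear resolutions\<close>

lemma homogeneous_0 [simp]: "homogeneous d 0"
  by (simp add: homogeneous_def)

lemma homogeneous_add: "homogeneous d p \<Longrightarrow> homogeneous d q \<Longrightarrow> homogeneous d (p + q)"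
  using keys_add[of p q] by (auto simp: homogeneous_def)

lemma homogeneous_sum: "(\<And>a. a \<in> A \<Longrightarrow> homogeneous d (f a)) \<Longrightarrow> homogeneous d (sum f A)"
  by (induction A rule: infinite_finite_induct) (auto intro: homogeneous_add)

lemma homogeneous_Cst_mult: "homogeneous d p \<Longrightarrow> homogeneous d (Cst c * p)"
  by (auto simp: homogeneous_def in_keys_iff lookup_Cst_mult)

lemma homogeneous_unique: "homogeneous d p \<Longrightarrow> homogeneous d' p \<Longrightarrow> p \<noteq> 0 \<Longrightarrow> d = d'"
  by (metis homogeneous_def keys_eq_empty ex_in_conv sum_singles sum.empty)

lemma homogeneous_eqI:
  assumes "homogeneous (int d) p" "homogeneous (int d) q" "\<And>t. expo_deg t = d \<Longrightarrow> lookup p t = lookup q t"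
  shows "p = q"
proof (rule poly_mapping_eqI)
  fix t show "lookup p t = lookup q t"
  proof (cases "expo_deg t = d")
    case False
    then have "t \<notin> keys p" "t \<notin> keys q" using assms(1,2) by (auto simp: homogeneous_def)
    then show ?thesis by (simp add: in_keys_iff)
  qed (use assms(3) in simp)
qed

text \<open>
  All elements of \<open>I\<close> have order at least \<open>d\<close>, so a monomial of degree \<open>d\<close> in \<open>I\<close> is itself a generator. Hence
  the generators of degree \<open>d\<close> already generate \<open>I\<close>, and minimality leaves no others.
\<close>

lemma minimal_generators_same_degree:
  fixes I :: "'k::field mpoly set"
  assumes gen: "minimal_monomial_generators n I us" and deg: "generated_in_degree n d I"
  shows "\<forall>u\<in>set us. expo_deg u = d"
proof -
  have us: "\<And>u. u \<in> set us \<Longrightarrow> keys u \<subseteq> {..<n}" and I: "I = ideal_of_monomials n (set us)"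
    and min: "\<And>M. M \<subset> set us \<Longrightarrow> ideal_of_monomials n M \<noteq> I"
    using gen by (auto simp: minimal_monomial_generators_def)
  obtain F where F: "F \<subseteq> PR n" "\<And>f. f \<in> F \<Longrightarrow> homogeneous (int d) f" "I = genideal (poly_ring n) F"
    using deg by (auto simp: generated_in_degree_def)
  have low: "d \<le> expo_deg t" if "p \<in> ispan F" "t \<in> keys p" for p t
    using that
  proof (induction arbitrary: t rule: mult_module.span_induct_alt)
    case (step c x y)
    then have "t \<in> keys (c * x) \<or> t \<in> keys y" using keys_add[of "c * x" y] by auto
    then show ?case
    proof
      assume "t \<in> keys (c * x)"
      then obtain r s where "s \<in> keys x" "t = r + s" using keys_multD by blast
      then show ?thesis using F(2)[OF step(1)] by (auto simp: homogeneous_def expo_deg_add)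
    qed (use step in auto)
  qed simp
  have Ilow: "d \<le> expo_deg t" if "p \<in> I" "t \<in> keys p" for p t
    using that low F(3) genideal_poly_ring[OF F(1)] by auto
  have xI: "xmon u \<in> I" if "u \<in> set us" for u
    using that us unfolding I by (auto simp: ideal_of_monomials_iff intro!: bexI[of _ u])
  have degge: "d \<le> expo_deg u" if "u \<in> set us" for u using Ilow[OF xI[OF that], of u] by simp
  define M where "M = {u \<in> set us. expo_deg u = d}"
  have usM: "\<And>u. u \<in> M \<Longrightarrow> keys u \<subseteq> {..<n}" using us by (simp add: M_def)
  interpret cring "poly_ring n :: 'k mpoly ring" by (rule cring_poly_ring)
  have idM: "ideal (ideal_of_monomials n M :: 'k mpoly set) (poly_ring n)"
    unfolding ideal_of_monomials_def using usM by (intro genideal_ideal) auto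
  have "F \<subseteq> ideal_of_monomials n M"
  proof
    fix f assume f: "f \<in> F"
    then have fI: "f \<in> I" using F genideal_self[OF F(1)] by auto
    have "\<exists>u\<in>M. expo_le u t" if t: "t \<in> keys f" for t
    proof -
      obtain u where u: "u \<in> set us" "expo_le u t" using fI t us unfolding I by (auto simp: ideal_of_monomials_iff)
      moreover have "expo_deg t = d" using F(2)[OF f] t by (auto simp: homogeneous_def)
      ultimately have "u = t" using degge[OF u(1)] by (intro expo_le_deg_eq) auto
      then show ?thesis using u \<open>expo_deg t = d\<close> by (auto simp: M_def)
    qed
    then show "f \<in> ideal_of_monomials n M" using f F(1) usM by (auto simp: ideal_of_monomials_iff)
  qed
  then have "I \<subseteq> ideal_of_monomials n M" unfolding F(3) by (rule genideal_minimal[OF idM])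
  moreover have "ideal_of_monomials n M \<subseteq> I"
  proof
    fix p :: "'k mpoly" assume "p \<in> ideal_of_monomials n M"
    then have "p \<in> PR n" "\<forall>t\<in>keys p. \<exists>u\<in>M. expo_le u t" using ideal_of_monomials_iff[OF usM] by auto
    then have "p \<in> PR n" "\<forall>t\<in>keys p. \<exists>u\<in>set us. expo_le u t" by (auto simp: M_def)
    then show "p \<in> I" unfolding I using us by (simp add: ideal_of_monomials_iff)
  qed
  ultimately have "\<not> M \<subset> set us" using min by blast
  then show ?thesis by (auto simp: M_def)
qed

definition linear_syzygies :: "nat \<Rightarrow> expo list \<Rightarrow> 'k::field mpoly vec set" where
  "linear_syzygies n us = {w \<in> syzygies n us. \<forall>v<length us. homogeneous 1 (w $ v)}"

lemma syzygies_carrier: "w \<in> syzygies n us \<Longrightarrow> w \<in> carrier_vec (length us)"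
  by (simp add: syzygies_def free_mod_def)

text \<open>
  The images \<open>g\<close> of the basis of the free module \<open>F\<^sub>0\<close> and the monomials \<open>us\<close> generate the same space in
  degree \<open>d\<close>, so they are related by constant matrices \<open>\<alpha>\<close> and \<open>\<beta>\<close> with \<open>\<alpha> \<beta> = 1\<close>. The map \<open>\<beta>\<close> takes a
  syzygy \<open>w\<close> of \<open>us\<close> to one of \<open>g\<close>, that is a combination of the columns of \<open>\<phi> 0\<close>; and \<open>\<alpha>\<close> takes it back to
  \<open>w\<close> and the columns, whose entries are linear, to linear syzygies.
\<close>

lemma linear_resolution_syzygies:
  fixes I :: "'k::field mpoly set"
  assumes gen: "minimal_monomial_generators n I us" and deg: "\<forall>u\<in>set us. expo_deg u = d"
    and lin: "linear_resolution n I"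
  shows "syzygies n us \<subseteq> submod_span n (length us) (linear_syzygies n us :: 'k mpoly vec set)"
proof
  let ?N = "length us"
  fix w :: "'k mpoly vec" assume w: "w \<in> syzygies n us"
  have us: "\<And>u. u \<in> set us \<Longrightarrow> keys u \<subseteq> {..<n}" and I: "I = ideal_of_monomials n (set us)" and dist: "distinct us"
    using gen by (auto simp: minimal_monomial_generators_def)
  obtain b a g \<phi> where res: "graded_free_resolution n I b a g \<phi>"
    and lin1: "\<And>i p q. p < b i \<Longrightarrow> q < b (Suc i) \<Longrightarrow> homogeneous 1 (\<phi> i $$ (p, q))"
    using lin unfolding linear_resolution_def minimal_graded_free_resolution_def by blast
  have g: "g \<in> free_mod n (b 0)" and ghom: "\<And>j. j < b 0 \<Longrightarrow> homogeneous (a 0 j) (g $ j)"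
    and \<phi>: "\<phi> 0 \<in> poly_mat n (b 0) (b 1)"
    and \<phi>hom: "\<And>p q. p < b 0 \<Longrightarrow> q < b 1 \<Longrightarrow> homogeneous (a 1 q - a 0 p) (\<phi> 0 $$ (p, q))"
    and img: "(\<lambda>v. g \<bullet> v) ` free_mod n (b 0) = I"
    and ker: "{v \<in> free_mod n (b 0). g \<bullet> v = 0} = (\<lambda>w. \<phi> 0 *\<^sub>v w) ` free_mod n (b 1)"
    using res by (auto simp: graded_free_resolution_def)
  have sp: "g \<bullet> v = (\<Sum>p<b 0. g $ p * v $ p)" if "v \<in> free_mod n (b 0)" for v
  proof -
    have "dim_vec v = b 0" using that by (auto simp: free_mod_def)
    then show ?thesis by (simp add: scalar_prod_def lessThan_atLeast0)
  qed
  have mv: "(\<phi> 0 *\<^sub>v c) $ p = (\<Sum>q<b 1. \<phi> 0 $$ (p, q) * c $ q)" if "c \<in> free_mod n (b 1)" "p < b 0" for c p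
    using that \<phi> by (auto simp: scalar_prod_def free_mod_def poly_mat_def lessThan_atLeast0)
  have gI: "g $ p \<in> I" if "p < b 0" for p
  proof -
    have "unit_vec (b 0) p \<in> (free_mod n (b 0) :: 'k mpoly vec set)" using that by (auto simp: free_mod_def)
    then have "g \<bullet> unit_vec (b 0) p \<in> I" using img by blast
    moreover have "g \<bullet> unit_vec (b 0) p = g $ p"
      using g that by (simp add: free_mod_def)
    ultimately show ?thesis by simp
  qed
  have Ile: "\<exists>u\<in>set us. expo_le u t" if "p \<in> I" "t \<in> keys p" for p t
    using that us unfolding I by (auto simp: ideal_of_monomials_iff)
  have Ilow: "d \<le> expo_deg t" if "p \<in> I" "t \<in> keys p" for p t
    using Ile[OF that] deg expo_le_deg by fastforce
  \<comment> \<open>Only the basis elements of degree d matter; other degrees may a priori occur as well.\<close>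
  define D where "D = {p. p < b 0 \<and> a 0 p = int d}"
  have D: "finite D" "D \<subseteq> {..<b 0}" by (auto simp: D_def)
  have xI: "xmon u \<in> I" if "u \<in> set us" for u
    using that us unfolding I by (auto simp: ideal_of_monomials_iff intro!: bexI[of _ u])
  have "\<exists>v\<in>free_mod n (b 0). g \<bullet> v = xmon (us ! i)" if "i < ?N" for i
    using xI[of "us ! i"] that img by (metis imageE nth_mem)
  then obtain V where V: "\<And>i. i < ?N \<Longrightarrow> V i \<in> free_mod n (b 0)" "\<And>i. i < ?N \<Longrightarrow> g \<bullet> V i = xmon (us ! i)"
    by metis
  \<comment> \<open>\<open>\<beta>\<close> writes the monomials in terms of g, and \<open>\<alpha>\<close> writes g in terms of the monomials, in degree d.\<close>
  define \<beta> where "\<beta> p i = lookup (V i $ p) 0" for p i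
  define \<alpha> where "\<alpha> i p = lookup (g $ p) (us ! i)" for i p
  have hD: "homogeneous (int d) (g $ p)" if "p \<in> D" for p
    using ghom[of p] that by (auto simp: D_def)
  have u_eq: "xmon (us ! i) = (\<Sum>p\<in>D. Cst (\<beta> p i) * g $ p)" if i: "i < ?N" for i
  proof (rule homogeneous_eqI[of d])
    show "homogeneous (int d) (xmon (us ! i) :: 'k mpoly)" using deg i by (auto simp: homogeneous_def)
    show "homogeneous (int d) (\<Sum>p\<in>D. Cst (\<beta> p i) * g $ p)"
      by (intro homogeneous_sum homogeneous_Cst_mult hD)
    fix t assume t: "expo_deg t = d"
    have "lookup (xmon (us ! i)) t = (\<Sum>p<b 0. lookup (V i $ p * g $ p) t)"
      unfolding V(2)[OF i, symmetric] sp[OF V(1)[OF i]] lookup_sum by (simp add: mult.commute)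
    also have "\<dots> = (\<Sum>p<b 0. \<beta> p i * lookup (g $ p) t)"
      using gI Ilow t unfolding \<beta>_def by (intro sum.cong refl lookup_mult_low_degree) auto
    also have "\<dots> = (\<Sum>p\<in>D. \<beta> p i * lookup (g $ p) t)"
    proof (rule sum.mono_neutral_right)
      show "\<forall>p\<in>{..<b 0} - D. \<beta> p i * lookup (g $ p) t = 0"
        using ghom t by (auto simp: D_def homogeneous_def in_keys_iff)
    qed (use D in auto)
    finally show "lookup (xmon (us ! i)) t = lookup (\<Sum>p\<in>D. Cst (\<beta> p i) * g $ p) t"
      by (simp add: lookup_sum lookup_Cst_mult)
  qed
  have g_eq: "g $ p = (\<Sum>i<?N. Cst (\<alpha> i p) * xmon (us ! i))" if p: "p \<in> D" for p
  proof (rule poly_mapping_eqI)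
    fix t
    have "lookup (\<Sum>i<?N. Cst (\<alpha> i p) * xmon (us ! i)) t = (\<Sum>i<?N. if us ! i = t then lookup (g $ p) t else 0)"
      by (auto simp: lookup_sum lookup_Cst_mult lookup_xmon \<alpha>_def intro!: sum.cong)
    also have "\<dots> = lookup (g $ p) t"
    proof (cases "t \<in> set us")
      case True
      then obtain k where k: "k < ?N" "us ! k = t" by (auto simp: in_set_conv_nth)
      have "(\<Sum>i<?N. if us ! i = t then lookup (g $ p) t else 0) = (\<Sum>i<?N. if i = k then lookup (g $ p) t else 0)"
        using k dist by (intro sum.cong) (auto simp: nth_eq_iff_index_eq)
      then show ?thesis using k by simp
    next
      case False
      have "t \<notin> keys (g $ p)"
      proof
        assume t: "t \<in> keys (g $ p)"
        then obtain u where "u \<in> set us" "expo_le u t" using Ile gI p D by blast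
        moreover have "expo_deg t = d" using hD[OF p] t by (auto simp: homogeneous_def)
        ultimately have "u = t" using deg by (intro expo_le_deg_eq) auto
        then show False using \<open>u \<in> set us\<close> False by simp
      qed
      then show ?thesis using False by (auto simp: in_keys_iff intro!: sum.neutral)
    qed
    finally show "lookup (g $ p) t = lookup (\<Sum>i<?N. Cst (\<alpha> i p) * xmon (us ! i)) t" by simp
  qed
  have inv: "(\<Sum>p\<in>D. \<alpha> k p * \<beta> p i) = (if k = i then 1 else 0)" if "i < ?N" "k < ?N" for i k
  proof -
    have "lookup (xmon (us ! i) :: 'k mpoly) (us ! k) = (\<Sum>p\<in>D. \<beta> p i * \<alpha> k p)"
      unfolding u_eq[OF that(1)] by (simp add: lookup_sum lookup_Cst_mult \<alpha>_def)
    then show ?thesis using that dist by (simp add: lookup_xmon nth_eq_iff_index_eq mult.commute)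
  qed
  have wPR: "w $ i \<in> PR n" if "i < ?N" for i using w that by (simp add: syzygies_def free_mod_def)
  \<comment> \<open>The syzygy of g obtained from w.\<close>
  define v where "v = vec (b 0) (\<lambda>p. if p \<in> D then \<Sum>i<?N. Cst (\<beta> p i) * w $ i else 0)"
  have "(\<Sum>i<?N. Cst (\<beta> p i) * w $ i) \<in> PR n" for p
    by (intro PR_sum PR_mult wPR PR_single) auto
  then have v: "v \<in> free_mod n (b 0)" by (simp add: free_mod_def v_def)
  have "g \<bullet> v = (\<Sum>p<b 0. if p \<in> D then g $ p * (\<Sum>i<?N. Cst (\<beta> p i) * w $ i) else 0)"
    unfolding sp[OF v] by (intro sum.cong) (auto simp: v_def)
  also have "\<dots> = (\<Sum>p\<in>D. g $ p * (\<Sum>i<?N. Cst (\<beta> p i) * w $ i))"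
    using D by (simp add: sum.inter_restrict[symmetric] Int_absorb1)
  also have "\<dots> = (\<Sum>i<?N. w $ i * (\<Sum>p\<in>D. Cst (\<beta> p i) * g $ p))"
    unfolding sum_distrib_left by (subst sum.swap) (intro sum.cong refl, simp only: mult_ac)
  also have "\<dots> = (\<Sum>i<?N. w $ i * xmon (us ! i))"
    by (intro sum.cong refl) (use u_eq in auto)
  also have "\<dots> = 0" using w by (simp add: syzygies_def)
  finally have "v \<in> {v \<in> free_mod n (b 0). g \<bullet> v = 0}" using v by simp
  then obtain c where c: "c \<in> free_mod n (b 1)" "v = \<phi> 0 *\<^sub>v c" unfolding ker by blast
  \<comment> \<open>The column q of the first map, turned into a syzygy of the monomials.\<close>
  define ls where "ls q = vec ?N (\<lambda>i. \<Sum>p\<in>D. Cst (\<alpha> i p) * \<phi> 0 $$ (p, q))" for q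
  have \<phi>PR: "\<phi> 0 $$ (p, q) \<in> PR n" if "p < b 0" "q < b 1" for p q using \<phi> that by (simp add: poly_mat_def)
  have lslin: "ls q \<in> linear_syzygies n us" if q: "q < b 1" for q
  proof -
    have col: "(\<Sum>p<b 0. g $ p * \<phi> 0 $$ (p, q)) = 0"
    proof -
      have u: "unit_vec (b 1) q \<in> (free_mod n (b 1) :: 'k mpoly vec set)" using q by (auto simp: free_mod_def)
      then have *: "\<phi> 0 *\<^sub>v unit_vec (b 1) q \<in> {v \<in> free_mod n (b 0). g \<bullet> v = 0}" unfolding ker by blast
      have "(\<phi> 0 *\<^sub>v unit_vec (b 1) q) $ p = \<phi> 0 $$ (p, q)" if "p < b 0" for p
        unfolding mv[OF u that] using q by (simp add: unit_vec_def if_distrib sum.delta cong: if_cong)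
      then show ?thesis using * sp[of "\<phi> 0 *\<^sub>v unit_vec (b 1) q"] by simp
    qed
    \<comment> \<open>A column with a nonzero linear entry in a row of D has degree \<open>d + 1\<close>, so its nonzero entries all lie
      in rows of D.\<close>
    have "(\<Sum>p\<in>D. g $ p * \<phi> 0 $$ (p, q)) = 0"
    proof (cases "\<forall>p\<in>D. \<phi> 0 $$ (p, q) = 0")
      case False
      then obtain p0 where p0: "p0 \<in> D" "\<phi> 0 $$ (p0, q) \<noteq> 0" by blast
      have step1: "a 1 q - a 0 p = 1" if "p < b 0" "\<phi> 0 $$ (p, q) \<noteq> 0" for p
        using homogeneous_unique[OF \<phi>hom[OF that(1) q] lin1[of p 0 q] that(2)] that q by simp
      have "a 1 q = int d + 1" using step1[of p0] p0 by (auto simp: D_def)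
      then have "\<forall>p\<in>{..<b 0} - D. \<phi> 0 $$ (p, q) = 0" using step1 by (force simp: D_def)
      then have "(\<Sum>p\<in>D. g $ p * \<phi> 0 $$ (p, q)) = (\<Sum>p<b 0. g $ p * \<phi> 0 $$ (p, q))"
        using D by (intro sum.mono_neutral_left) auto
      then show ?thesis using col by simp
    qed simp
    moreover have "(\<Sum>i<?N. ls q $ i * xmon (us ! i)) = (\<Sum>p\<in>D. g $ p * \<phi> 0 $$ (p, q))"
    proof -
      have "(\<Sum>i<?N. ls q $ i * xmon (us ! i)) = (\<Sum>i<?N. \<Sum>p\<in>D. Cst (\<alpha> i p) * \<phi> 0 $$ (p, q) * xmon (us ! i))"
        by (simp add: ls_def sum_distrib_right)
      also have "\<dots> = (\<Sum>p\<in>D. (\<Sum>i<?N. Cst (\<alpha> i p) * xmon (us ! i)) * \<phi> 0 $$ (p, q))"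
        unfolding sum_distrib_right by (subst sum.swap) (intro sum.cong refl, simp only: mult_ac)
      also have "\<dots> = (\<Sum>p\<in>D. g $ p * \<phi> 0 $$ (p, q))"
        by (intro sum.cong refl) (simp only: g_eq)
      finally show ?thesis .
    qed
    moreover have "(\<Sum>p\<in>D. Cst (\<alpha> i p) * \<phi> 0 $$ (p, q)) \<in> PR n" for i
      by (intro PR_sum PR_mult \<phi>PR PR_single) (use q D in auto)
    then have "ls q \<in> free_mod n ?N" by (simp add: free_mod_def ls_def)
    moreover have "homogeneous 1 (ls q $ i)" if "i < ?N" for i
    proof -
      have "homogeneous 1 (\<Sum>p\<in>D. Cst (\<alpha> i p) * \<phi> 0 $$ (p, q))"
        using lin1[of _ 0 q] q D by (intro homogeneous_sum homogeneous_Cst_mult) auto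
      then show ?thesis using that by (simp add: ls_def)
    qed
    ultimately show ?thesis by (simp add: linear_syzygies_def syzygies_def)
  qed
  have lc: "linear_syzygies n us \<subseteq> (carrier_vec ?N :: 'k mpoly vec set)"
    using syzygies_carrier by (auto simp: linear_syzygies_def)
  show "w \<in> submod_span n ?N (linear_syzygies n us)"
  proof (rule submod_span_sum[of "{..<b 1}" ls n ?N _ "\<lambda>q. c $ q" w])
    show "ls q \<in> submod_span n ?N (linear_syzygies n us)" if "q \<in> {..<b 1}" for q
      using lslin that lc by (intro submod_span_base) auto
    show "c $ q \<in> PR n" if "q \<in> {..<b 1}" for q using c(1) that by (simp add: free_mod_def)
    fix i assume i: "i < ?N"
    have "(\<Sum>q<b 1. c $ q * ls q $ i) = (\<Sum>q<b 1. \<Sum>p\<in>D. Cst (\<alpha> i p) * (\<phi> 0 $$ (p, q) * c $ q))"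
    proof (rule sum.cong)
      fix q
      have "c $ q * ls q $ i = c $ q * (\<Sum>p\<in>D. Cst (\<alpha> i p) * \<phi> 0 $$ (p, q))" using i by (simp add: ls_def)
      also have "\<dots> = (\<Sum>p\<in>D. Cst (\<alpha> i p) * (\<phi> 0 $$ (p, q) * c $ q))"
        unfolding sum_distrib_left by (intro sum.cong refl) (simp only: mult_ac)
      finally show "c $ q * ls q $ i = (\<Sum>p\<in>D. Cst (\<alpha> i p) * (\<phi> 0 $$ (p, q) * c $ q))" .
    qed simp
    also have "\<dots> = (\<Sum>p\<in>D. Cst (\<alpha> i p) * (\<Sum>q<b 1. \<phi> 0 $$ (p, q) * c $ q))"
      by (subst sum.swap) (simp add: sum_distrib_left)
    also have "\<dots> = (\<Sum>p\<in>D. Cst (\<alpha> i p) * v $ p)"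
      using mv[OF c(1)] c(2) D by (intro sum.cong) auto
    also have "\<dots> = (\<Sum>p\<in>D. \<Sum>k<?N. Cst (\<alpha> i p * \<beta> p k) * w $ k)"
    proof (rule sum.cong)
      fix p assume "p \<in> D"
      then have "v $ p = (\<Sum>k<?N. Cst (\<beta> p k) * w $ k)" using D by (auto simp: v_def)
      then show "Cst (\<alpha> i p) * v $ p = (\<Sum>k<?N. Cst (\<alpha> i p * \<beta> p k) * w $ k)"
        by (simp add: sum_distrib_left mult.assoc[symmetric] mult_single)
    qed simp
    also have "\<dots> = (\<Sum>k<?N. (\<Sum>p\<in>D. Cst (\<alpha> i p * \<beta> p k)) * w $ k)"
      by (subst sum.swap) (simp add: sum_distrib_right)
    also have "\<dots> = (\<Sum>k<?N. (if i = k then 1 else 0) * w $ k)"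
    proof (rule sum.cong)
      fix k assume "k \<in> {..<?N}"
      then have "(\<Sum>p\<in>D. \<alpha> i p * \<beta> p k) = (if i = k then 1 else 0)" using inv i by simp
      moreover have "(\<Sum>p\<in>D. Cst (\<alpha> i p * \<beta> p k)) = Cst (\<Sum>p\<in>D. \<alpha> i p * \<beta> p k)"
        by (rule poly_mapping_eqI) (simp add: lookup_sum lookup_single when_def)
      ultimately show "(\<Sum>p\<in>D. Cst (\<alpha> i p * \<beta> p k)) * w $ k = (if i = k then 1 else 0) * w $ k" by simp
    qed simp
    also have "\<dots> = w $ i" using i by (simp add: if_distrib[of "\<lambda>x. x * _"] cong: if_cong)
    finally show "w $ i = (\<Sum>q<b 1. c $ q * ls q $ i)" by simp
  qed (use lc w in \<open>auto intro: syzygies_carrier\<close>)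
qed

lemma expo_lcm_degree_ge:
  assumes "distinct us" "\<forall>u\<in>set us. expo_deg u = d" "i \<noteq> j" "i < length us" "j < length us"
  shows "Suc d \<le> expo_deg (elcm us (i, j))"
proof (rule ccontr)
  assume "\<not> ?thesis"
  then have "expo_deg (elcm us (i, j)) \<le> d" by simp
  then have "us ! i = elcm us (i, j)" "us ! j = elcm us (i, j)"
    using assms expo_le_lcm[of "us ! i" "us ! j"] by (auto intro!: expo_le_deg_eq)
  then show False using assms nth_eq_iff_index_eq by metis
qed

lemma keys_trel_entry:
  assumes "i \<noteq> j" "v < length us" "t \<in> keys ((trel us (i, j) :: 'k::field mpoly vec) $ v)"
  shows "expo_deg t + expo_deg (us ! v) = expo_deg (elcm us (i, j))"
proof -
  have "t = elcm us (i, j) - us ! v \<and> expo_le (us ! v) (elcm us (i, j))"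
    using assms by (auto simp: trel_eq_scaled_diff scaled_diff_def split: if_splits)
  then show ?thesis using expo_deg_add[of "us ! v" t] by (simp add: expo_le_add_diff)
qed

text \<open>
  Every edge of \<open>T\<close> has degree at least \<open>d + 1\<close>. The degree-one part of a representation of a linear syzygy
  by the relations of \<open>T\<close> involves only constant multiples of the linear relations \<open>T'\<close>. So \<open>T'\<close> generates
  all linear syzygies, hence all syzygies, and \<open>spanning_edges_card\<close> forces \<open>T' = T\<close>.
\<close>

lemma hb_edges_linear:
  assumes us: "\<And>u. u \<in> set us \<Longrightarrow> keys u \<subseteq> {..<n}" and dist: "distinct us"
    and deg: "\<forall>u\<in>set us. expo_deg u = d"
    and lin: "syzygies n us \<subseteq> submod_span n (length us) (linear_syzygies n us :: 'k::field mpoly vec set)"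
    and T: "hb_edges TYPE('k) n us T" and e: "e \<in> T"
  shows "expo_deg (elcm us e) = Suc d"
proof -
  let ?N = "length us"
  have sub: "T \<subseteq> edge_pairs ?N" and card: "card T = ?N - 1"
    and span: "submod_span n ?N (trel us ` T) = (syzygies n us :: 'k mpoly vec set)"
    using T by (auto simp: hb_edges_def)
  have finT: "finite T" by (rule finite_subset[OF sub finite_edge_pairs])
  define T' where "T' = {e \<in> T. expo_deg (elcm us e) = Suc d}"
  have ltrel: "trel us ` T' \<subseteq> (carrier_vec ?N :: 'k mpoly vec set)" by auto
  have entry: "expo_deg t + d = expo_deg (elcm us e)"
    if "e \<in> T" "v < ?N" "t \<in> keys ((trel us e :: 'k mpoly vec) $ v)" for e v t
    using that sub keys_trel_entry[of "fst e" "snd e" v us t, where 'k = 'k] deg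
    by (cases e) (auto simp: edge_pairs_def)
  have low: "Suc d \<le> expo_deg (elcm us e)" if "e \<in> T" for e
    using that sub expo_lcm_degree_ge[OF dist deg, of "fst e" "snd e"] by (cases e) (auto simp: edge_pairs_def)
  have "linear_syzygies n us \<subseteq> (submod_span n ?N (trel us ` T') :: 'k mpoly vec set)"
  proof
    fix w :: "'k mpoly vec" assume w: "w \<in> linear_syzygies n us"
    then have "w \<in> submod_span n ?N (trel us ` T)" using span by (auto simp: linear_syzygies_def)
    then obtain c where c: "\<And>e. e \<in> T \<Longrightarrow> c e \<in> PR n" "\<And>v. v < ?N \<Longrightarrow> w $ v = (\<Sum>e\<in>T. c e * (trel us e $ v))"
      using submod_span_image_coeffs[OF finT, of "trel us" ?N w n] by auto
    show "w \<in> submod_span n ?N (trel us ` T')"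
    proof (rule submod_span_sum[of T' "trel us" n ?N _ "\<lambda>e. Cst (lookup (c e) 0)" w])
      show "trel us e \<in> submod_span n ?N (trel us ` T')" if "e \<in> T'" for e
        using that ltrel by (intro submod_span_base) auto
      show "w \<in> carrier_vec ?N" using w syzygies_carrier by (auto simp: linear_syzygies_def)
      fix v assume v: "v < ?N"
      show "w $ v = (\<Sum>e\<in>T'. Cst (lookup (c e) 0) * (trel us e $ v))"
      proof (rule homogeneous_eqI[of 1])
        show "homogeneous (int 1) (w $ v)" using w v by (simp add: linear_syzygies_def)
        have "homogeneous 1 ((trel us e :: 'k mpoly vec) $ v)" if "e \<in> T'" for e
          using entry[of e v] that v by (fastforce simp: homogeneous_def T'_def)
        then show "homogeneous (int 1) (\<Sum>e\<in>T'. Cst (lookup (c e) 0) * (trel us e $ v))"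
          by (intro homogeneous_sum homogeneous_Cst_mult) auto
        fix t :: expo assume t: "expo_deg t = 1"
        have "lookup (w $ v) t = (\<Sum>e\<in>T. lookup (c e * (trel us e $ v)) t)"
          unfolding c(2)[OF v] by (simp add: lookup_sum)
        also have "\<dots> = (\<Sum>e\<in>T. lookup (c e) 0 * lookup (trel us e $ v) t)"
        proof (intro sum.cong refl lookup_mult_low_degree)
          fix e s assume "e \<in> T" "s \<in> keys ((trel us e :: 'k mpoly vec) $ v)"
          then show "expo_deg t \<le> expo_deg s" using entry[OF _ v] low t by fastforce
        qed
        also have "\<dots> = (\<Sum>e\<in>T'. lookup (c e) 0 * lookup (trel us e $ v) t)"
        proof (rule sum.mono_neutral_right[OF finT])
          show "\<forall>e\<in>T - T'. lookup (c e) 0 * lookup (trel us e $ v) t = 0"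
          proof
            fix e assume e: "e \<in> T - T'"
            then have "t \<notin> keys ((trel us e :: 'k mpoly vec) $ v)" using entry[of e v t] v t by (auto simp: T'_def)
            then show "lookup (c e) 0 * lookup (trel us e $ v) t = 0" by (simp add: in_keys_iff)
          qed
        qed (auto simp: T'_def)
        finally show "lookup (w $ v) t = lookup (\<Sum>e\<in>T'. Cst (lookup (c e) 0) * (trel us e $ v)) t"
          by (simp add: lookup_sum lookup_Cst_mult)
      qed
    qed (use finT ltrel in \<open>auto simp: T'_def\<close>)
  qed
  then have "submod_span n ?N (linear_syzygies n us) \<subseteq> (submod_span n ?N (trel us ` T') :: 'k mpoly vec set)"
    by (rule submod_span_minimal[OF ltrel])
  then have "syzygies n us \<subseteq> (submod_span n ?N (trel us ` T') :: 'k mpoly vec set)" using lin by blast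
  moreover have "submod_span n ?N (trel us ` T') \<subseteq> (syzygies n us :: 'k mpoly vec set)"
    unfolding span[symmetric] by (rule submod_span_mono) (auto simp: T'_def)
  ultimately have "submod_span n ?N (trel us ` T') = (syzygies n us :: 'k mpoly vec set)" by blast
  then have "?N - 1 \<le> card T'"
    using spanning_edges_card[of us n T', where 'k = 'k] us sub by (auto simp: T'_def)
  moreover have "T' \<subseteq> T" by (auto simp: T'_def)
  ultimately have "T' = T" using card finT by (metis card_seteq)
  then show ?thesis using e by (auto simp: T'_def)
qed

section \<open>Monochromatic paths and exchange\<close>

text \<open>
  The colour of an edge is the least common multiple of its two generators.
\<close>

definition colour_class :: "expo list \<Rightarrow> (nat \<times> nat) set \<Rightarrow> expo \<Rightarrow> (nat \<times> nat) set" where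
  "colour_class us T \<sigma> = {e \<in> T. elcm us e = \<sigma>}"

lemma scaled_diff_in_span:
  assumes S: "S \<subseteq> edge_pairs (length us)" "\<And>e. e \<in> S \<Longrightarrow> elcm us e = \<sigma>"
    and ij: "(i, j) \<in> (symc S)\<^sup>*"
  shows "(scaled_diff us \<sigma> i j :: 'k::field mpoly vec) \<in> submod_span n (length us) (trel us ` S)"
  using ij
proof (induction rule: rtrancl_induct)
  case base
  show ?case by (simp add: scaled_diff_refl submod_span.zero)
next
  case (step k l)
  let ?A = "trel us ` S :: 'k mpoly vec set"
  have A: "?A \<subseteq> carrier_vec (length us)" by auto
  have tr: "scaled_diff us \<sigma> a b \<in> submod_span n (length us) ?A" if "(a, b) \<in> S" for a b
  proof -
    have "a \<noteq> b" using S(1) that by (auto simp: edge_pairs_def)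
    then have "trel us (a, b) = (scaled_diff us \<sigma> a b :: 'k mpoly vec)"
      using S(2)[OF that] by (simp add: trel_eq_scaled_diff)
    then show ?thesis using that A submod_span_base[of "trel us (a, b)" ?A] by (metis imageI)
  qed
  have "scaled_diff us \<sigma> k l \<in> submod_span n (length us) ?A"
    using step(2) tr[of k l] tr[of l k] submod_span_uminus[OF A, of "scaled_diff us \<sigma> l k"]
      scaled_diff_swap[of us \<sigma> k l, where 'a = 'k]
    by (auto simp: symc_def)
  from submod_span_add[OF A step(3) this] show ?case by (simp add: scaled_diff_add)
qed

lemma rtrancl_symc_remove:
  assumes "(i, j) \<in> (symc (insert (a, b) R))\<^sup>*" "(i, j) \<notin> (symc R)\<^sup>*"
  shows "(i, a) \<in> (symc R)\<^sup>* \<and> (b, j) \<in> (symc R)\<^sup>* \<or> (i, b) \<in> (symc R)\<^sup>* \<and> (a, j) \<in> (symc R)\<^sup>*"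
proof -
  have "symc (insert (a, b) R) = insert (a, b) (insert (b, a) (symc R))" by (auto simp: symc_def)
  then have "(i, j) \<in> (insert (a, b) (insert (b, a) (symc R)))\<^sup>*" using assms(1) by simp
  then show ?thesis using assms(2) unfolding rtrancl_insert
    by (auto dest: rtrancl_trans)
qed

text \<open>
  An edge \<open>(a, b)\<close> of an inclusion-minimal connecting set \<open>insert (a, b) S'\<close>: every path from \<open>i\<close> to \<open>j\<close> in it uses
  this edge, so the rest of the path connects its ends to \<open>i\<close> and \<open>j\<close>. This replaces explicit paths.
\<close>

lemma minimal_connecting_edge:
  assumes "finite S" "(i, j) \<in> (symc S)\<^sup>*" "i \<noteq> j"
  obtains a b S' where "(a, b) \<in> S" "S' \<subseteq> S - {(a, b)}"
    "(i, a) \<in> (symc S')\<^sup>* \<and> (b, j) \<in> (symc S')\<^sup>* \<or> (i, b) \<in> (symc S')\<^sup>* \<and> (a, j) \<in> (symc S')\<^sup>*"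
proof -
  let ?\<A> = "{S'. S' \<subseteq> S \<and> (i, j) \<in> (symc S')\<^sup>*}"
  have "finite ?\<A>" using assms(1) by simp
  moreover have "S \<in> ?\<A>" using assms(2) by simp
  ultimately have "\<exists>M\<in>?\<A>. \<forall>S'\<in>?\<A>. S' \<subseteq> M \<longrightarrow> M = S'" by (intro finite_has_minimal) auto
  then obtain M where M: "M \<in> ?\<A>" and "\<forall>S'\<in>?\<A>. S' \<subseteq> M \<longrightarrow> M = S'" by (elim bexE)
  then have min: "M = S'" if "S' \<in> ?\<A>" "S' \<subseteq> M" for S' using that by simp
  have "M \<noteq> {}" using M assms(3) by (auto simp: symc_def)
  then obtain a b where ab: "(a, b) \<in> M" by auto
  define S' where "S' = M - {(a, b)}"
  have "S' \<notin> ?\<A>" using min[of S'] ab by (auto simp: S'_def)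
  then have "(i, j) \<notin> (symc S')\<^sup>*" using M by (auto simp: S'_def)
  moreover have "(i, j) \<in> (symc (insert (a, b) S'))\<^sup>*" using M ab by (simp add: S'_def insert_absorb)
  ultimately have "(i, a) \<in> (symc S')\<^sup>* \<and> (b, j) \<in> (symc S')\<^sup>* \<or> (i, b) \<in> (symc S')\<^sup>* \<and> (a, j) \<in> (symc S')\<^sup>*"
    by (intro rtrancl_symc_remove)
  then show ?thesis using that[of a b S'] ab M by (auto simp: S'_def)
qed

text \<open>
  A fixed relation tree \<open>T\<close> of an ideal generated in degree \<open>d\<close> with linear syzygies.
\<close>

locale linear_hb =
  fixes K :: "'k::field itself" and n d us T
  assumes us: "\<And>u. u \<in> set us \<Longrightarrow> keys u \<subseteq> {..<n}" and dist: "distinct us"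
    and deg: "\<forall>u\<in>set us. expo_deg u = d"
    and lin: "syzygies n us \<subseteq> submod_span n (length us) (linear_syzygies n us :: 'k mpoly vec set)"
    and hb: "hb_edges TYPE('k) n us T"
begin

abbreviation "clr \<equiv> colour_class us T"

lemma T_sub: "T \<subseteq> edge_pairs (length us)"
  and T_card: "card T = length us - 1"
  and T_span: "submod_span n (length us) (trel us ` T) = (syzygies n us :: 'k mpoly vec set)"
  using hb by (auto simp: hb_edges_def)

lemma finT: "finite T" by (rule finite_subset[OF T_sub finite_edge_pairs])

lemma clr_sub: "clr \<sigma> \<subseteq> T" by (auto simp: colour_class_def)

lemma T_deg: "e \<in> T \<Longrightarrow> expo_deg (elcm us e) = Suc d"
  by (rule hb_edges_linear[OF us dist deg lin hb])

lemma connected_range: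
  "(i, j) \<in> (symc S)\<^sup>* \<Longrightarrow> S \<subseteq> T \<Longrightarrow> i \<noteq> j \<Longrightarrow> i < length us \<and> j < length us"
proof -
  assume "(i, j) \<in> (symc S)\<^sup>*" "S \<subseteq> T" "i \<noteq> j"
  moreover have "symc S \<subseteq> {..<length us} \<times> {..<length us}" if "S \<subseteq> T"
    using that T_sub by (auto simp: symc_def edge_pairs_def)
  ultimately show ?thesis by (metis (no_types, lifting) converse_rtranclE rtranclE lessThan_iff mem_Sigma_iff subsetD)
qed

text \<open>
  Both \<open>u\<^sub>i\<close> and \<open>u\<^sub>j\<close> divide the common colour \<open>\<sigma>\<close>, which has the smallest possible degree \<open>d + 1\<close> of a common
  multiple of distinct generators.
\<close>

lemma colour_of_connected:
  assumes ij: "(i, j) \<in> (symc (clr \<sigma>))\<^sup>*" "i \<noteq> j"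
  shows "elcm us (i, j) = \<sigma>"
proof -
  have le: "expo_le (us ! a) \<sigma> \<and> expo_deg \<sigma> = Suc d" if "(a, b) \<in> (symc (clr \<sigma>))\<^sup>*" "a \<noteq> b" for a b
    using that(1)
  proof (cases rule: converse_rtranclE)
    case (step c)
    then obtain e where "e \<in> T" "elcm us e = \<sigma>" "fst e = a \<or> snd e = a" by (auto simp: symc_def colour_class_def)
    then show ?thesis using T_deg by auto
  qed (use that in simp)
  have "(j, i) \<in> (symc (clr \<sigma>))\<^sup>*" using ij(1) by (rule sym_symc_rtrancl)
  then have "expo_le (elcm us (i, j)) \<sigma>" "expo_deg \<sigma> = Suc d"
    using le[OF ij] le[of j i] ij(2) by (auto intro: expo_lcm_least)
  moreover have "Suc d \<le> expo_deg (elcm us (i, j))"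
    using connected_range[OF ij(1) clr_sub ij(2)] ij(2) by (intro expo_lcm_degree_ge[OF dist deg]) auto
  ultimately show ?thesis by (intro expo_le_deg_eq) auto
qed

text \<open>
  \<open>trel_in_span_connected\<close> gives a path in \<open>T\<close> whose colours divide \<open>lcm(u\<^sub>i, u\<^sub>j)\<close>; all these monomials have
  degree \<open>d + 1\<close>, so the colours are equal to it.
\<close>

lemma hb_edge_connected:
  assumes "hb_edges TYPE('k) n us T'" "(i, j) \<in> T'"
  shows "(i, j) \<in> (symc (clr (elcm us (i, j))))\<^sup>*"
proof -
  have ij: "i \<noteq> j" "i < length us" "j < length us" using assms by (auto simp: hb_edges_def edge_pairs_def)
  have "(trel us (i, j) :: 'k mpoly vec) \<in> submod_span n (length us) (trel us ` T)"
    unfolding T_span by (rule trel_in_syzygies[OF us ij])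
  from trel_in_span_connected[OF T_sub ij this] show ?thesis
  proof (rule symc_rtrancl_mono)
    have "expo_deg (elcm us (i, j)) = Suc d" by (rule hb_edges_linear[OF us dist deg lin assms])
    then show "{e \<in> T. expo_le (elcm us e) (elcm us (i, j))} \<subseteq> clr (elcm us (i, j))"
      using T_deg expo_le_deg_eq by (fastforce simp: colour_class_def)
  qed
qed

text \<open>
  By telescoping along the monochromatic path, the relation of an edge \<open>(a, b)\<close> on this path is a
  combination of the relation of \<open>(i, j)\<close> and those of the other edges; so \<open>(i, j)\<close> can replace \<open>(a, b)\<close>.
\<close>

lemma exchange:
  assumes ij: "(i, j) \<in> (symc (clr \<sigma>))\<^sup>*" "i < j"
  shows "\<exists>T'. hb_edges TYPE('k) n us T' \<and> (i, j) \<in> T'"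
proof (cases "(i, j) \<in> T")
  case False
  have ne: "i \<noteq> j" using ij by simp
  have \<sigma>: "elcm us (i, j) = \<sigma>" by (rule colour_of_connected[OF ij(1) ne])
  have finS: "finite (clr \<sigma>)" using finT clr_sub finite_subset by blast
  obtain a b S' where ab: "(a, b) \<in> clr \<sigma>" "S' \<subseteq> clr \<sigma> - {(a, b)}"
    "(i, a) \<in> (symc S')\<^sup>* \<and> (b, j) \<in> (symc S')\<^sup>* \<or> (i, b) \<in> (symc S')\<^sup>* \<and> (a, j) \<in> (symc S')\<^sup>*"
    using minimal_connecting_edge[OF finS ij(1) ne] by blast
  define T' where "T' = insert (i, j) (T - {(a, b)})"
  let ?A = "trel us ` T' :: 'k mpoly vec set" let ?N = "length us"
  have A: "?A \<subseteq> carrier_vec ?N" by auto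
  have abT: "(a, b) \<in> T" and \<sigma>ab: "elcm us (a, b) = \<sigma>" using ab(1) by (auto simp: colour_class_def)
  have abne: "a \<noteq> b" using abT T_sub by (auto simp: edge_pairs_def)
  have ijN: "(i, j) \<in> edge_pairs ?N" using connected_range[OF ij(1) clr_sub ne] ij by (auto simp: edge_pairs_def)
  have sub: "T' \<subseteq> edge_pairs ?N" using T_sub ijN by (auto simp: T'_def)
  have S'T': "S' \<subseteq> T'" using ab(2) clr_sub by (auto simp: T'_def)
  have sd: "scaled_diff us \<sigma> x y \<in> submod_span n ?N ?A" if "(x, y) \<in> (symc S')\<^sup>*" for x y
  proof -
    have "scaled_diff us \<sigma> x y \<in> submod_span n ?N (trel us ` S')"
      using that ab(2) T_sub by (intro scaled_diff_in_span) (auto simp: colour_class_def)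
    then show ?thesis using submod_span_mono[of "trel us ` S'" ?A] S'T' A by blast
  qed
  have "trel us (i, j) \<in> submod_span n ?N ?A" using A by (intro submod_span_base) (auto simp: T'_def)
  then have sij: "scaled_diff us \<sigma> i j \<in> submod_span n ?N ?A"
    using trel_eq_scaled_diff[OF ne, of us, where 'a = 'k] \<sigma> by simp
  have "scaled_diff us \<sigma> a b \<in> submod_span n ?N ?A"
    using ab(3)
  proof
    assume c: "(i, a) \<in> (symc S')\<^sup>* \<and> (b, j) \<in> (symc S')\<^sup>*"
    then have "(a, i) \<in> (symc S')\<^sup>*" "(j, b) \<in> (symc S')\<^sup>*" using sym_symc_rtrancl by metis+
    then have "(scaled_diff us \<sigma> a i + scaled_diff us \<sigma> i j) + scaled_diff us \<sigma> j b \<in> submod_span n ?N ?A"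
      using submod_span_add[OF A submod_span_add[OF A sd sij] sd] by blast
    then show ?thesis by (simp add: scaled_diff_add)
  next
    assume c: "(i, b) \<in> (symc S')\<^sup>* \<and> (a, j) \<in> (symc S')\<^sup>*"
    then have "(b, i) \<in> (symc S')\<^sup>*" "(j, a) \<in> (symc S')\<^sup>*" using sym_symc_rtrancl by metis+
    then have "(scaled_diff us \<sigma> b i + scaled_diff us \<sigma> i j) + scaled_diff us \<sigma> j a \<in> submod_span n ?N ?A"
      using submod_span_add[OF A submod_span_add[OF A sd sij] sd] by blast
    then have "- scaled_diff us \<sigma> b a \<in> submod_span n ?N ?A"
      by (intro submod_span_uminus A) (simp add: scaled_diff_add)
    then show ?thesis by (simp add: scaled_diff_swap[of us \<sigma> a b])
  qed
  then have tab: "trel us (a, b) \<in> submod_span n ?N ?A"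
    using trel_eq_scaled_diff[OF abne, of us, where 'a = 'k] \<sigma>ab by simp
  have "trel us ` T \<subseteq> submod_span n ?N ?A"
  proof (intro image_subsetI)
    fix e assume "e \<in> T"
    then show "trel us e \<in> submod_span n ?N ?A"
      using tab A by (cases "e = (a, b)") (auto simp: T'_def intro: submod_span_base)
  qed
  then have "submod_span n ?N (trel us ` T) \<subseteq> submod_span n ?N ?A" by (rule submod_span_minimal[OF A])
  moreover have "?A \<subseteq> submod_span n ?N (trel us ` T)"
    unfolding T_span
  proof (intro image_subsetI)
    fix e assume "e \<in> T'"
    then have "e \<in> edge_pairs ?N" using sub by blast
    then show "trel us e \<in> (syzygies n us :: 'k mpoly vec set)"
      using trel_in_syzygies[OF us, where i = "fst e" and j = "snd e"] by (auto simp: edge_pairs_def)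
  qed
  then have "submod_span n ?N ?A \<subseteq> submod_span n ?N (trel us ` T)" by (rule submod_span_minimal[rotated]) auto
  ultimately have "submod_span n ?N ?A = syzygies n us" using T_span by auto
  moreover have "card T' = ?N - 1"
  proof -
    have "card T' = Suc (card (T - {(a, b)}))" using False finT by (simp add: T'_def)
    also have "\<dots> = card T" by (rule card.remove[OF finT abT, symmetric])
    finally show ?thesis using T_card by simp
  qed
  ultimately have "hb_edges TYPE('k) n us T'" using sub by (simp add: hb_edges_def)
  then show ?thesis by (intro exI[of _ T']) (simp add: T'_def)
qed (use hb in blast)

text \<open>
  The two directions are \<open>hb_edge_connected\<close> and \<open>exchange\<close>.
\<close>

lemma taylor_graph_arcs:
  "(i, j) \<in> parcs (taylor_graph TYPE('k) n us) \<longleftrightarrow> i \<noteq> j \<and> (\<exists>\<sigma>. (i, j) \<in> (symc (clr \<sigma>))\<^sup>*)"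
proof -
  have "(i, j) \<in> parcs (taylor_graph TYPE('k) n us) \<longleftrightarrow>
      (\<exists>T'. hb_edges TYPE('k) n us T' \<and> ((i, j) \<in> T' \<or> (j, i) \<in> T'))"
    by (auto simp: parcs_taylor_graph[OF us] symc_def)
  also have "\<dots> \<longleftrightarrow> i \<noteq> j \<and> (\<exists>\<sigma>. (i, j) \<in> (symc (clr \<sigma>))\<^sup>*)"
  proof
    assume "\<exists>T'. hb_edges TYPE('k) n us T' \<and> ((i, j) \<in> T' \<or> (j, i) \<in> T')"
    then obtain T' where T': "hb_edges TYPE('k) n us T'" "(i, j) \<in> T' \<or> (j, i) \<in> T'" by blast
    then have "i \<noteq> j" by (auto simp: hb_edges_def edge_pairs_def)
    moreover have "\<exists>\<sigma>. (i, j) \<in> (symc (clr \<sigma>))\<^sup>*"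
      using T' hb_edge_connected[OF T'(1)] sym_symc_rtrancl by metis
    ultimately show "i \<noteq> j \<and> (\<exists>\<sigma>. (i, j) \<in> (symc (clr \<sigma>))\<^sup>*)" by blast
  next
    assume "i \<noteq> j \<and> (\<exists>\<sigma>. (i, j) \<in> (symc (clr \<sigma>))\<^sup>*)"
    then obtain \<sigma> where \<sigma>: "i \<noteq> j" "(i, j) \<in> (symc (clr \<sigma>))\<^sup>*" by blast
    then show "\<exists>T'. hb_edges TYPE('k) n us T' \<and> ((i, j) \<in> T' \<or> (j, i) \<in> T')"
      using exchange[OF \<sigma>(2)] exchange[OF sym_symc_rtrancl[OF \<sigma>(2)]]
      by (cases "i < j") (metis, metis linorder_neqE_nat)
  qed
  finally show ?thesis .
qed

text \<open>
  Without the edge there are fewer than \<open>length us - 1\<close> edges left, too few to connect all vertices.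
\<close>

lemma tree_edge_separates:
  assumes "(a, b) \<in> T"
  shows "(a, b) \<notin> (symc (T - {(a, b)}))\<^sup>*"
proof
  let ?R = "T - {(a, b)}"
  assume ab: "(a, b) \<in> (symc ?R)\<^sup>*"
  have "symc T \<subseteq> (symc ?R)\<^sup>*"
  proof
    fix e assume "e \<in> symc T"
    then show "e \<in> (symc ?R)\<^sup>*"
      using ab sym_symc_rtrancl[OF ab] by (cases e) (auto simp: symc_def)
  qed
  then have "(symc T)\<^sup>* \<subseteq> (symc ?R)\<^sup>*" using rtrancl_subset_rtrancl by blast
  then have "card {..<length us} \<le> Suc (card ?R)"
  proof (intro connected_card_edges)
    show "{..<length us} \<noteq> {}" using T_sub assms by (auto simp: edge_pairs_def)
    show "?R \<subseteq> {..<length us} \<times> {..<length us}" using T_sub by (auto simp: edge_pairs_def)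
    fix i j assume "i \<in> {..<length us}" "j \<in> {..<length us}"
    then have "(i, j) \<in> (symc T)\<^sup>*" using spanning_edges_connected[OF us T_sub T_span] by simp
    then show "(i, j) \<in> (symc ?R)\<^sup>*" using \<open>(symc T)\<^sup>* \<subseteq> (symc ?R)\<^sup>*\<close> by blast
  qed simp
  moreover have "card T = Suc (card ?R)" by (rule card.remove[OF finT assms])
  moreover have "length us \<noteq> 0" using assms T_sub by (auto simp: edge_pairs_def)
  ultimately show False using T_card by simp
qed

text \<open>
  The vertex sets of the monochromatic components of \<open>T\<close>, including singletons.
\<close>

definition blocks :: "nat set set" where
  "blocks = {C. \<exists>\<sigma> x. x < length us \<and> C = {y. y < length us \<and> (x, y) \<in> (symc (clr \<sigma>))\<^sup>*}}"

lemma blocks_arcs: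
  "(i, j) \<in> parcs (taylor_graph TYPE('k) n us) \<longleftrightarrow> i \<noteq> j \<and> (\<exists>C\<in>blocks. i \<in> C \<and> j \<in> C)"
proof
  assume "(i, j) \<in> parcs (taylor_graph TYPE('k) n us)"
  then obtain \<sigma> where \<sigma>: "i \<noteq> j" "(i, j) \<in> (symc (clr \<sigma>))\<^sup>*" by (auto simp: taylor_graph_arcs)
  then have "i < length us" "j < length us" using connected_range[OF \<sigma>(2) clr_sub \<sigma>(1)] by auto
  then show "i \<noteq> j \<and> (\<exists>C\<in>blocks. i \<in> C \<and> j \<in> C)"
    using \<sigma>(1) unfolding blocks_def
    by (intro conjI bexI[of _ "{y. y < length us \<and> (i, y) \<in> (symc (clr \<sigma>))\<^sup>*}"]) (use \<sigma>(2) in auto)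
next
  assume "i \<noteq> j \<and> (\<exists>C\<in>blocks. i \<in> C \<and> j \<in> C)"
  then obtain \<sigma> x where "i \<noteq> j" "(x, i) \<in> (symc (clr \<sigma>))\<^sup>*" "(x, j) \<in> (symc (clr \<sigma>))\<^sup>*"
    by (auto simp: blocks_def)
  then show "(i, j) \<in> parcs (taylor_graph TYPE('k) n us)"
    unfolding taylor_graph_arcs by (meson rtrancl_trans sym_symc_rtrancl)
qed

text \<open>
  Remove from \<open>T\<close> an edge \<open>(a, b)\<close> of the monochromatic path from \<open>x\<close> to \<open>y\<close>; \<open>f\<close> tells on which side of it a
  vertex lies. A monochromatic path between vertices on different sides must use \<open>(a, b)\<close>, so its colour is
  that of \<open>C\<close> and it lies in the component \<open>C\<close>.
\<close>

lemma blocks_separated: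
  assumes C: "C \<in> blocks" and xy: "x \<in> C" "y \<in> C" "x \<noteq> y"
  obtains f :: "nat \<Rightarrow> bool" where "f x \<noteq> f y"
    "\<And>k l. (k, l) \<in> parcs (taylor_graph TYPE('k) n us) \<Longrightarrow> f k \<noteq> f l \<Longrightarrow> k \<in> C \<and> l \<in> C"
proof -
  obtain \<sigma> z where z: "C = {y. y < length us \<and> (z, y) \<in> (symc (clr \<sigma>))\<^sup>*}"
    using C by (auto simp: blocks_def)
  then have con: "(x, y) \<in> (symc (clr \<sigma>))\<^sup>*" using xy by (auto intro: rtrancl_trans sym_symc_rtrancl)
  have finS: "finite (clr \<sigma>)" using finT clr_sub finite_subset by blast
  obtain a b S' where ab: "(a, b) \<in> clr \<sigma>" "S' \<subseteq> clr \<sigma> - {(a, b)}"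
    and path: "(x, a) \<in> (symc S')\<^sup>* \<and> (b, y) \<in> (symc S')\<^sup>* \<or> (x, b) \<in> (symc S')\<^sup>* \<and> (a, y) \<in> (symc S')\<^sup>*"
    using minimal_connecting_edge[OF finS con xy(3)] by blast
  have abT: "(a, b) \<in> T" using ab(1) clr_sub by blast
  define R where "R = (symc (T - {(a, b)}))\<^sup>*"
  have R: "(u, v) \<in> R" if "(u, v) \<in> (symc S')\<^sup>*" for u v
    unfolding R_def by (rule symc_rtrancl_mono[OF that]) (use ab(2) clr_sub in blast)
  have Rsym: "(u, v) \<in> R \<Longrightarrow> (v, u) \<in> R" for u v unfolding R_def by (rule sym_symc_rtrancl)
  have Rtrans: "(u, v) \<in> R \<Longrightarrow> (v, w) \<in> R \<Longrightarrow> (u, w) \<in> R" for u v w unfolding R_def by (rule rtrancl_trans)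
  have nab: "(a, b) \<notin> R" unfolding R_def by (rule tree_edge_separates[OF abT])
  define f where "f v \<longleftrightarrow> (a, v) \<in> R" for v
  have fxy: "f x \<noteq> f y" unfolding f_def using path R Rsym Rtrans nab by metis
  have sep: "k \<in> C" if kl: "(k, l) \<in> (symc (clr \<tau>))\<^sup>*" "f k \<noteq> f l" for k l \<tau>
  proof -
    have "k \<noteq> l" using kl(2) by auto
    have "(k, a) \<in> (symc (clr \<tau>))\<^sup>* \<and> (a, b) \<in> clr \<tau> \<or> (k, b) \<in> (symc (clr \<tau>))\<^sup>* \<and> (a, b) \<in> clr \<tau> \<or> f k = f l"
      using kl(1)
    proof (induction rule: rtrancl_induct)
      case (step u v)
      then obtain e where e: "e \<in> clr \<tau>" "e = (u, v) \<or> e = (v, u)" by (auto simp: symc_def)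
      show ?case
      proof (cases "e = (a, b)")
        case True
        then show ?thesis using e step(1) by auto
      next
        case False
        then have "e \<in> T - {(a, b)}" using e(1) clr_sub by blast
        then have "(u, v) \<in> symc (T - {(a, b)})" using e(2) by (auto simp: symc_def)
        then have "(u, v) \<in> R" unfolding R_def by blast
        then have "f u = f v" using Rsym Rtrans unfolding f_def by blast
        then show ?thesis using step by auto
      qed
    qed simp
    then have *: "(a, b) \<in> clr \<tau>" "(k, a) \<in> (symc (clr \<tau>))\<^sup>* \<or> (k, b) \<in> (symc (clr \<tau>))\<^sup>*" using kl(2) by auto
    then have "\<tau> = \<sigma>" using ab(1) by (auto simp: colour_class_def)
    have in_\<sigma>: "(u, v) \<in> (symc (clr \<sigma>))\<^sup>*" if "(u, v) \<in> (symc S')\<^sup>*" for u v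
      by (rule symc_rtrancl_mono[OF that]) (use ab(2) in blast)
    have edge: "(a, b) \<in> (symc (clr \<sigma>))\<^sup>*" using ab(1) by (auto simp: symc_def)
    have "(x, a) \<in> (symc (clr \<sigma>))\<^sup>*" "(x, b) \<in> (symc (clr \<sigma>))\<^sup>*"
      using path in_\<sigma> edge by (meson rtrancl_trans sym_symc_rtrancl)+
    then have "(x, k) \<in> (symc (clr \<sigma>))\<^sup>*" using * \<open>\<tau> = \<sigma>\<close> by (meson rtrancl_trans sym_symc_rtrancl)
    moreover have "(z, x) \<in> (symc (clr \<sigma>))\<^sup>*" using xy(1) z by simp
    moreover have "k < length us" using connected_range[OF kl(1) clr_sub] \<open>k \<noteq> l\<close> by simp
    ultimately show ?thesis unfolding z by (auto intro: rtrancl_trans)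
  qed
  show thesis
  proof (rule that[OF fxy])
    fix k l assume "(k, l) \<in> parcs (taylor_graph TYPE('k) n us)" and f: "f k \<noteq> f l"
    then obtain \<tau> where "(k, l) \<in> (symc (clr \<tau>))\<^sup>*" by (auto simp: taylor_graph_arcs)
    then show "k \<in> C \<and> l \<in> C" using sep[of k l \<tau>] sep[of l k \<tau>] sym_symc_rtrancl f by metis
  qed
qed

end

text \<open>
  A relation tree exists because the Taylor graph has an edge; \<open>blocks\<close> of this tree, pulled back along the
  labelling, are separated cliques covering all edges.
\<close>

lemma taylor_graph_block_graph:
  fixes G :: "'a pair_pre_digraph" and I :: "'k::field mpoly set"
  assumes wf: "pair_graph G" and nonempty: "parcs G \<noteq> {}" and lab: "inj_on lab (pverts G)"
    and gen: "minimal_monomial_generators n I us" and res: "linear_resolution n I"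
    and eq: "relabel lab G = taylor_graph TYPE('k) n us"
  shows "chordal G"
    and "\<And>C D. maximal_clique G C \<Longrightarrow> maximal_clique G D \<Longrightarrow> C \<noteq> D \<Longrightarrow> card (C \<inter> D) \<le> 1"
proof -
  interpret G: pair_graph G by fact
  have us: "\<And>u. u \<in> set us \<Longrightarrow> keys u \<subseteq> {..<n}" and dist: "distinct us"
    using gen by (auto simp: minimal_monomial_generators_def)
  obtain d where "generated_in_degree n d I" using res by (auto simp: linear_resolution_def)
  then have deg: "\<forall>u\<in>set us. expo_deg u = d" by (rule minimal_generators_same_degree[OF gen])
  have V: "pverts (taylor_graph TYPE('k) n us) = lab ` pverts G"
    and E: "parcs (taylor_graph TYPE('k) n us) = map_prod lab lab ` parcs G"
    using eq by (metis relabel_def pair_pre_digraph.select_convs(1), metis relabel_def pair_pre_digraph.select_convs(2))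
  have "parcs (taylor_graph TYPE('k) n us) \<noteq> {}" using E nonempty by simp
  moreover have "parcs (taylor_graph TYPE('k) n us) = (\<Union>T\<in>{T. hb_edges TYPE('k) n us T}. symc T)"
    by (rule parcs_taylor_graph) (rule us)
  ultimately obtain T where T: "hb_edges TYPE('k) n us T" by auto
  interpret linear_hb "TYPE('k)" n d us T
    by unfold_locales (use us dist deg T linear_resolution_syzygies[OF gen deg res] in auto)
  have arc: "(x, y) \<in> parcs G \<longleftrightarrow> (lab x, lab y) \<in> parcs (taylor_graph TYPE('k) n us)"
    if "x \<in> pverts G" "y \<in> pverts G" for x y
  proof
    assume "(lab x, lab y) \<in> parcs (taylor_graph TYPE('k) n us)"
    then obtain x' y' where "(x', y') \<in> parcs G" "lab x = lab x'" "lab y = lab y'" unfolding E by auto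
    then show "(x, y) \<in> parcs G"
      using that lab G.in_arcsD1 G.in_arcsD2 by (metis inj_onD)
  qed (auto simp: E)
  define Cs where "Cs = (\<lambda>C. {x \<in> pverts G. lab x \<in> C}) ` blocks"
  have arcs: "(x, y) \<in> parcs G \<longleftrightarrow> x \<noteq> y \<and> (\<exists>C\<in>Cs. x \<in> C \<and> y \<in> C)" for x y
  proof
    assume xy: "(x, y) \<in> parcs G"
    then have V: "x \<in> pverts G" "y \<in> pverts G" using G.in_arcsD1 G.in_arcsD2 by auto
    then have "lab x \<noteq> lab y \<and> (\<exists>C\<in>blocks. lab x \<in> C \<and> lab y \<in> C)"
      using xy arc blocks_arcs by simp
    then show "x \<noteq> y \<and> (\<exists>C\<in>Cs. x \<in> C \<and> y \<in> C)" using V by (auto simp: Cs_def)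
  next
    assume "x \<noteq> y \<and> (\<exists>C\<in>Cs. x \<in> C \<and> y \<in> C)"
    then have V: "x \<noteq> y" "x \<in> pverts G" "y \<in> pverts G" and "\<exists>C\<in>blocks. lab x \<in> C \<and> lab y \<in> C"
      by (auto simp: Cs_def)
    moreover have "lab x \<noteq> lab y" using V lab by (auto dest: inj_onD)
    ultimately show "(x, y) \<in> parcs G" using arc blocks_arcs by simp
  qed
  have sub: "C \<subseteq> pverts G" if "C \<in> Cs" for C using that by (auto simp: Cs_def)
  have sep: "\<exists>f :: 'a \<Rightarrow> bool. f x \<noteq> f y \<and> (\<forall>k l. (k, l) \<in> parcs G \<longrightarrow> f k \<noteq> f l \<longrightarrow> k \<in> C \<and> l \<in> C)"
    if C: "C \<in> Cs" "x \<in> C" "y \<in> C" "x \<noteq> y" for C x y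
  proof -
    obtain C' where C': "C' \<in> blocks" "C = {x \<in> pverts G. lab x \<in> C'}" using C(1) by (auto simp: Cs_def)
    have "lab x \<noteq> lab y" using C C' lab by (auto dest: inj_onD)
    then obtain f :: "nat \<Rightarrow> bool" where f: "f (lab x) \<noteq> f (lab y)"
      "\<And>k l. (k, l) \<in> parcs (taylor_graph TYPE('k) n us) \<Longrightarrow> f k \<noteq> f l \<Longrightarrow> k \<in> C' \<and> l \<in> C'"
      using blocks_separated[OF C'(1), of "lab x" "lab y"] C C' by auto
    show ?thesis
    proof (intro exI[of _ "f \<circ> lab"] conjI allI impI)
      fix k l assume kl: "(k, l) \<in> parcs G" "(f \<circ> lab) k \<noteq> (f \<circ> lab) l"
      then have "k \<in> pverts G" "l \<in> pverts G" using G.in_arcsD1 G.in_arcsD2 by auto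
      then show "k \<in> C" "l \<in> C" using f(2)[of "lab k" "lab l"] kl arc C'(2) by auto
    qed (use f in simp)
  qed
  show "chordal G" by (rule chordal_and_cliques_if_separated_classes(1)[OF arcs sub sep])
  show "card (C \<inter> D) \<le> 1" if "maximal_clique G C" "maximal_clique G D" "C \<noteq> D" for C D
    by (rule chordal_and_cliques_if_separated_classes(2)[OF arcs sub sep that])
qed

section \<open>The monomials of a rooted block structure\<close>

text \<open>
  The path from \<open>v\<close> to the root, without the root. The guard \<open>p v < v\<close> ensures termination for arbitrary \<open>p\<close>.
\<close>

fun anc :: "(nat \<Rightarrow> nat) \<Rightarrow> nat \<Rightarrow> nat set" where
  "anc p v = (if p v < v then insert v (anc p (p v)) else {})"

declare anc.simps [simp del]

lemma block_parentsD:
  assumes "block_parents m p s" "1 \<le> j" "j \<le> m"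
  shows "p j < j" "1 \<le> s j" "s j \<le> j" "s (s j) = s j" "p (s j) = p j"
  using assms by (auto simp: block_parents_def)

lemma block_parents_mono: "block_parents m p s \<Longrightarrow> m' \<le> m \<Longrightarrow> block_parents m' p s"
  by (auto simp: block_parents_def)

lemma anc_0 [simp]: "anc p 0 = {}"
  by (simp add: anc.simps)

lemma anc_rec: "p v < v \<Longrightarrow> anc p v = insert v (anc p (p v))"
  by (simp add: anc.simps)

lemma anc_le: "k \<in> anc p v \<Longrightarrow> k \<le> v \<and> p k < k"
proof (induction p v rule: anc.induct)
  case (1 p v)
  then show ?case by (cases "p v < v") (force simp: anc.simps[of p v])+
qed

lemma anc_notin: "v < k \<Longrightarrow> k \<notin> anc p v"
  using anc_le[of k p v] by auto

text \<open>
  Vertices with the same \<open>s\<close> lie in the same clique and hence have the same parent, so no two of them are on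
  a common path to the root. This makes the monomials below squarefree.
\<close>

lemma anc_inj_on:
  assumes bp: "block_parents m p s" and v: "v \<le> m"
  shows "inj_on s (anc p v)"
  using v
proof (induction v rule: less_induct)
  case (less v)
  show ?case
  proof (cases "v = 0")
    case False
    then have pv: "p v < v" using block_parentsD(1)[OF bp] less.prems by simp
    have "s v \<noteq> s k" if k: "k \<in> anc p (p v)" for k
    proof
      assume eq: "s v = s k"
      have kv: "k \<le> p v" "p k < k" using anc_le[OF k] by auto
      then have "p k = p v" using block_parentsD(5)[OF bp, of k] block_parentsD(5)[OF bp, of v] eq pv less.prems by simp
      then show False using kv by simp
    qed
    then show ?thesis using less.IH[OF pv] pv less.prems by (auto simp: anc_rec)
  qed simp
qed

lemma anc_inject:
  assumes bp: "block_parents m p s" and "v \<le> m" "w \<le> m" "anc p v = anc p w"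
  shows "v = w"
proof -
  have "a \<le> b" if "a \<le> m" "anc p a = anc p b" for a b
  proof (cases "a = 0")
    case False
    then have "a \<in> anc p a" using block_parentsD(1)[OF bp, of a] that(1) by (simp add: anc_rec)
    then show ?thesis using that(2) anc_le[of a p b] by simp
  qed simp
  from this[of v w] this[of w v] assms show ?thesis by simp
qed

text \<open>
  Variable number \<open>2 * k\<close> is \<open>y\<^sub>k\<close>, and number \<open>2 * k + 1\<close> is \<open>z\<^sub>k\<close>. The \<open>k\<close>-th factor of the generator \<open>u\<^sub>v\<close> is
  \<open>y\<^sub>k\<close>, unless \<open>k\<close> lies on the path from \<open>v\<close> to the root, where it becomes \<open>z\<^bsub>s k\<^esub>\<close>. The variables number
  \<open>0\<close> and \<open>1\<close> do not occur.
\<close>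

definition bvar :: "(nat \<Rightarrow> nat) \<Rightarrow> (nat \<Rightarrow> nat) \<Rightarrow> nat \<Rightarrow> nat \<Rightarrow> nat" where
  "bvar p s v k = (if k \<in> anc p v then 2 * s k + 1 else 2 * k)"

definition bmon :: "nat \<Rightarrow> (nat \<Rightarrow> nat) \<Rightarrow> (nat \<Rightarrow> nat) \<Rightarrow> nat \<Rightarrow> expo" where
  "bmon m p s v = (\<Sum>k\<in>{1..m}. single (bvar p s v k) 1)"

lemma bvar_range:
  assumes "block_parents m p s" "k \<in> {1..m}"
  shows "2 \<le> bvar p s v k" "bvar p s v k < 2 * m + 2"
  using block_parentsD[OF assms(1), of k] assms(2) by (auto simp: bvar_def)

lemma bvar_inj_on:
  assumes "block_parents m p s" "v \<le> m"
  shows "inj_on (bvar p s v) {1..m}"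
proof (rule inj_onI)
  fix k l assume kl: "bvar p s v k = bvar p s v l"
  show "k = l"
  proof (cases "k \<in> anc p v \<longleftrightarrow> l \<in> anc p v")
    case True
    then show ?thesis using kl inj_onD[OF anc_inj_on[OF assms], of k l] by (auto simp: bvar_def)
  next
    case False
    then show ?thesis using kl by (auto simp: bvar_def) presburger+
  qed
qed

lemma bvar_parent:
  assumes "p v < v" "k \<noteq> v"
  shows "bvar p s (p v) k = bvar p s v k"
  using assms by (simp add: bvar_def anc_rec)

lemma bvar_self: "p v < v \<Longrightarrow> bvar p s v v = 2 * s v + 1" "p v < v \<Longrightarrow> bvar p s (p v) v = 2 * v"
  using anc_notin[of "p v" v p] by (auto simp: bvar_def anc_rec)

lemma expo_deg_bmon: "expo_deg (bmon m p s v) = m"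
  by (simp add: bmon_def expo_deg_sum)

lemma keys_bmon: "block_parents m p s \<Longrightarrow> keys (bmon m p s v) \<subseteq> {..<2 * m + 2}"
  using keys_sum[of "\<lambda>k. single (bvar p s v k) (1::nat)" "{1..m}"] bvar_range[of m p s _ v]
  unfolding bmon_def by fastforce

text \<open>
  Passing from \<open>p v\<close> to \<open>v\<close> changes only the \<open>v\<close>-th factor, from \<open>y\<^sub>v\<close> to \<open>z\<^bsub>s v\<^esub>\<close>.
\<close>

lemma bmon_parent:
  assumes bp: "block_parents m p s" and v: "v \<in> {1..m}"
  shows "bmon m p s v + single (2 * v) 1 = bmon m p s (p v) + single (2 * s v + 1) 1"
proof -
  have pv: "p v < v" using block_parentsD(1)[OF bp] v by simp
  have split: "bmon m p s w = single (bvar p s w v) 1 + (\<Sum>k\<in>{1..m} - {v}. single (bvar p s w k) 1)" for w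
    unfolding bmon_def using v by (intro sum.remove) auto
  have "(\<Sum>k\<in>{1..m} - {v}. single (bvar p s (p v) k) (1::nat)) = (\<Sum>k\<in>{1..m} - {v}. single (bvar p s v k) 1)"
    using bvar_parent[of p v _ s, OF pv] by (intro sum.cong) auto
  then show ?thesis
    using split[of v] split[of "p v"] bvar_self[of p v s] pv by (simp add: add_ac)
qed

lemma lookup_bmon:
  assumes "block_parents m p s" "v \<le> m"
  shows "lookup (bmon m p s v) x = (if x \<in> bvar p s v ` {1..m} then 1 else 0)"
proof -
  have "lookup (bmon m p s v) x = (\<Sum>k\<in>{1..m}. if bvar p s v k = x then 1 else 0)"
    by (auto simp: bmon_def lookup_sum lookup_single when_def intro!: sum.cong)
  also have "\<dots> = (\<Sum>y\<in>bvar p s v ` {1..m}. if y = x then 1 else 0)"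
    unfolding sum.reindex[OF bvar_inj_on[OF assms]] comp_def ..
  also have "\<dots> = (if x \<in> bvar p s v ` {1..m} then 1 else 0)"
    by (rule sum.delta) simp
  finally show ?thesis .
qed

lemma lookup_bmon_even:
  assumes "block_parents m p s" "v \<le> m"
  shows "lookup (bmon m p s v) (2 * k) = (if k \<in> {1..m} - anc p v then 1 else 0)"
proof -
  have "2 * k = bvar p s v j \<longleftrightarrow> k = j \<and> j \<notin> anc p v" for j
    by (auto simp: bvar_def) presburger
  then show ?thesis by (auto simp: lookup_bmon[OF assms] image_iff)
qed

text \<open>
  The \<open>y\<close>-part of \<open>u\<^sub>v\<close> records the path from \<open>v\<close> to the root, whose largest element is \<open>v\<close>.
\<close>

lemma anc_eq_if_bmon_even:
  assumes bp: "block_parents m p s" and vw: "v \<le> m" "w \<le> m"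
    and eq: "\<And>k. lookup (bmon m p s v) (2 * k) = lookup (bmon m p s w) (2 * k)"
  shows "v = w"
proof (rule anc_inject[OF bp vw])
  have sub: "anc p u \<subseteq> {1..m}" if "u \<le> m" for u using anc_le[of _ p u] that by fastforce
  have "k \<in> anc p v \<longleftrightarrow> k \<in> anc p w" if "k \<in> {1..m}" for k
    using eq[of k, unfolded lookup_bmon_even[OF bp vw(1)] lookup_bmon_even[OF bp vw(2)]] that
    by (cases "k \<in> anc p v"; cases "k \<in> anc p w") simp_all
  then show "anc p v = anc p w" using sub vw by blast
qed

lemma expo_le_bmonI:
  assumes "block_parents m p s" "v \<le> m" "\<And>k. k \<in> {1..m} \<Longrightarrow> lookup t (bvar p s v k) \<noteq> 0"
  shows "expo_le (bmon m p s v) t"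
  using assms(3) by (auto simp: expo_le_def lookup_bmon[OF assms(1,2)] Suc_le_eq)

definition bmons :: "nat \<Rightarrow> (nat \<Rightarrow> nat) \<Rightarrow> (nat \<Rightarrow> nat) \<Rightarrow> expo list" where
  "bmons m p s = map (bmon m p s) [0..<Suc m]"

lemma length_bmons [simp]: "length (bmons m p s) = Suc m"
  by (simp add: bmons_def)

lemma nth_bmons [simp]: "v \<le> m \<Longrightarrow> bmons m p s ! v = bmon m p s v"
  by (simp add: bmons_def nth_map_upt[of _ 0] del: upt_Suc)

lemma set_bmons: "set (bmons m p s) = bmon m p s ` {..m}"
  by (auto simp: bmons_def less_Suc_eq_le simp del: upt_Suc)

lemma distinct_bmons: "block_parents m p s \<Longrightarrow> distinct (bmons m p s)"
  unfolding bmons_def distinct_map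
  by (auto simp: inj_on_def less_Suc_eq_le simp del: upt_Suc intro: anc_eq_if_bmon_even)

lemma mon_ev_bmon: "mon_ev \<sigma> (bmon m p s v) = (\<Prod>k\<in>{1..m}. \<sigma> (bvar p s v k))"
  by (simp add: bmon_def mon_ev_sum)

section \<open>Syzygies of products of pairwise non-associated primes\<close>

lemma prime_elem_dvd_prodD:
  assumes "prime_elem y" "finite A" "y dvd prod f A"
  shows "\<exists>k\<in>A. y dvd f k"
  using assms(2,3)
proof (induction A rule: finite_induct)
  case empty
  then show ?case using assms(1) by (simp add: prime_elem_def)
next
  case (insert k A)
  then show ?case using prime_elem_dvd_mult_iff[OF assms(1)] by auto
qed

text \<open>
  The generators are evaluated at arbitrary pairwise non-dividing primes \<open>e\<close> instead of the variables, since
  the same argument is applied to substituted generators. The prime \<open>y\<close> belonging to the last vertex divides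
  all generators but the last one, so it divides the last coefficient of a syzygy. Subtracting a multiple of
  the relation between the last vertex and its parent leaves a syzygy of the smaller structure, times \<open>y\<close>.
\<close>

lemma block_syzygies:
  fixes e :: "nat \<Rightarrow> 'a::idom"
  assumes "block_parents m p s"
    and "\<And>i. 2 \<le> i \<Longrightarrow> i < 2 * m + 2 \<Longrightarrow> prime_elem (e i)"
    and "\<And>i j. 2 \<le> i \<Longrightarrow> i < 2 * m + 2 \<Longrightarrow> 2 \<le> j \<Longrightarrow> j < 2 * m + 2 \<Longrightarrow> i \<noteq> j \<Longrightarrow> \<not> e i dvd e j"
    and "(\<Sum>v\<le>m. c v * (\<Prod>k\<in>{1..m}. e (bvar p s v k))) = 0"
  shows "\<exists>d. \<forall>v\<le>m. c v = (\<Sum>j\<in>{1..m}. d j * ((if v = j then e (2 * j) else 0) - (if v = p j then e (2 * s j + 1) else 0)))"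
  using assms
proof (induction m arbitrary: c)
  case 0
  then show ?case by simp
next
  case (Suc m)
  let ?M = "Suc m" and ?P = "\<lambda>v. \<Prod>k\<in>{1..m}. e (bvar p s v k)"
  let ?y = "e (2 * ?M)" and ?z = "e (2 * s ?M + 1)"
  note bp = Suc.prems(1)
  have bpm: "block_parents m p s" using bp by (rule block_parents_mono) simp
  have pM: "p ?M < ?M" and sM: "1 \<le> s ?M" "s ?M \<le> ?M" using block_parentsD[OF bp, of ?M] by auto
  have set: "{1..?M} = insert ?M {1..m}" by auto
  have prod_low: "(\<Prod>k\<in>{1..?M}. e (bvar p s v k)) = ?y * ?P v" if "v \<le> m" for v
    using that anc_notin[of v ?M p] by (simp add: set bvar_def)
  have prod_top: "(\<Prod>k\<in>{1..?M}. e (bvar p s ?M k)) = ?z * ?P (p ?M)"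
  proof -
    have "?P (p ?M) = ?P ?M" by (intro prod.cong refl) (use bvar_parent[of p ?M, OF pM] in auto)
    then show ?thesis by (simp add: set bvar_self(1)[of p ?M, OF pM])
  qed
  have "(\<Sum>v\<le>m. c v * (\<Prod>k\<in>{1..?M}. e (bvar p s v k))) = ?y * (\<Sum>v\<le>m. c v * ?P v)"
    unfolding sum_distrib_left by (intro sum.cong refl) (simp only: prod_low atMost_iff mult.left_commute)
  then have sum0: "?y * (\<Sum>v\<le>m. c v * ?P v) + c ?M * (?z * ?P (p ?M)) = 0"
    using Suc.prems(4) by (simp only: sum.atMost_Suc prod_top)
  then have "c ?M * (?z * ?P (p ?M)) = - (?y * (\<Sum>v\<le>m. c v * ?P v))"
    by (rule minus_unique[symmetric])
  then have "c ?M * (?z * ?P (p ?M)) = ?y * - (\<Sum>v\<le>m. c v * ?P v)"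
    by (simp only: mult_minus_right)
  then have "?y dvd c ?M * (?z * ?P (p ?M))" by (rule dvdI)
  moreover have py: "prime_elem ?y" using Suc.prems(2)[of "2 * ?M"] by simp
  moreover have "\<not> ?y dvd ?z"
  proof -
    have "2 * ?M \<noteq> 2 * s ?M + 1" by presburger
    then show ?thesis using Suc.prems(3)[of "2 * ?M" "2 * s ?M + 1"] sM by simp
  qed
  moreover have "\<not> ?y dvd ?P (p ?M)"
  proof
    assume "?y dvd ?P (p ?M)"
    then obtain k where k: "k \<in> {1..m}" "?y dvd e (bvar p s (p ?M) k)"
      using prime_elem_dvd_prodD[OF py finite_atLeastAtMost] by blast
    have "bvar p s (p ?M) k < 2 * ?M" using bvar_range[OF bpm k(1)] by simp
    moreover have "2 \<le> bvar p s (p ?M) k" using bvar_range[OF bpm k(1)] by simp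
    ultimately show False using Suc.prems(3)[of "2 * ?M" "bvar p s (p ?M) k"] k(2) by simp
  qed
  ultimately have "?y dvd c ?M" using prime_elem_dvd_mult_iff by blast
  then obtain d where d: "c ?M = ?y * d" by (elim dvdE)
  \<comment> \<open>The coefficients after subtracting d times the relation of the last vertex.\<close>
  define c' where "c' v = c v + (if v = p ?M then d * ?z else 0)" for v
  have "?y * (\<Sum>v\<le>m. c' v * ?P v) = ?y * (\<Sum>v\<le>m. c v * ?P v) + ?y * (d * ?z * ?P (p ?M))"
  proof -
    have "(\<Sum>v\<le>m. c' v * ?P v) = (\<Sum>v\<le>m. c v * ?P v + (if v = p ?M then d * ?z * ?P v else 0))"
      by (intro sum.cong) (auto simp: c'_def distrib_right)
    also have "\<dots> = (\<Sum>v\<le>m. c v * ?P v) + d * ?z * ?P (p ?M)"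
      using pM by (simp add: sum.distrib)
    finally show ?thesis by (simp add: distrib_left)
  qed
  also have "?y * (d * ?z * ?P (p ?M)) = c ?M * (?z * ?P (p ?M))" by (simp only: d mult.assoc)
  also note sum0
  finally have "(\<Sum>v\<le>m. c' v * ?P v) = 0" using py by (auto simp: prime_elem_def)
  then obtain d' where d': "\<And>v. v \<le> m \<Longrightarrow> c' v =
      (\<Sum>j\<in>{1..m}. d' j * ((if v = j then e (2 * j) else 0) - (if v = p j then e (2 * s j + 1) else 0)))"
    using Suc.IH[OF bpm, of c'] Suc.prems(2,3) by auto
  define D where "D = d'(?M := d)"
  have "c v = (\<Sum>j\<in>{1..?M}. D j * ((if v = j then e (2 * j) else 0) - (if v = p j then e (2 * s j + 1) else 0)))"
    if v: "v \<le> ?M" for v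
  proof -
    have "(\<Sum>j\<in>{1..?M}. D j * ((if v = j then e (2 * j) else 0) - (if v = p j then e (2 * s j + 1) else 0)))
      = d * ((if v = ?M then ?y else 0) - (if v = p ?M then ?z else 0)) +
        (\<Sum>j\<in>{1..m}. d' j * ((if v = j then e (2 * j) else 0) - (if v = p j then e (2 * s j + 1) else 0)))"
      by (simp add: set D_def)
    also have "\<dots> = c v"
    proof (cases "v = ?M")
      case True
      have "(\<Sum>j\<in>{1..m}. d' j * ((if v = j then e (2 * j) else 0) - (if v = p j then e (2 * s j + 1) else 0))) = 0"
        using True block_parentsD(1)[OF bpm] by (intro sum.neutral) fastforce
      then show ?thesis using True d pM by (simp add: mult.commute)
    next
      case False
      then have "v \<le> m" using v by simp
      then show ?thesis using d'[of v] False by (auto simp: c'_def algebra_simps)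
    qed
    finally show ?thesis by simp
  qed
  then show ?case by blast
qed

section \<open>Congruences and prime elements through substitutions\<close>

text \<open>
  Replacing variables by congruent elements yields a congruent polynomial.
\<close>

lemma subst_diff_in_ispan:
  fixes p :: "'k::field mpoly"
  assumes *: "\<And>i. \<sigma> i - \<tau> i \<in> ispan B"
  shows "subst \<sigma> p - subst \<tau> p \<in> ispan B"
proof -
  have mult: "x * x' - y * y' \<in> ispan B" if "x - y \<in> ispan B" "x' - y' \<in> ispan B" for x x' y y' :: "'k mpoly"
  proof -
    have "x * x' - y * y' = x' * (x - y) + y * (x' - y')" by (simp add: algebra_simps)
    then show ?thesis using that by (simp add: mult_module.span_add mult_module.span_scale)
  qed
  have pow: "\<sigma> i ^ e - \<tau> i ^ e \<in> ispan B" for i e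
    by (induction e) (auto intro: mult * mult_module.span_zero)
  have ev: "mon_ev \<sigma> t - mon_ev \<tau> t \<in> ispan B" for t
  proof -
    have "(\<Prod>i\<in>A. \<sigma> i ^ lookup t i) - (\<Prod>i\<in>A. \<tau> i ^ lookup t i) \<in> ispan B" if "finite A" for A
      using that by (induction A rule: finite_induct) (auto intro: mult pow mult_module.span_zero)
    then show ?thesis by (simp add: mon_ev_def)
  qed
  have "subst \<sigma> p - subst \<tau> p = (\<Sum>t\<in>keys p. Cst (lookup p t) * (mon_ev \<sigma> t - mon_ev \<tau> t))"
    by (simp add: subst_def sum_subtractf right_diff_distrib)
  then show ?thesis using ev by (auto intro!: mult_module.span_sum mult_module.span_scale)
qed

lemma diff_subst_dvd:
  assumes "e = (poly_var i :: 'k::field mpoly) - g"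
  shows "e dvd a - subst (poly_var(i := g)) a"
proof -
  have "subst poly_var a - subst (poly_var(i := g)) a \<in> ispan {e}"
    by (rule subst_diff_in_ispan) (auto simp: assms intro: mult_module.span_base mult_module.span_zero)
  then show ?thesis by (auto simp: mult_module.span_singleton)
qed

text \<open>
  The multiples of \<open>x\<^sub>i - g\<close> are the kernel of the substitution \<open>x\<^sub>i \<mapsto> g\<close>, which is a ring homomorphism into
  a domain.
\<close>

lemma prime_elem_by_subst:
  fixes e :: "'k::field mpoly"
  assumes e: "e = poly_var i - g" "subst (poly_var(i := g)) e = 0" "e \<noteq> 0"
  shows "prime_elem e" "e dvd a \<longleftrightarrow> subst (poly_var(i := g)) a = 0"
proof -
  have iff: "e dvd a \<longleftrightarrow> subst (poly_var(i := g)) a = 0" for a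
  proof
    assume "e dvd a"
    then show "subst (poly_var(i := g)) a = 0" using e(2) by (auto simp: subst_mult elim!: dvdE)
  next
    assume "subst (poly_var(i := g)) a = 0"
    then show "e dvd a" using diff_subst_dvd[OF e(1), of a] by simp
  qed
  show "e dvd a \<longleftrightarrow> subst (poly_var(i := g)) a = 0" by (rule iff)
  show "prime_elem e"
    unfolding prime_elem_def using e(3) by (auto simp: iff subst_mult)
qed

text \<open>
  Pairwise non-associated primes in the two variables that do not occur in the generators.
\<close>

definition param :: "nat \<Rightarrow> 'k::field mpoly" where
  "param i = poly_var 0 + poly_var 1 ^ i"

text \<open>
  The specialization of the variables \<open>2, \<dots>, k - 1\<close>. For \<open>k = 2\<close> nothing is replaced.
\<close>

definition spec :: "nat \<Rightarrow> nat \<Rightarrow> 'k::field mpoly" where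
  "spec k i = (if 2 \<le> i \<and> i < k then param i else poly_var i)"

lemma poly_var_eq_iff [simp]: "poly_var i = (poly_var j :: 'k::field mpoly) \<longleftrightarrow> i = j"
proof -
  have "single i (1::nat) = single j 1 \<longleftrightarrow> i = j"
    by (metis keys_single singleton_inject zero_neq_one)
  then show ?thesis by (simp add: poly_var_def)
qed

lemma poly_var_neq_0 [simp]: "poly_var i \<noteq> (0 :: 'k::field mpoly)"
  by (simp add: poly_var_def)

lemma param_neq_0: "param i \<noteq> (0 :: 'k::field mpoly)"
proof
  assume "param i = (0 :: 'k mpoly)"
  then have "subst (poly_var(0 := 1, 1 := 0)) (param i) = (0 :: 'k mpoly)" by simp
  moreover have "subst (poly_var(0 := 1 + 1, 1 := 1)) (param i) = subst (poly_var(0 := 1, 1 := 1)) (param i) + (1 :: 'k mpoly)"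
    by (simp add: param_def subst_add subst_power)
  ultimately show False using \<open>param i = (0 :: 'k mpoly)\<close> by simp
qed

lemma poly_var_power_inject:
  assumes "i \<noteq> j"
  shows "(poly_var x :: 'k::field mpoly) ^ i \<noteq> poly_var x ^ j"
proof -
  have "single x i \<noteq> single x j" using assms inj_single by (metis injD)
  then show ?thesis by (simp add: poly_var_power)
qed

text \<open>
  Each value is the generator of the kernel of a substitution: \<open>x\<^sub>0 \<mapsto> - x\<^sub>1\<^sup>i\<close> for the replaced variables, and
  \<open>x\<^sub>i \<mapsto> 0\<close> for the others. None of these substitutions kills another value.
\<close>

lemma spec_prime:
  assumes "2 \<le> i"
  shows "prime_elem (spec k i :: 'k::field mpoly)"
    and "2 \<le> j \<Longrightarrow> i \<noteq> j \<Longrightarrow> \<not> (spec k i :: 'k mpoly) dvd spec k j"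
proof -
  have "prime_elem (spec k i :: 'k mpoly) \<and> (2 \<le> j \<longrightarrow> i \<noteq> j \<longrightarrow> \<not> (spec k i :: 'k mpoly) dvd spec k j)" for j
  proof (cases "i < k")
    case True
    let ?\<tau> = "(poly_var :: nat \<Rightarrow> 'k mpoly)(0 := - (poly_var 1 ^ i))"
    have e: "spec k i = poly_var 0 - (- (poly_var 1 ^ i))" "subst ?\<tau> (spec k i) = 0" "spec k i \<noteq> (0 :: 'k mpoly)"
      using True assms param_neq_0 by (auto simp: spec_def param_def subst_add subst_power)
    have "subst ?\<tau> (spec k j) \<noteq> 0" if "2 \<le> j" "i \<noteq> j"
      using that poly_var_power_inject[of i j 1, where 'k = 'k] by (auto simp: spec_def param_def subst_add subst_power)
    then show ?thesis using prime_elem_by_subst[OF e] by auto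
  next
    case False
    let ?\<tau> = "(poly_var :: nat \<Rightarrow> 'k mpoly)(i := 0)"
    have e: "spec k i = poly_var i - 0" "subst ?\<tau> (spec k i) = 0" "spec k i \<noteq> (0 :: 'k mpoly)"
      using False by (auto simp: spec_def)
    have "subst ?\<tau> (spec k j) \<noteq> 0" if "2 \<le> j" "i \<noteq> j"
      using that assms param_neq_0[of j, where 'k = 'k] by (auto simp: spec_def param_def subst_add subst_power)
    then show ?thesis using prime_elem_by_subst[OF e] by auto
  qed
  then show "prime_elem (spec k i :: 'k mpoly)"
    and "2 \<le> j \<Longrightarrow> i \<noteq> j \<Longrightarrow> \<not> (spec k i :: 'k mpoly) dvd spec k j" by blast+
qed

lemma spec_2: "spec 2 = poly_var"
  by (rule ext) (auto simp: spec_def)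

text \<open>
  The elements of the regular sequence; adding them to an ideal imposes the specialization \<open>spec\<close>.
\<close>

definition theta :: "nat \<Rightarrow> 'k::field mpoly" where
  "theta k = poly_var k - param k"

lemma subst_spec_param [simp]: "subst (spec k) (param i) = param i"
  by (simp add: param_def subst_add subst_power spec_def)

lemma subst_upd_param [simp]: "2 \<le> k \<Longrightarrow> subst (poly_var(k := g)) (param i) = param i"
  by (simp add: param_def subst_add subst_power)

lemma theta_neq_0: "2 \<le> k \<Longrightarrow> theta k \<noteq> (0 :: 'k::field mpoly)"
proof
  assume "2 \<le> k" "theta k = (0 :: 'k mpoly)"
  then have "subst (poly_var(k := 0)) (theta k) = (0 :: 'k mpoly)" by simp
  then show False using \<open>2 \<le> k\<close> param_neq_0[of k, where 'k = 'k] by (simp add: theta_def subst_diff)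
qed

lemma ispan_image_coeffs:
  assumes "finite A" "x \<in> ispan (f ` A)"
  obtains c where "x = (\<Sum>a\<in>A. c a * f a)"
proof -
  have "\<exists>c. x = (\<Sum>a\<in>A. c a * f a)"
    using assms(2)
  proof (induction rule: mult_module.span_induct_alt)
    case base
    show ?case by (intro exI[of _ "\<lambda>_. 0"]) simp
  next
    case (step r y x)
    then obtain a c where a: "a \<in> A" "y = f a" "x = (\<Sum>a\<in>A. c a * f a)" by auto
    have "r * y + x = (\<Sum>b\<in>A. (if b = a then r else 0) * f b + c b * f b)"
      using a assms(1) by (simp add: sum.distrib if_distrib[of "\<lambda>x. x * _"] cong: if_cong)
    also have "\<dots> = (\<Sum>b\<in>A. ((if b = a then r else 0) + c b) * f b)" by (simp only: distrib_right)
    finally show ?case by (rule exI[of _ "\<lambda>b. (if b = a then r else 0) + c b"])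
  qed
  then show ?thesis using that by blast
qed

lemma ispan_image_sum: "(\<And>a. a \<in> A \<Longrightarrow> f a \<in> ispan B) \<Longrightarrow> (\<Sum>a\<in>A. c a * f a) \<in> ispan B"
  by (intro mult_module.span_sum mult_module.span_scale)

section \<open>The ideal of a rooted block structure\<close>

text \<open>
  The ideal attached to a rooted block structure, in \<open>n = 2 m + 2\<close> variables.
\<close>

locale block_ideal =
  fixes K :: "'k::field itself" and m p s n
  assumes bp: "block_parents m p s" and m1: "1 \<le> m" and n_def: "n = 2 * m + 2"
begin

abbreviation "U \<equiv> bmon m p s"
abbreviation "us \<equiv> bmons m p s"

lemma n_bounds: "2 < n" "3 < n" "k \<in> {1..m} \<Longrightarrow> 2 * k < n" "k \<in> {1..m} \<Longrightarrow> bvar p s v k < n"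
  using bvar_range(2)[OF bp, of k v] m1 by (auto simp: n_def)

definition "I = (ideal_of_monomials n (set us) :: 'k mpoly set)"

lemma us_keys: "u \<in> set us \<Longrightarrow> keys u \<subseteq> {..<n}"
  using keys_bmon[OF bp] by (auto simp: set_bmons n_def)

lemma xmon_us_PR: "xmon ` set us \<subseteq> (PR n :: 'k mpoly set)"
  using us_keys by auto

lemma I_ispan: "I = ispan (xmon ` set us) \<inter> PR n"
  unfolding I_def ideal_of_monomials_def by (rule genideal_poly_ring[OF xmon_us_PR])

lemma I_iff: "q \<in> I \<longleftrightarrow> q \<in> PR n \<and> (\<forall>t\<in>keys q. \<exists>v\<le>m. expo_le (U v) t)"
  unfolding I_def by (subst ideal_of_monomials_iff) (auto simp: us_keys set_bmons)

lemma I_ideal: "ideal I (poly_ring n)"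
proof -
  interpret cring "poly_ring n :: 'k mpoly ring" by (rule cring_poly_ring)
  show ?thesis unfolding I_def ideal_of_monomials_def using xmon_us_PR by (intro genideal_ideal) simp
qed

lemma minimal_generators: "minimal_monomial_generators n I us"
  unfolding minimal_monomial_generators_def
proof (intro conjI ballI allI impI)
  fix M assume M: "M \<subset> set us"
  then obtain u where u: "u \<in> set us" "u \<notin> M" by blast
  have degs: "expo_deg w = m" if "w \<in> set us" for w using that by (auto simp: set_bmons expo_deg_bmon)
  have "(xmon u :: 'k mpoly) \<notin> ideal_of_monomials n M"
  proof
    assume "(xmon u :: 'k mpoly) \<in> ideal_of_monomials n M"
    then obtain w where "w \<in> M" "expo_le w u"
      using M us_keys by (subst (asm) ideal_of_monomials_iff) auto
    moreover then have "w = u" using degs[of w] degs[of u] u M by (intro expo_le_deg_eq) auto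
    ultimately show False using u by simp
  qed
  moreover have "xmon u \<in> I"
    using u us_keys unfolding I_def by (subst ideal_of_monomials_iff) (auto intro!: bexI[of _ u])
  ultimately show "ideal_of_monomials n M \<noteq> I" by auto
qed (use us_keys distinct_bmons[OF bp] in \<open>auto simp: I_def\<close>)

lemma relation_mon_ev: "j \<in> {1..m} \<Longrightarrow> \<sigma> (2 * j) * mon_ev \<sigma> (U j) = \<sigma> (2 * s j + 1) * mon_ev \<sigma> (U (p j))"
proof -
  assume j: "j \<in> {1..m}"
  have "mon_ev \<sigma> (U j + single (2 * j) 1) = mon_ev \<sigma> (U (p j) + single (2 * s j + 1) 1)"
    by (simp only: bmon_parent[OF bp j])
  then show ?thesis unfolding mon_ev_add by (simp add: mult.commute)
qed

text \<open>
  Combinations of the relations \<open>y\<^sub>j e\<^sub>j - z\<^bsub>s j\<^esub> e\<^bsub>p j\<^esub>\<close> are syzygies, also after any substitution \<open>\<sigma>\<close>.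
\<close>

lemma relation_sum:
  fixes \<sigma> :: "nat \<Rightarrow> 'k mpoly"
  assumes c: "\<And>v. v \<le> m \<Longrightarrow> c v =
      (\<Sum>j\<in>{1..m}. d j * ((if v = j then \<sigma> (2 * j) else 0) - (if v = p j then \<sigma> (2 * s j + 1) else 0)))"
  shows "(\<Sum>v\<le>m. c v * mon_ev \<sigma> (U v)) = 0"
proof -
  have "(\<Sum>v\<le>m. c v * mon_ev \<sigma> (U v)) = (\<Sum>v\<le>m. \<Sum>j\<in>{1..m}.
      d j * ((if v = j then \<sigma> (2 * j) * mon_ev \<sigma> (U j) else 0)
        - (if v = p j then \<sigma> (2 * s j + 1) * mon_ev \<sigma> (U (p j)) else 0)))"
  proof (rule sum.cong[OF refl])
    fix v assume v: "v \<in> {..m}"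
    then have v: "v \<le> m" by simp
    show "c v * mon_ev \<sigma> (U v) = (\<Sum>j\<in>{1..m}.
      d j * ((if v = j then \<sigma> (2 * j) * mon_ev \<sigma> (U j) else 0)
        - (if v = p j then \<sigma> (2 * s j + 1) * mon_ev \<sigma> (U (p j)) else 0)))"
    proof -
      have "((if v = j then x else 0) - (if v = p j then y else 0)) * mon_ev \<sigma> (U v)
          = (if v = j then x * mon_ev \<sigma> (U j) else 0) - (if v = p j then y * mon_ev \<sigma> (U (p j)) else 0)"
        for j and x y :: "'k mpoly" by (cases "v = j"; cases "v = p j") (simp_all add: left_diff_distrib)
      then show ?thesis by (simp only: c[OF v] sum_distrib_right mult.assoc)
    qed
  qed
  also have "\<dots> = (\<Sum>j\<in>{1..m}. \<Sum>v\<le>m.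
      d j * ((if v = j then \<sigma> (2 * j) * mon_ev \<sigma> (U j) else 0)
        - (if v = p j then \<sigma> (2 * s j + 1) * mon_ev \<sigma> (U (p j)) else 0)))"
    by (rule sum.swap)
  also have "\<dots> = 0"
  proof (rule sum.neutral, rule ballI)
    fix j assume j: "j \<in> {1..m}"
    then have "p j \<le> m" using block_parentsD(1)[OF bp, of j] by simp
    then show "(\<Sum>v\<le>m. d j * ((if v = j then \<sigma> (2 * j) * mon_ev \<sigma> (U j) else 0)
        - (if v = p j then \<sigma> (2 * s j + 1) * mon_ev \<sigma> (U (p j)) else 0))) = 0"
      using j unfolding sum_distrib_left[symmetric] sum_subtractf by (simp add: relation_mon_ev[OF j])
  qed
  finally show ?thesis .
qed

lemma spec_syzygies:
  assumes "(\<Sum>v\<le>m. c v * mon_ev (spec k) (U v)) = (0 :: 'k mpoly)"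
  shows "\<exists>d. \<forall>v\<le>m. c v = (\<Sum>j\<in>{1..m}. d j *
    ((if v = j then spec k (2 * j) else 0) - (if v = p j then spec k (2 * s j + 1) else 0)))"
  using assms spec_prime[where 'k = 'k] unfolding mon_ev_bmon by (intro block_syzygies[OF bp]) auto

section \<open>A regular sequence\<close>

text \<open>
  The ideal generated by \<open>I\<close> and the first \<open>k - 2\<close> elements of the sequence, in the ring with all variables.
\<close>

definition "J k = (ispan (xmon ` set us \<union> theta ` {2..<k}) :: 'k mpoly set)"

text \<open>
  Modulo \<open>J k\<close> every polynomial is congruent to its specialization, so membership can be tested after
  specializing.
\<close>

lemma J_iff: "a \<in> J k \<longleftrightarrow> subst (spec k) a \<in> ispan ((\<lambda>v. mon_ev (spec k) (U v)) ` {..m})"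
proof
  assume "a \<in> J k"
  then show "subst (spec k) a \<in> ispan ((\<lambda>v. mon_ev (spec k) (U v)) ` {..m})"
    unfolding J_def
  proof (induction rule: mult_module.span_induct_alt)
    case base
    show ?case by (simp add: mult_module.span_zero)
  next
    case (step c x y)
    have "subst (spec k) x \<in> ispan ((\<lambda>v. mon_ev (spec k) (U v)) ` {..m})"
      using step(1)
    proof
      assume "x \<in> xmon ` set us"
      then obtain v where "v \<le> m" "x = xmon (U v)" by (auto simp: set_bmons)
      then show ?thesis by (intro mult_module.span_base) auto
    next
      assume "x \<in> theta ` {2..<k}"
      then have "subst (spec k) x = 0" by (auto simp: theta_def subst_diff spec_def)
      then show ?thesis by (simp add: mult_module.span_zero)
    qed
    then show ?case using step(2)
      by (simp add: subst_add subst_mult mult_module.span_add mult_module.span_scale)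
  qed
next
  have diff: "subst poly_var a - subst (spec k) a \<in> J k" for a
    unfolding J_def
    by (rule subst_diff_in_ispan) (auto simp: spec_def theta_def[symmetric] mult_module.span_zero intro: mult_module.span_base)
  assume a: "subst (spec k) a \<in> ispan ((\<lambda>v. mon_ev (spec k) (U v)) ` {..m})"
  obtain c where c: "subst (spec k) a = (\<Sum>v\<le>m. c v * mon_ev (spec k) (U v))"
    using ispan_image_coeffs[OF finite_atMost a] by blast
  have "mon_ev (spec k) (U v) \<in> J k" if "v \<le> m" for v
  proof -
    have "xmon (U v) \<in> J k" unfolding J_def using that by (intro mult_module.span_base) (auto simp: set_bmons)
    moreover have "xmon (U v) - mon_ev (spec k) (U v) \<in> J k" using diff[of "xmon (U v)"] by (simp add: mon_ev_poly_var)
    ultimately show ?thesis unfolding J_def using mult_module.span_diff by fastforce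
  qed
  then have "subst (spec k) a \<in> J k" unfolding c J_def by (intro ispan_image_sum) auto
  moreover have "a = (a - subst (spec k) a) + subst (spec k) a" by simp
  ultimately show "a \<in> J k" using diff[of a] unfolding J_def by (metis mult_module.span_add subst_id)
qed

text \<open>
  After specialization, let \<open>theta k * a' = (\<Sum>v\<le>m. c v * g v)\<close>, where \<open>g v\<close> are the specialized generators. Applying
  \<open>x\<^sub>k \<mapsto> param k\<close>, written \<open>\<psi>\<close>, turns this into a syzygy \<open>\<psi> c\<close> of the generators specialized one step
  further. By \<open>block_syzygies\<close> it is a combination of the standard relations, and the same combination of
  the relations before the step is a syzygy \<open>c'\<close> of \<open>g\<close> with \<open>\<psi> c' = \<psi> c\<close>. So \<open>theta k\<close> divides \<open>c - c'\<close>, and can be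
  cancelled.
\<close>

lemma theta_nzd:
  assumes k: "2 \<le> k" and a: "theta k * a \<in> J k"
  shows "a \<in> J k"
proof -
  let ?\<sigma> = "spec k :: nat \<Rightarrow> 'k mpoly" and ?\<psi> = "subst (poly_var(k := param k)) :: 'k mpoly \<Rightarrow> 'k mpoly"
  let ?g = "\<lambda>v. mon_ev ?\<sigma> (U v)"
  define a' where "a' = subst ?\<sigma> a"
  have \<sigma>\<theta>: "subst ?\<sigma> (theta k) = theta k" by (simp add: theta_def subst_diff) (simp add: spec_def)
  have \<psi>\<theta>: "?\<psi> (theta k) = 0" using k by (simp add: theta_def subst_diff)
  have "theta k * a' \<in> ispan (?g ` {..m})" using a unfolding J_iff subst_mult \<sigma>\<theta> a'_def .
  then obtain c where c: "theta k * a' = (\<Sum>v\<le>m. c v * ?g v)"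
    using ispan_image_coeffs[OF finite_atMost] by metis
  have \<psi>\<sigma>: "?\<psi> (?\<sigma> i) = spec (Suc k) i" for i using k by (auto simp: spec_def)
  have \<psi>g: "?\<psi> (?g v) = mon_ev (spec (Suc k)) (U v)" for v
    unfolding mon_ev_bmon subst_prod \<psi>\<sigma> ..
  have \<psi>\<psi>: "?\<psi> (?\<psi> x) = ?\<psi> x" for x
    unfolding subst_subst using k by (intro subst_cong) auto
  have "0 = ?\<psi> (theta k * a')" by (simp add: subst_mult \<psi>\<theta>)
  also have "\<dots> = (\<Sum>v\<le>m. ?\<psi> (c v) * mon_ev (spec (Suc k)) (U v))"
    unfolding c subst_sum subst_mult \<psi>g ..
  finally obtain d where d: "\<And>v. v \<le> m \<Longrightarrow> ?\<psi> (c v) = (\<Sum>j\<in>{1..m}. d j *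
    ((if v = j then spec (Suc k) (2 * j) else 0) - (if v = p j then spec (Suc k) (2 * s j + 1) else 0)))"
    using spec_syzygies[of "\<lambda>v. ?\<psi> (c v)" "Suc k"] by auto
  define c' where "c' v = (\<Sum>j\<in>{1..m}. d j *
    ((if v = j then ?\<sigma> (2 * j) else 0) - (if v = p j then ?\<sigma> (2 * s j + 1) else 0)))" for v
  have c'0: "(\<Sum>v\<le>m. c' v * ?g v) = 0" by (rule relation_sum) (simp add: c'_def)
  have if\<psi>: "?\<psi> (if P then x else 0) = (if P then ?\<psi> x else 0)" for P x by simp
  have spec2: "?\<psi> (spec (Suc k) i) = spec (Suc k) i" for i
    using \<psi>\<psi>[of "?\<sigma> i"] by (simp only: \<psi>\<sigma>)
  have "?\<psi> (c v - c' v) = 0" if v: "v \<le> m" for v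
  proof -
    have "?\<psi> (c v) = ?\<psi> (?\<psi> (c v))" by (simp only: \<psi>\<psi>)
    also have "\<dots> = ?\<psi> (c' v)"
      unfolding d[OF v] c'_def subst_sum subst_mult subst_diff if\<psi> spec2 \<psi>\<sigma> ..
    finally show ?thesis by (simp add: subst_diff)
  qed
  then have "theta k dvd c v - c' v" if "v \<le> m" for v
    using diff_subst_dvd[of "theta k" k "param k" "c v - c' v"] that by (simp add: theta_def)
  then have "\<forall>v. \<exists>h. v \<le> m \<longrightarrow> c v - c' v = theta k * h" by (meson dvdE)
  then obtain h where h: "\<And>v. v \<le> m \<Longrightarrow> c v - c' v = theta k * h v" by metis
  have "theta k * a' = (\<Sum>v\<le>m. c v * ?g v) - (\<Sum>v\<le>m. c' v * ?g v)" using c c'0 by simp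
  also have "\<dots> = (\<Sum>v\<le>m. (c v - c' v) * ?g v)" by (simp add: sum_subtractf left_diff_distrib)
  also have "\<dots> = theta k * (\<Sum>v\<le>m. h v * ?g v)"
    unfolding sum_distrib_left by (intro sum.cong refl) (simp only: h atMost_iff mult.assoc)
  finally have "a' = (\<Sum>v\<le>m. h v * ?g v)" using theta_neq_0[OF k, where 'k = 'k] by simp
  moreover have "(\<Sum>v\<le>m. h v * ?g v) \<in> ispan (?g ` {..m})"
    by (intro ispan_image_sum mult_module.span_base) auto
  ultimately show ?thesis unfolding J_iff a'_def by simp
qed

definition "thetas = (map theta [2..<n] :: 'k mpoly list)"

lemma theta_PR: "k < n \<Longrightarrow> 2 \<le> k \<Longrightarrow> theta k \<in> PR n"
  by (auto simp: theta_def param_def intro!: PR_diff PR_add PR_power)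

lemma genideal_I_thetas:
  assumes "k \<le> n"
  shows "genideal (poly_ring n) (I \<union> theta ` {2..<k}) = J k \<inter> PR n"
proof -
  have "theta i \<in> (PR n :: 'k mpoly set)" if "i \<in> {2..<k}" for i by (rule theta_PR) (use that assms in auto)
  then have sub: "I \<union> theta ` {2..<k} \<subseteq> PR n" by (auto simp: I_iff)
  have "ispan (I \<union> theta ` {2..<k}) = J k"
    unfolding J_def mult_module.span_eq
  proof
    have "I \<subseteq> ispan (xmon ` set us)" using I_ispan by blast
    also have "\<dots> \<subseteq> ispan (xmon ` set us \<union> theta ` {2..<k})" by (rule mult_module.span_mono) simp
    finally show "I \<union> theta ` {2..<k} \<subseteq> ispan (xmon ` set us \<union> theta ` {2..<k})"
      by (auto intro: mult_module.span_base)
    have "xmon ` set us \<subseteq> I" using xmon_us_PR unfolding I_ispan by (auto intro: mult_module.span_base)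
    then show "xmon ` set us \<union> theta ` {2..<k} \<subseteq> ispan (I \<union> theta ` {2..<k})"
      by (auto intro: mult_module.span_base)
  qed
  then show ?thesis using genideal_poly_ring[OF sub] by simp
qed

lemma set_take_thetas:
  assumes "i \<le> length thetas"
  shows "set (take i thetas) = theta ` {2..<i + 2}"
proof -
  have "2 + i \<le> n" using assms n_bounds(1) by (simp add: thetas_def)
  then have "take i [2..<n] = [2..<2 + i]" by (rule take_upt)
  then show ?thesis unfolding thetas_def take_map by (simp add: add.commute del: upt_Suc)
qed

text \<open>
  All generators and all elements \<open>theta k\<close> vanish at the origin.
\<close>

lemma one_notin_J: "1 \<notin> J k"
proof
  assume "1 \<in> J k"
  have "subst (\<lambda>_. 0) x = 0" if "x \<in> J k" for x :: "'k mpoly"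
    using that unfolding J_def
  proof (induction rule: mult_module.span_induct_alt)
    case (step c x y)
    have "subst (\<lambda>_. 0) x = 0"
      using step(1) m1 by (auto simp: set_bmons mon_ev_bmon theta_def param_def subst_diff subst_add subst_power)
    then show ?case using step by (simp add: subst_add subst_mult)
  qed simp
  from this[OF \<open>1 \<in> J k\<close>] show False by simp
qed

lemma regular_seq_thetas: "regular_seq (poly_ring n) I thetas"
  unfolding regular_seq_def
proof (intro conjI allI impI ballI)
  have len: "length thetas = n - 2" by (simp add: thetas_def)
  show "set thetas \<subseteq> carrier (poly_ring n)" using theta_PR by (auto simp: thetas_def)
  show "genideal (poly_ring n) (I \<union> set thetas) \<noteq> carrier (poly_ring n)"
  proof -
    have "set thetas = theta ` {2..<n}" by (simp add: thetas_def)
    then show ?thesis using genideal_I_thetas[of n] one_notin_J[of n] PR_1 by auto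
  qed
  fix i a assume i: "i < length thetas" and a: "a \<in> carrier (poly_ring n)"
    "thetas ! i \<otimes>\<^bsub>poly_ring n\<^esub> a \<in> genideal (poly_ring n) (I \<union> set (take i thetas))"
  have th: "thetas ! i = theta (i + 2)" using i by (simp add: thetas_def)
  have J: "genideal (poly_ring n) (I \<union> set (take i thetas)) = J (i + 2) \<inter> PR n"
    using i len by (simp add: set_take_thetas genideal_I_thetas)
  have "theta (i + 2) * a \<in> J (i + 2)" using a(2) unfolding J th by simp
  then have "a \<in> J (i + 2)" by (rule theta_nzd[rotated]) simp
  then show "a \<in> genideal (poly_ring n) (I \<union> set (take i thetas))" unfolding J using a(1) by simp
qed

lemma irrelevant_ideal_ispan: "irrelevant_ideal n = ispan (poly_var ` {..<n}) \<inter> (PR n :: 'k mpoly set)"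
  unfolding irrelevant_ideal_def by (rule genideal_poly_ring) auto

lemma thetas_irrelevant: "set thetas \<subseteq> irrelevant_ideal n"
proof
  fix x assume "x \<in> set thetas"
  then obtain k where k: "2 \<le> k" "k < n" "x = theta k" by (auto simp: thetas_def)
  have v: "poly_var i \<in> ispan (poly_var ` {..<n} :: 'k mpoly set)" if "i < n" for i
    using that by (intro mult_module.span_base) auto
  have "(poly_var 1 :: 'k mpoly) ^ k = poly_var 1 ^ (k - 1) * poly_var 1"
    using k by (simp add: power_eq_if mult.commute)
  moreover have "poly_var 1 ^ (k - 1) * poly_var 1 \<in> ispan (poly_var ` {..<n} :: 'k mpoly set)"
    using v[of 1] n_bounds by (intro mult_module.span_scale) auto
  ultimately have "x \<in> ispan (poly_var ` {..<n})"
    unfolding k(3) theta_def param_def using k n_bounds v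
    by (intro mult_module.span_diff mult_module.span_add) auto
  then show "x \<in> irrelevant_ideal n"
    unfolding irrelevant_ideal_ispan using k theta_PR by auto
qed

section \<open>Depth, krull_dim_I and height_I\<close>

text \<open>
  The hypothesis says that at most one variable is missing from \<open>t\<close>. If it is \<open>y\<^sub>k\<close>, then \<open>u\<^sub>k\<close>, which does not
  involve \<open>y\<^sub>k\<close>, divides \<open>t\<close>; otherwise \<open>u\<^sub>0\<close> does.
\<close>

lemma monomial_covered:
  assumes "\<And>a b. a < b \<Longrightarrow> b < n \<Longrightarrow> a \<in> keys t \<or> b \<in> keys t"
  shows "\<exists>v\<le>m. expo_le (U v) t"
proof (cases "\<exists>k\<in>{1..m}. 2 * k \<notin> keys t")
  case True
  then obtain k where k: "k \<in> {1..m}" "2 * k \<notin> keys t" by blast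
  have "expo_le (U k) t"
  proof (rule expo_le_bmonI[OF bp])
    fix j assume j: "j \<in> {1..m}"
    have "k \<in> anc p k" using block_parentsD(1)[OF bp, of k] k by (simp add: anc_rec)
    then have "bvar p s k j \<noteq> 2 * k" by (auto simp: bvar_def) presburger
    then have "bvar p s k j \<in> keys t"
      using assms[of "2 * k" "bvar p s k j"] assms[of "bvar p s k j" "2 * k"] k n_bounds(3)[OF k(1)] n_bounds(4)[OF j, of k]
      by (cases "2 * k" "bvar p s k j" rule: linorder_cases) auto
    then show "lookup t (bvar p s k j) \<noteq> 0" by (simp add: in_keys_iff)
  qed (use k in simp)
  then show ?thesis using k by auto
next
  case False
  have "expo_le (U 0) t" by (rule expo_le_bmonI[OF bp]) (use False in \<open>auto simp: bvar_def in_keys_iff\<close>)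
  then show ?thesis by auto
qed

text \<open>
  By \<open>monomial_covered\<close>, \<open>I\<close> contains the intersection of the primes generated by two variables. A longer
  family is dependent modulo each of these finitely many primes, and the product of the relations is a
  relation modulo \<open>I\<close>.
\<close>

lemma alg_indep_mod_I_length:
  assumes gs: "set gs \<subseteq> (PR n :: 'k mpoly set)" and indep: "alg_indep_mod I gs"
  shows "length gs \<le> n - 2"
proof (rule ccontr)
  assume long: "\<not> ?thesis"
  define Zs where "Zs = {Z. \<exists>a b. a < b \<and> b < n \<and> Z = {a, b}}"
  have finZ: "finite Zs" by (rule finite_subset[of _ "Pow {..<n}"]) (auto simp: Zs_def)
  have "\<exists>F. F \<in> PR (length gs) \<and> subst (nth gs) F \<in> var_ideal n Z \<and> F \<noteq> 0" if "Z \<in> Zs" for Z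
  proof (rule ccontr)
    assume "\<not> ?thesis"
    then have "alg_indep_mod (var_ideal n Z) gs" by (auto simp: alg_indep_mod_def)
    moreover have "Z \<subseteq> {..<n}" "card Z = 2" using that by (auto simp: Zs_def)
    ultimately show False using alg_indep_mod_var_ideal_length[OF _ gs, of Z] long by simp
  qed
  then obtain F where F: "\<And>Z. Z \<in> Zs \<Longrightarrow> F Z \<in> PR (length gs)"
    "\<And>Z. Z \<in> Zs \<Longrightarrow> subst (nth gs) (F Z) \<in> var_ideal n Z" "\<And>Z. Z \<in> Zs \<Longrightarrow> F Z \<noteq> 0" by metis
  define P where "P = (\<Prod>Z\<in>Zs. F Z)"
  have P: "P \<in> PR (length gs)" "P \<noteq> 0" using F finZ by (auto simp: P_def)
  have "subst (nth gs) P \<in> var_ideal n Z" if Z: "Z \<in> Zs" for Z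
  proof -
    have "subst (kill Z) (subst (nth gs) (F Z)) = 0" using F(2)[OF Z] by (simp add: var_ideal_def)
    then have "subst (kill Z) (subst (nth gs) P) = 0"
      using finZ Z by (auto simp: P_def subst_prod)
    then show ?thesis using subst_nth_PR[OF gs P(1)] by (simp add: var_ideal_def)
  qed
  then have all: "keys t \<inter> Z \<noteq> {}" if "Z \<in> Zs" "t \<in> keys (subst (nth gs) P)" for t Z
    using that by (auto simp: var_ideal_iff)
  have "\<exists>v\<le>m. expo_le (U v) t" if t: "t \<in> keys (subst (nth gs) P)" for t
  proof (rule monomial_covered)
    fix a b :: nat assume "a < b" "b < n"
    then have "{a, b} \<in> Zs" by (auto simp: Zs_def)
    from all[OF this t] show "a \<in> keys t \<or> b \<in> keys t" by auto
  qed
  then have "subst (nth gs) P \<in> I" using subst_nth_PR[OF gs P(1)] by (simp add: I_iff)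
  then show False using indep P by (auto simp: alg_indep_mod_def)
qed

lemma depth_I: "depth_quot n I = enat (n - 2)"
  unfolding depth_quot_def
proof (rule antisym)
  show "Sup {enat (length fs) |fs. set fs \<subseteq> irrelevant_ideal n \<and> regular_seq (poly_ring n) I fs} \<le> enat (n - 2)"
  proof (rule Sup_least)
    fix x assume "x \<in> {enat (length fs) |fs. set fs \<subseteq> irrelevant_ideal n \<and> regular_seq (poly_ring n) I fs}"
    then obtain fs where fs: "x = enat (length fs)" "regular_seq (poly_ring n) I fs" by blast
    have "I \<subseteq> PR n" by (auto simp: I_iff)
    from regular_seq_alg_indep[OF fs(2) this] alg_indep_mod_I_length show "x \<le> enat (n - 2)" unfolding fs(1) by force
  qed
  have "enat (n - 2) = enat (length thetas)" by (simp add: thetas_def)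
  then show "enat (n - 2) \<le> Sup {enat (length fs) |fs. set fs \<subseteq> irrelevant_ideal n \<and> regular_seq (poly_ring n) I fs}"
    using thetas_irrelevant regular_seq_thetas by (intro Sup_upper) blast
qed

lemma poly_var_in_var_ideal: "i < n \<Longrightarrow> poly_var i \<in> (var_ideal n Z :: 'k mpoly set) \<longleftrightarrow> i \<in> Z"
  by (simp add: var_ideal_def kill_def)

lemma var_ideal_mono: "Z \<subseteq> Z' \<Longrightarrow> (var_ideal n Z :: 'k mpoly set) \<subseteq> var_ideal n Z'"
  by (intro subsetI) (fastforce simp: var_ideal_iff)

text \<open>
  These are the variables \<open>y\<^sub>1\<close> and \<open>z\<^sub>1\<close>: since \<open>s 1 = 1\<close>, the first factor of every generator is one of them.
\<close>

lemma I_subset_var_ideal: "I \<subseteq> var_ideal n {2, 3}"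
proof
  fix q assume q: "q \<in> I"
  have "keys t \<inter> {2, 3} \<noteq> {}" if t: "t \<in> keys q" for t
  proof -
    obtain v where v: "v \<le> m" "expo_le (U v) t" using q t by (auto simp: I_iff)
    have "bvar p s v 1 \<in> keys (U v)" using v m1 by (auto simp: in_keys_iff lookup_bmon[OF bp])
    moreover have "bvar p s v 1 \<in> {2, 3}"
      using block_parentsD(2,3)[OF bp, of 1] m1 by (auto simp: bvar_def)
    ultimately show ?thesis using expo_le_keys[OF v(2)] by blast
  qed
  then show "q \<in> var_ideal n {2, 3}" using q by (simp add: var_ideal_iff I_iff)
qed

text \<open>
  The upper bound is \<open>prime_chain_alg_indep\<close>, applied to the empty family modulo the largest prime of a chain.
  The lower bound is the chain that starts with the ideal of the variables \<open>2, 3\<close> and adds the other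
  variables one at a time.
\<close>

lemma krull_dim_I: "krull_dim (poly_ring n Quot I) = enat (n - 2)"
proof -
  interpret cring "poly_ring n :: 'k mpoly ring" by (rule cring_poly_ring)
  note iff = prime_chain_Quot_iff[OF I_ideal]
  show ?thesis
    unfolding krull_dim_def iff
  proof (rule antisym)
    show "Sup {enat k |k. \<exists>P. prime_chain (poly_ring n) P k \<and> I \<subseteq> P 0} \<le> enat (n - 2)"
    proof (rule Sup_least)
      fix x assume "x \<in> {enat k |k. \<exists>P. prime_chain (poly_ring n) P k \<and> I \<subseteq> P 0}"
      then obtain k P where k: "x = enat k" "prime_chain (poly_ring n) P k" "I \<subseteq> P 0" by blast
      then have pr: "primeideal (P k) (poly_ring n)" by (simp add: prime_chain_def)
      have id: "ideal (P k) (poly_ring n)" by (rule primeideal.axioms(1)[OF pr])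
      have "1 \<notin> P k" using primeideal.I_notcarr[OF pr] ideal.one_imp_carrier[OF id] by auto
      then have "alg_indep_mod (P k) []" by (rule alg_indep_mod_Nil[OF id])
      from prime_chain_alg_indep[OF k(2) _ this] obtain gs
        where gs: "length gs = k" "set gs \<subseteq> PR n" "alg_indep_mod (P 0) gs" by auto
      then show "x \<le> enat (n - 2)"
        using alg_indep_mod_I_length[OF gs(2) alg_indep_mod_mono[OF gs(3) k(3)]] k(1) by simp
    qed
    define xs where "xs = sorted_list_of_set ({..<n} - {2, 3})"
    have xs: "set xs = {..<n} - {2, 3}" "distinct xs" by (auto simp: xs_def)
    have len: "length xs = n - 2" using n_bounds by (simp add: xs_def card_Diff_subset)
    define P where "P i = (var_ideal n ({2, 3} \<union> set (take i xs)) :: 'k mpoly set)" for i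
    have "P i \<subset> P (Suc i)" if i: "i < n - 2" for i
    proof -
      have "xs ! i \<in> set xs" using i len by simp
      then have xi: "xs ! i < n" "xs ! i \<notin> {2, 3}" using xs(1) by auto
      have "xs ! i \<notin> set (take i xs)"
        using xs(2) i len by (auto simp: in_set_conv_nth nth_eq_iff_index_eq)
      then have "poly_var (xs ! i) \<notin> P i" "poly_var (xs ! i) \<in> P (Suc i)"
        using xi i len by (auto simp: P_def poly_var_in_var_ideal take_Suc_conv_app_nth)
      moreover have "P i \<subseteq> P (Suc i)" unfolding P_def using i len
        by (intro var_ideal_mono) (auto simp: take_Suc_conv_app_nth)
      ultimately show ?thesis by blast
    qed
    then have "prime_chain (poly_ring n) P (n - 2)"
      by (simp add: prime_chain_def P_def primeideal_var_ideal)
    moreover have "I \<subseteq> P 0" using I_subset_var_ideal by (simp add: P_def)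
    ultimately show "enat (n - 2) \<le> Sup {enat k |k. \<exists>P. prime_chain (poly_ring n) P k \<and> I \<subseteq> P 0}"
      by (intro Sup_upper) blast
  qed
qed

lemma prime_prod_mem:
  assumes Q: "primeideal Q (poly_ring n)" and A: "finite A"
    and f: "\<And>a. a \<in> A \<Longrightarrow> f a \<in> PR n" and prod: "prod f A \<in> Q"
  shows "\<exists>a\<in>A. f a \<in> Q"
  using A f prod
proof (induction A rule: finite_induct)
  case empty
  have "ideal Q (poly_ring n)" by (rule primeideal.axioms(1)[OF Q])
  then show ?case using empty primeideal.I_notcarr[OF Q] ideal.one_imp_carrier[of Q "poly_ring n"] by auto
next
  case (insert a A)
  then show ?case using primeideal.I_prime[OF Q, of "f a" "prod f A"] by auto
qed

text \<open>
  At most two: modulo the ideal of the variables \<open>2, 3\<close> the other \<open>n - 2\<close> variables are independent, and a chain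
  of length \<open>k\<close> below it produces \<open>n - 2 + k\<close> independent elements. At least two: a prime over \<open>I\<close> contains some
  factor \<open>y\<^sub>k\<close> of \<open>u\<^sub>0\<close>, and also a factor of \<open>u\<^sub>k\<close>, which does not involve \<open>y\<^sub>k\<close>.
\<close>

lemma height_I: "ideal_height (poly_ring n) I = 2"
proof (rule antisym)
  let ?Q = "var_ideal n {2, 3} :: 'k mpoly set"
  have "prime_height (poly_ring n) ?Q \<le> 2"
    unfolding prime_height_def
  proof (rule Sup_least)
    fix x assume "x \<in> {enat k |k. \<exists>P. prime_chain (poly_ring n) P k \<and> P k = ?Q}"
    then obtain k P where k: "x = enat k" "prime_chain (poly_ring n) P k" "P k = ?Q" by blast
    have Z: "{2, 3} \<subseteq> {..<n}" using n_bounds by auto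
    obtain fs :: "'k mpoly list" where fs: "length fs = n - card {2::nat, 3}" "set fs \<subseteq> PR n" "alg_indep_mod ?Q fs"
      using alg_indep_mod_var_ideal_vars[OF Z] by blast
    obtain gs where gs: "length gs = length fs + k" "set gs \<subseteq> PR n" "alg_indep_mod (P 0) gs"
      using prime_chain_alg_indep[OF k(2) fs(2)] fs(3) k(3) by auto
    have "primeideal (P 0) (poly_ring n)" using k(2) by (simp add: prime_chain_def)
    then have "0 \<in> P 0" using ideal_poly_ringD(2)[OF primeideal.axioms(1)] by blast
    moreover have "var_ideal n {} = {0 :: 'k mpoly}"
    proof -
      have "kill {} = (poly_var :: nat \<Rightarrow> 'k mpoly)" by (auto simp: kill_def)
      then show ?thesis by (auto simp: var_ideal_def)
    qed
    ultimately have "alg_indep_mod (var_ideal n {}) gs" using alg_indep_mod_mono[OF gs(3)] by auto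
    from alg_indep_mod_var_ideal_length[OF _ gs(2) this] have "length gs \<le> n" by simp
    then have "k \<le> 2" using gs(1) fs(1) by simp
    then show "x \<le> 2" unfolding k(1) by (metis enat_ord_simps(1) numeral_eq_enat)
  qed
  moreover have "ideal_height (poly_ring n) I \<le> prime_height (poly_ring n) ?Q"
    unfolding ideal_height_def using primeideal_var_ideal I_subset_var_ideal by (intro Inf_lower) blast
  ultimately show "ideal_height (poly_ring n) I \<le> 2" by simp
next
  show "2 \<le> ideal_height (poly_ring n) I"
    unfolding ideal_height_def
  proof (rule Inf_greatest)
    fix x assume "x \<in> {prime_height (poly_ring n) Q |Q. primeideal Q (poly_ring n) \<and> I \<subseteq> Q}"
    then obtain Q where Q: "x = prime_height (poly_ring n) Q" "primeideal Q (poly_ring n)" "I \<subseteq> Q" by blast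
    have ex: "\<exists>k\<in>{1..m}. poly_var (bvar p s v k) \<in> Q" if "v \<le> m" for v
    proof (rule prime_prod_mem[OF Q(2)])
      have "xmon (U v) \<in> I" using that us_keys[of "U v"] by (auto simp: I_iff set_bmons)
      then show "(\<Prod>k\<in>{1..m}. poly_var (bvar p s v k)) \<in> Q"
        using Q(3) unfolding mon_ev_bmon[symmetric] mon_ev_poly_var by blast
    qed (use n_bounds in auto)
    obtain k where k: "k \<in> {1..m}" "poly_var (bvar p s 0 k) \<in> Q" using ex[of 0] by auto
    then have y: "poly_var (2 * k) \<in> Q" by (simp add: bvar_def)
    obtain l where l: "l \<in> {1..m}" "poly_var (bvar p s k l) \<in> Q" using ex[of k] k by auto
    have "k \<in> anc p k" using block_parentsD(1)[OF bp, of k] k by (simp add: anc_rec)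
    then have ne: "bvar p s k l \<noteq> 2 * k" by (auto simp: bvar_def) presburger
    define P where "P i = (if i = 0 then var_ideal n {} else if i = 1 then var_ideal n {2 * k} else Q)" for i :: nat
    have idQ: "ideal Q (poly_ring n)" by (rule primeideal.axioms(1)[OF Q(2)])
    have "var_ideal n {2 * k} \<subseteq> Q"
    proof
      fix q :: "'k mpoly" assume q: "q \<in> var_ideal n {2 * k}"
      then have q': "q \<in> PR n" "\<And>t. t \<in> keys q \<Longrightarrow> expo_le (single (2 * k) 1) t"
        by (auto simp: var_ideal_iff expo_le_single_iff in_keys_iff Suc_le_eq)
      obtain r where "q = xmon (single (2 * k) 1) * r" "r \<in> PR n"
        using xmon_dvd_factor_PR[OF q'(2,1)] by blast
      then have "q = r * poly_var (2 * k)" by (simp add: poly_var_def mult.commute)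
      then show "q \<in> Q" using ideal_poly_ringD(4)[OF idQ y] \<open>r \<in> PR n\<close> by simp
    qed
    moreover have "poly_var (bvar p s k l) \<notin> (var_ideal n {2 * k} :: 'k mpoly set)"
      using ne n_bounds(4)[OF l(1)] by (simp add: poly_var_in_var_ideal)
    ultimately have "var_ideal n {2 * k} \<subset> Q" using l by blast
    moreover have "var_ideal n {} \<subset> (var_ideal n {2 * k} :: 'k mpoly set)"
      using var_ideal_mono[of "{}" "{2 * k}"] poly_var_in_var_ideal[of "2 * k" "{}"]
        poly_var_in_var_ideal[of "2 * k" "{2 * k}"] n_bounds(3)[OF k(1)] by auto
    ultimately have "prime_chain (poly_ring n) P 2"
      using Q(2) by (auto simp: prime_chain_def P_def primeideal_var_ideal less_2_cases_iff)
    moreover have "P 2 = Q" by (simp add: P_def)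
    ultimately have "enat 2 \<le> prime_height (poly_ring n) Q"
      unfolding prime_height_def by (intro Sup_upper) blast
    then show "2 \<le> x" unfolding Q(1) by (simp add: numeral_eq_enat)
  qed
qed

lemma cohen_macaulay_I: "cohen_macaulay n I"
  by (simp add: cohen_macaulay_def depth_I krull_dim_I)

section \<open>The minimal resolution\<close>

lemma xmon_mon_ev: "xmon (U v) = mon_ev poly_var (U v)"
  by (simp add: mon_ev_poly_var)

lemma syzygies_iff:
  "w \<in> syzygies n us \<longleftrightarrow> w \<in> free_mod n (Suc m) \<and> (\<Sum>v\<le>m. w $ v * xmon (U v)) = (0 :: 'k mpoly)"
proof -
  have "(\<Sum>v<Suc m. w $ v * xmon (us ! v)) = (\<Sum>v\<le>m. w $ v * xmon (U v))"
    unfolding lessThan_Suc_atMost by (intro sum.cong) auto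
  then show ?thesis unfolding syzygies_def length_bmons mem_Collect_eq by simp
qed

text \<open>
  The coefficient of \<open>e\<^sub>v\<close> in the relation \<open>y\<^sub>j e\<^sub>j - z\<^bsub>s j\<^esub> e\<^bsub>p j\<^esub>\<close>.
\<close>

definition hb_entry :: "nat \<Rightarrow> nat \<Rightarrow> 'k mpoly" where
  "hb_entry v j = (if v = j then poly_var (2 * j) else 0) - (if v = p j then poly_var (2 * s j + 1) else 0)"

lemma hb_entry_bounds: "j \<in> {1..m} \<Longrightarrow> 2 * j < n \<and> 2 * s j + 1 < n \<and> p j < j"
  using block_parentsD[OF bp, of j] by (auto simp: n_def)

lemma hb_entry_PR: "j \<in> {1..m} \<Longrightarrow> hb_entry v j \<in> PR n"
  using hb_entry_bounds[of j] unfolding hb_entry_def by (intro PR_diff) auto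

lemma hb_entry_homogeneous: "homogeneous 1 (hb_entry v j)"
proof -
  have var: "homogeneous 1 (poly_var i :: 'k mpoly)" for i by (simp add: homogeneous_def poly_var_def)
  have "homogeneous 1 (- (poly_var i :: 'k mpoly))" for i
    using homogeneous_Cst_mult[OF var[of i], of "- 1"] by (simp add: single_uminus)
  then have "homogeneous 1 ((if v = j then poly_var (2 * j) else 0) + (if v = p j then - poly_var (2 * s j + 1) else (0 :: 'k mpoly)))"
    using var by (intro homogeneous_add) auto
  moreover have "(if v = j then poly_var (2 * j) else 0) + (if v = p j then - poly_var (2 * s j + 1) else (0 :: 'k mpoly)) = hb_entry v j"
    by (simp add: hb_entry_def)
  ultimately show ?thesis by simp
qed

lemma hb_entry_irrelevant: "j \<in> {1..m} \<Longrightarrow> hb_entry v j \<in> irrelevant_ideal n"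
proof -
  assume j: "j \<in> {1..m}"
  have "hb_entry v j \<in> ispan (poly_var ` {..<n})"
    unfolding hb_entry_def using hb_entry_bounds[OF j]
    by (intro mult_module.span_diff) (auto intro: mult_module.span_base mult_module.span_zero)
  then show ?thesis using hb_entry_PR[OF j] by (simp add: irrelevant_ideal_ispan)
qed

text \<open>
  The case \<open>k = 2\<close> of \<open>spec_syzygies\<close>, with the coefficients retracted to \<open>n\<close> variables.
\<close>

lemma syzygy_coefficients:
  assumes w: "\<And>v. v \<le> m \<Longrightarrow> w v \<in> PR n" and sum: "(\<Sum>v\<le>m. w v * xmon (U v)) = (0 :: 'k mpoly)"
  obtains d where "\<And>j. d j \<in> PR n" "\<And>v. v \<le> m \<Longrightarrow> w v = (\<Sum>j\<in>{1..m}. d j * hb_entry v j)"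
proof -
  obtain d where d: "\<And>v. v \<le> m \<Longrightarrow> w v = (\<Sum>j\<in>{1..m}. d j * hb_entry v j)"
    using spec_syzygies[of w 2] sum unfolding spec_2 mon_ev_poly_var hb_entry_def by auto
  have "w v = (\<Sum>j\<in>{1..m}. retract n (d j) * hb_entry v j)" if v: "v \<le> m" for v
  proof -
    have "w v = retract n (\<Sum>j\<in>{1..m}. d j * hb_entry v j)" using w[OF v] d[OF v] by (metis retract_id)
    also have "\<dots> = (\<Sum>j\<in>{1..m}. retract n (d j) * retract n (hb_entry v j))"
      unfolding retract_def subst_sum subst_mult ..
    also have "\<dots> = (\<Sum>j\<in>{1..m}. retract n (d j) * hb_entry v j)"
      by (intro sum.cong refl) (simp add: retract_id[OF hb_entry_PR])
    finally show ?thesis .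
  qed
  then show ?thesis using that[of "\<lambda>j. retract n (d j)"] by simp
qed

lemma hb_entry_sum:
  assumes "\<And>v. v \<le> m \<Longrightarrow> w v = (\<Sum>j\<in>{1..m}. d j * hb_entry v j)"
  shows "(\<Sum>v\<le>m. w v * xmon (U v)) = (0 :: 'k mpoly)"
  unfolding xmon_mon_ev using assms unfolding hb_entry_def by (intro relation_sum) auto

text \<open>
  Since \<open>p i < i\<close>, the matrix is triangular with diagonal entries \<open>y\<^sub>j\<close>, so the coefficients vanish from the last
  one downwards.
\<close>

lemma hb_entry_injective:
  assumes zero: "\<And>v. v \<le> m \<Longrightarrow> (\<Sum>j\<in>{1..m}. d j * hb_entry v j) = 0" and j: "j \<in> {1..m}"
  shows "d j = 0"
  using j
proof (induction "m - j" arbitrary: j rule: less_induct)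
  case less
  have "(\<Sum>i\<in>{1..m}. d i * hb_entry j i) = d j * hb_entry j j + (\<Sum>i\<in>{1..m} - {j}. d i * hb_entry j i)"
    using less.prems by (intro sum.remove) auto
  also have "(\<Sum>i\<in>{1..m} - {j}. d i * hb_entry j i) = 0"
  proof (intro sum.neutral ballI)
    fix i assume i: "i \<in> {1..m} - {j}"
    show "d i * hb_entry j i = 0"
    proof (cases "j < i")
      case True
      then have "d i = 0" using less.hyps[of i] i by auto
      then show ?thesis by simp
    next
      case False
      then have "j \<noteq> p i" using hb_entry_bounds[of i] i by auto
      then show ?thesis using i by (simp add: hb_entry_def)
    qed
  qed
  also have "d j * hb_entry j j = d j * poly_var (2 * j)"
    using hb_entry_bounds[OF less.prems] by (simp add: hb_entry_def)
  finally have "d j * poly_var (2 * j) = 0" using zero[of j] less.prems by simp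
  then show ?case by simp
qed

definition betti :: "nat \<Rightarrow> nat" where
  "betti i = (if i = 0 then Suc m else if i = 1 then m else 0)"

definition shift :: "nat \<Rightarrow> nat \<Rightarrow> int" where
  "shift i q = (if i = 0 then int m else int m + 1)"

definition gens :: "'k mpoly vec" where
  "gens = vec (Suc m) (\<lambda>v. xmon (U v))"

definition res_map :: "nat \<Rightarrow> 'k mpoly mat" where
  "res_map i = (if i = 0 then mat (Suc m) m (\<lambda>(v, q). hb_entry v (Suc q)) else 0\<^sub>m (betti i) (betti (Suc i)))"

lemma sum_shift: "(\<Sum>q<m. f (Suc q)) = (\<Sum>j\<in>{1..m}. f j)"
  by (rule sum.reindex_bij_witness[of _ "\<lambda>j. j - 1" Suc]) auto

lemma res_map_0_mult:
  assumes "w \<in> carrier_vec m" "v \<le> m"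
  shows "(res_map 0 *\<^sub>v w) $ v = (\<Sum>q<m. w $ q * hb_entry v (Suc q))"
  using assms by (simp add: res_map_def scalar_prod_def lessThan_atLeast0 mult.commute)

lemma gens_mult: "w \<in> carrier_vec (Suc m) \<Longrightarrow> gens \<bullet> w = (\<Sum>v\<le>m. w $ v * (xmon (U v) :: 'k mpoly))"
proof -
  assume w: "w \<in> carrier_vec (Suc m)"
  have "gens \<bullet> w = (\<Sum>v\<le>m. gens $ v * w $ v)"
    using carrier_vecD[OF w] by (simp add: scalar_prod_def lessThan_Suc_atMost[symmetric] lessThan_atLeast0)
  also have "\<dots> = (\<Sum>v\<le>m. w $ v * xmon (U v))" by (intro sum.cong) (auto simp: gens_def mult.commute)
  finally show ?thesis .
qed

text \<open>
  The resolution is \<open>0 \<longrightarrow> S\<^sup>m \<longrightarrow> S\<^bsup>m+1\<^esup> \<longrightarrow> I \<longrightarrow> 0\<close>, continued by zero modules.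
\<close>

lemma resolution: "graded_free_resolution n I betti shift (gens :: 'k mpoly vec) res_map"
  unfolding graded_free_resolution_def
proof (intro conjI allI impI)
  have fm: "w \<in> carrier_vec k" if "w \<in> free_mod n k" for w :: "'k mpoly vec" and k using that by (simp add: free_mod_def)
  have Un: "keys (U v) \<subseteq> {..<n}" if "v \<le> m" for v using us_keys[of "U v"] that by (simp add: set_bmons)
  show "(gens :: 'k mpoly vec) \<in> free_mod n (betti 0)"
    using Un by (auto simp: gens_def free_mod_def betti_def)
  show "homogeneous (shift 0 j) ((gens :: 'k mpoly vec) $ j)" if "j < betti 0" for j
    using that by (simp add: gens_def betti_def shift_def homogeneous_def expo_deg_bmon)
  show "res_map i \<in> poly_mat n (betti i) (betti (Suc i))" for i
    by (auto simp: res_map_def poly_mat_def betti_def hb_entry_PR)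
  show "homogeneous (shift (Suc i) q - shift i r) (res_map i $$ (r, q))" if "r < betti i" "q < betti (Suc i)" for i r q
    using that hb_entry_homogeneous by (auto simp: res_map_def betti_def shift_def split: if_splits)
  show "(\<lambda>v. (gens :: 'k mpoly vec) \<bullet> v) ` free_mod n (betti 0) = I"
  proof
    show "(\<lambda>v. (gens :: 'k mpoly vec) \<bullet> v) ` free_mod n (betti 0) \<subseteq> I"
    proof
      fix x assume "x \<in> (\<lambda>v. (gens :: 'k mpoly vec) \<bullet> v) ` free_mod n (betti 0)"
      then obtain w :: "'k mpoly vec" where w: "w \<in> free_mod n (Suc m)" "x = gens \<bullet> w" by (auto simp: betti_def)
      then have x: "x = (\<Sum>v\<le>m. w $ v * xmon (U v))" using gens_mult fm by blast
      have "x \<in> ispan (xmon ` set us)"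
        unfolding x by (intro ispan_image_sum mult_module.span_base) (auto simp: set_bmons)
      moreover have "x \<in> PR n" unfolding x using w Un by (intro PR_sum PR_mult) (auto simp: free_mod_def)
      ultimately show "x \<in> I" by (simp add: I_ispan)
    qed
    show "I \<subseteq> (\<lambda>v. (gens :: 'k mpoly vec) \<bullet> v) ` free_mod n (betti 0)"
    proof
      fix x assume x: "x \<in> I"
      have "xmon ` set us = (\<lambda>v. xmon (U v) :: 'k mpoly) ` {..m}" by (auto simp: set_bmons)
      then have "x \<in> ispan ((\<lambda>v. xmon (U v)) ` {..m})" "x \<in> PR n" using x by (auto simp: I_ispan)
      then obtain c where c: "x = (\<Sum>v\<le>m. c v * xmon (U v))" using ispan_image_coeffs[OF finite_atMost] by blast
      define w where "w = vec (Suc m) (\<lambda>v. retract n (c v))"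
      have w: "w \<in> free_mod n (Suc m)" by (simp add: w_def free_mod_def)
      have "x = retract n x" using \<open>x \<in> PR n\<close> by (simp add: retract_id)
      also have "\<dots> = (\<Sum>v\<le>m. retract n (c v) * retract n (xmon (U v)))"
        unfolding c retract_def subst_sum subst_mult ..
      also have "\<dots> = (\<Sum>v\<le>m. w $ v * xmon (U v))"
        by (intro sum.cong refl) (use Un in \<open>simp add: w_def retract_id\<close>)
      also have "\<dots> = gens \<bullet> w" using gens_mult[OF fm[OF w]] by simp
      finally show "x \<in> (\<lambda>v. (gens :: 'k mpoly vec) \<bullet> v) ` free_mod n (betti 0)" using w by (auto simp: betti_def)
    qed
  qed
  have res_map_0_closed: "res_map 0 *\<^sub>v w \<in> free_mod n (Suc m)" if w: "w \<in> free_mod n m" for w :: "'k mpoly vec"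
  proof -
    have "(res_map 0 *\<^sub>v w) $ v \<in> PR n" if "v < Suc m" for v
    proof -
      have "v \<le> m" using that by simp
      show ?thesis unfolding res_map_0_mult[OF fm[OF w] \<open>v \<le> m\<close>]
      proof (intro PR_sum PR_mult hb_entry_PR)
        fix q assume "q \<in> {..<m}"
        then show "w $ q \<in> PR n" "Suc q \<in> {1..m}" using w by (simp_all add: free_mod_def)
      qed
    qed
    moreover have "res_map 0 *\<^sub>v w \<in> carrier_vec (Suc m)" by (intro carrier_vecI) (simp add: res_map_def)
    ultimately show ?thesis by (simp add: free_mod_def)
  qed
  show "{v \<in> free_mod n (betti 0). (gens :: 'k mpoly vec) \<bullet> v = 0} = (\<lambda>w. res_map 0 *\<^sub>v w) ` free_mod n (betti 1)"
  proof
    show "{v \<in> free_mod n (betti 0). (gens :: 'k mpoly vec) \<bullet> v = 0} \<subseteq> (\<lambda>w. res_map 0 *\<^sub>v w) ` free_mod n (betti 1)"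
    proof
      fix v :: "'k mpoly vec" assume "v \<in> {v \<in> free_mod n (betti 0). gens \<bullet> v = 0}"
      then have v: "v \<in> free_mod n (Suc m)" "gens \<bullet> v = 0" by (auto simp: betti_def)
      obtain d where d: "\<And>j. d j \<in> PR n" "\<And>i. i \<le> m \<Longrightarrow> v $ i = (\<Sum>j\<in>{1..m}. d j * hb_entry i j)"
        using syzygy_coefficients[of "\<lambda>i. v $ i"] v gens_mult[OF fm[OF v(1)]] by (auto simp: free_mod_def)
      define w where "w = vec m (\<lambda>q. d (Suc q))"
      have w: "w \<in> free_mod n m" using d by (simp add: w_def free_mod_def)
      have "res_map 0 *\<^sub>v w = v"
      proof (rule eq_vecI)
        show "dim_vec (res_map 0 *\<^sub>v w) = dim_vec v" using carrier_vecD[OF fm[OF v(1)]] by (simp add: res_map_def)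
        fix i assume "i < dim_vec v"
        then have i: "i \<le> m" using carrier_vecD[OF fm[OF v(1)]] by simp
        have "(res_map 0 *\<^sub>v w) $ i = (\<Sum>q<m. w $ q * hb_entry i (Suc q))" by (rule res_map_0_mult[OF fm[OF w] i])
        also have "\<dots> = (\<Sum>q<m. d (Suc q) * hb_entry i (Suc q))" by (intro sum.cong) (auto simp: w_def)
        also have "\<dots> = v $ i" unfolding sum_shift[of "\<lambda>j. d j * hb_entry i j"] d(2)[OF i] ..
        finally show "(res_map 0 *\<^sub>v w) $ i = v $ i" .
      qed
      then show "v \<in> (\<lambda>w. res_map 0 *\<^sub>v w) ` free_mod n (betti 1)" using w by (auto simp: betti_def)
    qed
    show "(\<lambda>w. res_map 0 *\<^sub>v w) ` free_mod n (betti 1) \<subseteq> {v \<in> free_mod n (betti 0). (gens :: 'k mpoly vec) \<bullet> v = 0}"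
    proof
      fix v :: "'k mpoly vec" assume "v \<in> (\<lambda>w. res_map 0 *\<^sub>v w) ` free_mod n (betti 1)"
      then obtain w :: "'k mpoly vec" where w: "w \<in> free_mod n m" "v = res_map 0 *\<^sub>v w" by (auto simp: betti_def)
      have v: "v \<in> free_mod n (Suc m)" unfolding w(2) by (rule res_map_0_closed[OF w(1)])
      have "v $ i = (\<Sum>j\<in>{1..m}. w $ (j - 1) * hb_entry i j)" if "i \<le> m" for i
        unfolding w(2) res_map_0_mult[OF fm[OF w(1)] that]
        using sum_shift[of "\<lambda>j. w $ (j - 1) * hb_entry i j"] by simp
      from hb_entry_sum[of "\<lambda>i. v $ i", OF this] have "gens \<bullet> v = 0" using gens_mult[OF fm[OF v]] by simp
      then show "v \<in> {v \<in> free_mod n (betti 0). (gens :: 'k mpoly vec) \<bullet> v = 0}" using v by (simp add: betti_def)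
    qed
  qed
  have fm0: "free_mod n 0 = {0\<^sub>v 0 :: 'k mpoly vec}"
    by (auto simp: free_mod_def)
  show "{v \<in> free_mod n (betti (Suc i)). res_map i *\<^sub>v v = 0\<^sub>v (betti i)} = (\<lambda>w. res_map (Suc i) *\<^sub>v w) ` free_mod n (betti (Suc (Suc i)))"
    for i
  proof (cases "i = 0")
    case True
    have "w = 0\<^sub>v m" if w: "w \<in> free_mod n m" "res_map 0 *\<^sub>v w = 0\<^sub>v (Suc m)" for w :: "'k mpoly vec"
    proof (rule eq_vecI)
      show "dim_vec w = dim_vec (0\<^sub>v m :: 'k mpoly vec)" using carrier_vecD[OF fm[OF w(1)]] by simp
      fix q assume "q < dim_vec (0\<^sub>v m :: 'k mpoly vec)"
      then have q: "q < m" by simp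
      have "(\<Sum>j\<in>{1..m}. w $ (j - 1) * hb_entry v j) = 0" if "v \<le> m" for v
        using arg_cong[OF w(2), of "\<lambda>x. x $ v"] res_map_0_mult[OF fm[OF w(1)] that] that
          sum_shift[of "\<lambda>j. w $ (j - 1) * hb_entry v j"] by simp
      from hb_entry_injective[of "\<lambda>j. w $ (j - 1)" "Suc q", OF this] show "w $ q = 0\<^sub>v m $ q" using q by simp
    qed
    moreover have "res_map 0 *\<^sub>v 0\<^sub>v m = (0\<^sub>v (Suc m) :: 'k mpoly vec)"
      by (rule eq_vecI) (auto simp: res_map_def)
    moreover have "(0\<^sub>v m :: 'k mpoly vec) \<in> free_mod n m" by (simp add: free_mod_def)
    moreover have maps_1_mult_0: "res_map (Suc 0) *\<^sub>v 0\<^sub>v 0 = (0\<^sub>v m :: 'k mpoly vec)"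
      by (rule eq_vecI) (auto simp: res_map_def betti_def scalar_prod_def)
    ultimately have "{v \<in> free_mod n m. res_map 0 *\<^sub>v v = 0\<^sub>v (Suc m)} = {0\<^sub>v m :: 'k mpoly vec}" by blast
    moreover have "(\<lambda>w. res_map (Suc 0) *\<^sub>v w) ` {0\<^sub>v 0} = {0\<^sub>v m :: 'k mpoly vec}"
      by (simp only: image_insert image_empty maps_1_mult_0)
    moreover have "betti 0 = Suc m" "betti (Suc 0) = m" "betti (Suc (Suc 0)) = 0" by (simp_all add: betti_def)
    ultimately show ?thesis by (simp only: True fm0)
  next
    case False
    have "(res_map i *\<^sub>v 0\<^sub>v 0 :: 'k mpoly vec) = 0\<^sub>v (betti i)"
      using False by (intro eq_vecI) (auto simp: res_map_def betti_def scalar_prod_def)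
    then have "{v \<in> {0\<^sub>v 0}. res_map i *\<^sub>v v = 0\<^sub>v (betti i)} = {0\<^sub>v 0 :: 'k mpoly vec}" by blast
    moreover have mi: "(res_map (Suc i) *\<^sub>v 0\<^sub>v 0 :: 'k mpoly vec) = 0\<^sub>v 0"
      using False by (intro eq_vecI) (auto simp: res_map_def betti_def scalar_prod_def)
    have "(\<lambda>w. res_map (Suc i) *\<^sub>v w) ` {0\<^sub>v 0} = {0\<^sub>v 0 :: 'k mpoly vec}"
      by (simp only: image_insert image_empty mi)
    moreover have "betti (Suc i) = 0" "betti (Suc (Suc i)) = 0" using False by (simp_all add: betti_def)
    ultimately show ?thesis by (simp only: fm0)
  qed
qed

lemma linear_resolution_I: "linear_resolution n I"
proof -
  have "generated_in_degree n m I"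
    unfolding generated_in_degree_def
    using xmon_us_PR by (intro exI[of _ "xmon ` set us"])
      (auto simp: I_def ideal_of_monomials_def homogeneous_def set_bmons expo_deg_bmon)
  moreover have "minimal_graded_free_resolution n I betti shift gens res_map"
    unfolding minimal_graded_free_resolution_def using resolution hb_entry_irrelevant
    by (auto simp: res_map_def betti_def split: if_splits)
  moreover have "\<forall>i. \<forall>r<betti i. \<forall>q<betti (Suc i). homogeneous 1 (res_map i $$ (r, q))"
    using hb_entry_homogeneous by (auto simp: res_map_def betti_def split: if_splits)
  ultimately show ?thesis unfolding linear_resolution_def by blast
qed

section \<open>The Taylor graph\<close>

text \<open>
  The relation tree given by the resolution; \<open>edge_lcm j\<close> is the colour of its edge \<open>(p j, j)\<close>.
\<close>

definition "parent_tree = (\<lambda>j. (p j, j)) ` {1..m}"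
definition "edge_lcm j = U (p j) + single (2 * s j + 1) 1"

lemma elcm_tree: "j \<in> {1..m} \<Longrightarrow> elcm us (p j, j) = edge_lcm j"
proof -
  assume j: "j \<in> {1..m}"
  then have pj: "p j \<le> m" using hb_entry_bounds[OF j] by simp
  have eq: "lookup (U j) x + (if 2 * j = x then 1 else 0) = lookup (U (p j)) x + (if 2 * s j + 1 = x then 1 else 0)" for x
    using arg_cong[OF bmon_parent[OF bp j], of "\<lambda>t. lookup t x"]
    by (cases "2 * j = x"; cases "2 * s j + 1 = x") (auto simp: lookup_add lookup_single when_def)
  have ne: "2 * j \<noteq> 2 * s j + 1" by presburger
  have max: "max (lookup (U (p j)) x) (lookup (U j) x) = lookup (U (p j)) x + (if 2 * s j + 1 = x then 1 else 0)" for x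
    using eq[of x] ne by (cases "2 * j = x"; cases "2 * s j + 1 = x") auto
  show ?thesis
  proof (rule poly_mapping_eqI)
    fix x
    have "lookup (elcm us (p j, j)) x = max (lookup (U (p j)) x) (lookup (U j) x)"
      using j pj by (simp add: lookup_expo_lcm)
    also have "\<dots> = lookup (edge_lcm j) x"
      unfolding max by (simp add: edge_lcm_def lookup_add lookup_single when_def)
    finally show "lookup (elcm us (p j, j)) x = lookup (edge_lcm j) x" .
  qed
qed

lemma trel_tree:
  assumes j: "j \<in> {1..m}" and v: "v \<le> m"
  shows "(trel us (p j, j) :: 'k mpoly vec) $ v = hb_entry v j"
proof -
  have pj: "p j \<noteq> j" "p j \<le> m" using hb_entry_bounds[OF j] j by auto
  have "edge_lcm j - U (p j) = single (2 * s j + 1) 1" "edge_lcm j - U j = single (2 * j) 1"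
    by (simp add: edge_lcm_def) (simp only: edge_lcm_def bmon_parent[OF bp j, symmetric] add_diff_cancel_left')
  then show ?thesis
    using j v pj elcm_tree[OF j] by (auto simp: trel_eq_scaled_diff scaled_diff_def hb_entry_def poly_var_def)
qed

text \<open>
  The standard relations are the Taylor relations of the edges \<open>(p j, j)\<close>.
\<close>

lemma hb_tree: "hb_edges TYPE('k) n us parent_tree"
  unfolding hb_edges_def
proof (intro conjI)
  show sub: "parent_tree \<subseteq> edge_pairs (length us)" using hb_entry_bounds by (auto simp: parent_tree_def edge_pairs_def)
  have "inj_on (\<lambda>j. (p j, j)) {1..m}" by (auto intro: inj_onI)
  then show "card parent_tree = length us - 1" unfolding parent_tree_def by (simp add: card_image)
  have A: "trel us ` parent_tree \<subseteq> (carrier_vec (Suc m) :: 'k mpoly vec set)"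
    using trel_carrier[of us, where 'a = 'k] by auto
  show "submod_span n (length us) (trel us ` parent_tree) = (syzygies n us :: 'k mpoly vec set)"
  proof
    show "submod_span n (length us) (trel us ` parent_tree) \<subseteq> (syzygies n us :: 'k mpoly vec set)"
    proof
      fix w :: "'k mpoly vec" assume "w \<in> submod_span n (length us) (trel us ` parent_tree)"
      then show "w \<in> syzygies n us"
      proof induction
        case zero
        then show ?case by (auto simp: syzygies_iff free_mod_def)
      next
        case (step a c v)
        then obtain e where e: "e \<in> parent_tree" "a = trel us e" by blast
        have a: "a \<in> syzygies n us" unfolding e(2)
          using trel_in_syzygies[OF us_keys, where i = "fst e" and j = "snd e" and 'k = 'k] sub e(1) by (auto simp: edge_pairs_def)
        have dims: "dim_vec a = Suc m" "dim_vec v = Suc m" using a step(4) by (auto simp: syzygies_iff free_mod_def)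
        have "(\<Sum>i\<le>m. (c \<cdot>\<^sub>v a + v) $ i * xmon (U i)) = c * (\<Sum>i\<le>m. a $ i * xmon (U i)) + (\<Sum>i\<le>m. v $ i * xmon (U i))"
          unfolding sum_distrib_left sum.distrib[symmetric]
        proof (rule sum.cong[OF refl])
          fix i assume "i \<in> {..m}"
          then have "(c \<cdot>\<^sub>v a + v) $ i = c * a $ i + v $ i" using dims by simp
          then show "(c \<cdot>\<^sub>v a + v) $ i * xmon (U i) = c * (a $ i * xmon (U i)) + v $ i * xmon (U i)"
            by (simp only: distrib_right mult.assoc)
        qed
        also have "\<dots> = 0" using a step(4) by (simp add: syzygies_iff)
        finally have "(\<Sum>i\<le>m. (c \<cdot>\<^sub>v a + v) $ i * xmon (U i)) = 0" .
        moreover have "c \<cdot>\<^sub>v a + v \<in> free_mod n (Suc m)"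
          unfolding free_mod_def
        proof (intro CollectI conjI allI impI)
          show "c \<cdot>\<^sub>v a + v \<in> carrier_vec (Suc m)" using dims by (intro carrier_vecI) simp
          fix i assume "i < Suc m"
          then have "(c \<cdot>\<^sub>v a + v) $ i = c * a $ i + v $ i" using dims by simp
          moreover have "a $ i \<in> PR n" "v $ i \<in> PR n"
            using \<open>i < Suc m\<close> a step(4) by (simp_all add: syzygies_iff free_mod_def)
          ultimately show "(c \<cdot>\<^sub>v a + v) $ i \<in> PR n" using step(2) by simp
        qed
        ultimately show ?case by (simp add: syzygies_iff)
      qed
    qed
    show "syzygies n us \<subseteq> (submod_span n (length us) (trel us ` parent_tree) :: 'k mpoly vec set)"
    proof
      fix w :: "'k mpoly vec" assume "w \<in> syzygies n us"
      then have w: "w \<in> free_mod n (Suc m)" "(\<Sum>v\<le>m. w $ v * xmon (U v)) = 0" by (auto simp: syzygies_iff)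
      obtain d where d: "\<And>j. d j \<in> PR n" "\<And>i. i \<le> m \<Longrightarrow> w $ i = (\<Sum>j\<in>{1..m}. d j * hb_entry i j)"
        using syzygy_coefficients[of "\<lambda>i. w $ i"] w by (auto simp: free_mod_def)
      show "w \<in> submod_span n (length us) (trel us ` parent_tree)"
        unfolding length_bmons
      proof (rule submod_span_sum[of "{1..m}" "\<lambda>j. trel us (p j, j)" n "Suc m" _ d w])
        show "(trel us (p j, j) :: 'k mpoly vec) \<in> submod_span n (Suc m) (trel us ` parent_tree)" if "j \<in> {1..m}" for j
          using that A by (intro submod_span_base) (auto simp only: parent_tree_def)
        show "w \<in> carrier_vec (Suc m)" using w by (simp add: free_mod_def)
        fix v assume "v < Suc m"
        then have v: "v \<le> m" by simp
        show "w $ v = (\<Sum>j\<in>{1..m}. d j * trel us (p j, j) $ v)"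
          unfolding d(2)[OF v] by (intro sum.cong refl) (simp add: trel_tree[OF _ v])
      qed (use A d in auto)
    qed
  qed
qed

text \<open>
  Two edges have the same colour only if they belong to the same clique: the even variables in the colour
  determine the parent, and then the remaining odd variable determines \<open>s\<close>.
\<close>

lemma edge_lcm_inject:
  assumes ij: "i \<in> {1..m}" "j \<in> {1..m}" and eq: "edge_lcm i = edge_lcm j"
  shows "p i = p j" "s i = s j"
proof -
  have b: "p i \<le> m" "p j \<le> m" using hb_entry_bounds[OF ij(1)] hb_entry_bounds[OF ij(2)] ij by auto
  have odd: "2 * s x + 1 \<noteq> 2 * k" for x k by presburger
  show "p i = p j"
  proof (rule anc_eq_if_bmon_even[OF bp b])
    fix k
    show "lookup (U (p i)) (2 * k) = lookup (U (p j)) (2 * k)"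
      using arg_cong[OF eq, of "\<lambda>t. lookup t (2 * k)"] odd[of i k] odd[of j k]
      by (simp add: edge_lcm_def lookup_add lookup_single when_def)
  qed
  then have "single (2 * s i + 1) (1::nat) = single (2 * s j + 1) 1" using eq by (simp add: edge_lcm_def)
  then have "2 * s i + 1 = 2 * s j + 1" by (metis keys_single singleton_inject zero_neq_one)
  then show "s i = s j" by simp
qed

text \<open>
  By \<open>edge_lcm_inject\<close>, the edges of one colour join the first vertex of a clique to all its other vertices. So
  two vertices are joined by a monochromatic path if and only if they lie in a common clique.
\<close>

lemma taylor_graph_eq:
  "parcs (taylor_graph TYPE('k) n us) = symc (block_adj m p s)"
proof -
  have deg: "\<forall>u\<in>set us. expo_deg u = m" by (auto simp: set_bmons expo_deg_bmon)
  interpret L: linear_hb "TYPE('k)" n m us parent_tree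
    by unfold_locales
      (use us_keys distinct_bmons[OF bp] deg hb_tree linear_resolution_syzygies[OF minimal_generators deg linear_resolution_I] in auto)
  have step: "(p j, j) \<in> colour_class us parent_tree (edge_lcm j)" if "j \<in> {1..m}" for j
    using elcm_tree[OF that] that by (auto simp: colour_class_def parent_tree_def)
  have adj_connected: "(i, j) \<in> (symc (colour_class us parent_tree (edge_lcm j)))\<^sup>* \<and> i \<noteq> j" if "(i, j) \<in> block_adj m p s" for i j
  proof -
    have ij: "i < j" "j \<le> m" "i = p j \<or> 1 \<le> i \<and> s i = s j" using that by (auto simp: block_adj_def)
    then have j: "j \<in> {1..m}" by auto
    have e: "(p j, j) \<in> symc (colour_class us parent_tree (edge_lcm j))" using step[OF j] by (auto simp: symc_def)
    show ?thesis
    proof (cases "i = p j")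
      case True
      then show ?thesis using e ij by auto
    next
      case False
      then have i: "i \<in> {1..m}" "s i = s j" using ij by auto
      then have "p i = p j" using block_parentsD(5)[OF bp, of i] block_parentsD(5)[OF bp, of j] j by simp
      then have "edge_lcm i = edge_lcm j" using i by (simp add: edge_lcm_def)
      then have "(i, p j) \<in> symc (colour_class us parent_tree (edge_lcm j))"
        using step[OF i(1)] \<open>p i = p j\<close> by (auto simp: symc_def)
      then show ?thesis using e ij(1) by (meson less_irrefl r_into_rtrancl rtrancl.rtrancl_into_rtrancl)
    qed
  qed
  have connected_adj: "(i, j) \<in> block_adj m p s" if ij: "(i, j) \<in> (symc (colour_class us parent_tree \<sigma>))\<^sup>*" "i < j" for i j \<sigma>
  proof -
    obtain x where x: "(i, x) \<in> symc (colour_class us parent_tree \<sigma>)" using ij by (metis converse_rtranclE less_irrefl)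
    then obtain k where k: "k \<in> {1..m}" "edge_lcm k = \<sigma>" "i = p k \<or> i = k"
      using elcm_tree by (auto simp: symc_def colour_class_def parent_tree_def)
    \<comment> \<open>The vertices of the clique whose colour is \<open>\<sigma>\<close>.\<close>
    define B where "B = insert (p k) {y \<in> {1..m}. p y = p k \<and> s y = s k}"
    have ends: "a \<in> B \<and> b \<in> B" if ab: "(a, b) \<in> symc (colour_class us parent_tree \<sigma>)" for a b
    proof -
      obtain y where y: "y \<in> {1..m}" "elcm us (p y, y) = \<sigma>" "(a, b) = (p y, y) \<or> (b, a) = (p y, y)"
        using ab by (auto simp: symc_def colour_class_def parent_tree_def)
      then have "edge_lcm y = edge_lcm k" using elcm_tree k by simp
      then have "p y = p k" "s y = s k" using edge_lcm_inject y k by blast+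
      then show ?thesis using y by (auto simp: B_def)
    qed
    have "i \<in> B" using k by (auto simp: B_def)
    moreover have "j \<in> B"
      using ij(1)
    proof (cases rule: rtranclE)
      case base then show ?thesis using ij by simp
    next
      case (step y) then show ?thesis using ends by blast
    qed
    ultimately show ?thesis
      using ij(2) hb_entry_bounds[of i] by (auto simp: B_def block_adj_def)
  qed
  show ?thesis
  proof (rule Set.set_eqI)
    fix e :: "nat \<times> nat"
    obtain i j where e: "e = (i, j)" by fastforce
    show "e \<in> parcs (taylor_graph TYPE('k) n us) \<longleftrightarrow> e \<in> symc (block_adj m p s)"
    proof
      assume "e \<in> parcs (taylor_graph TYPE('k) n us)"
      then obtain \<sigma> where \<sigma>: "i \<noteq> j" "(i, j) \<in> (symc (colour_class us parent_tree \<sigma>))\<^sup>*" by (auto simp: e L.taylor_graph_arcs)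
      then show "e \<in> symc (block_adj m p s)"
        using connected_adj[OF \<sigma>(2)] connected_adj[OF sym_symc_rtrancl[OF \<sigma>(2)]] by (cases "i < j") (auto simp: e symc_def)
    next
      assume "e \<in> symc (block_adj m p s)"
      then have "(i, j) \<in> block_adj m p s \<or> (j, i) \<in> block_adj m p s" by (auto simp: e symc_def)
      then show "e \<in> parcs (taylor_graph TYPE('k) n us)"
        unfolding e L.taylor_graph_arcs using adj_connected sym_symc_rtrancl by metis
    qed
  qed
qed

end

theorem theorem2p6:
  fixes G :: "'a pair_pre_digraph"
  assumes "pair_graph G" and "connected (with_proj G)" and "2 \<le> card (pverts G)"
  shows
    "(\<exists>(lab :: 'a \<Rightarrow> nat) n (us :: expo list) (I :: ('k::field) mpoly set).
        inj_on lab (pverts G) \<and>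
        minimal_monomial_generators n I us \<and>
        cohen_macaulay n I \<and>
        ideal_height (poly_ring n) I = 2 \<and>
        linear_resolution n I \<and>
        relabel lab G = taylor_graph TYPE('k) n us)
     \<longleftrightarrow>
     (chordal G \<and>
      (\<forall>C D. maximal_clique G C \<and> maximal_clique G D \<and> C \<noteq> D \<longrightarrow> card (C \<inter> D) \<le> 1))"
    (is "?L \<longleftrightarrow> ?R")
proof
  assume ?L
  then obtain lab :: "'a \<Rightarrow> nat" and n us and I :: "'k mpoly set" where *: "inj_on lab (pverts G)"
    "minimal_monomial_generators n I us" "linear_resolution n I" "relabel lab G = taylor_graph TYPE('k) n us"
    by blast
  obtain x where x: "x \<in> pverts G" using assms(3) by fastforce
  have "pverts G \<noteq> {x}" using assms(3) by auto
  then have "parcs G \<noteq> {}"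
    using connected_pair_graph_crossing[OF assms(1,2), of "{x}"] x by blast
  note block = taylor_graph_block_graph[OF assms(1) this *]
  show ?R using block by blast
next
  assume R: ?R
  then have "\<And>C D. maximal_clique G C \<Longrightarrow> maximal_clique G D \<Longrightarrow> C \<noteq> D \<Longrightarrow> card (C \<inter> D) \<le> 1" "chordal G" by blast+
  then obtain m lab p s where m: "1 \<le> m" and lab: "bij_betw lab (pverts G) {..m}" and bp: "block_parents m p s"
    and adj: "\<And>x y. x \<in> pverts G \<Longrightarrow> y \<in> pverts G \<Longrightarrow> (x, y) \<in> parcs G \<longleftrightarrow>
       (lab x, lab y) \<in> block_adj m p s \<or> (lab y, lab x) \<in> block_adj m p s"
    using block_parents_exist[OF assms] by metis
  interpret block_ideal "TYPE('k)" m p s "2 * m + 2"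
    by unfold_locales (use m bp in auto)
  interpret G: pair_graph G by fact
  have "map_prod lab lab ` parcs G = symc (block_adj m p s)"
  proof (rule Set.set_eqI)
    fix e :: "nat \<times> nat"
    obtain i j where e: "e = (i, j)" by fastforce
    show "e \<in> map_prod lab lab ` parcs G \<longleftrightarrow> e \<in> symc (block_adj m p s)"
    proof
      assume "e \<in> map_prod lab lab ` parcs G"
      then obtain x y where "(x, y) \<in> parcs G" "i = lab x" "j = lab y" by (auto simp: e)
      then show "e \<in> symc (block_adj m p s)" using adj[of x y] G.in_arcsD1[of x y] G.in_arcsD2[of x y] by (simp add: e symc_def)
    next
      assume ij: "e \<in> symc (block_adj m p s)"
      then have "i \<in> {..m}" "j \<in> {..m}" by (auto simp: e symc_def block_adj_def)
      then have "i \<in> lab ` pverts G" "j \<in> lab ` pverts G" using lab by (auto simp: bij_betw_def)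
      then obtain x y where "x \<in> pverts G" "y \<in> pverts G" "i = lab x" "j = lab y" by blast
      then show "e \<in> map_prod lab lab ` parcs G"
        using ij adj[of x y] unfolding e symc_def by (intro image_eqI[of _ _ "(x, y)"]) auto
    qed
  qed
  moreover have "lab ` pverts G = {..<length us}"
    using lab unfolding bij_betw_def length_bmons lessThan_Suc_atMost by blast
  ultimately have "relabel lab G = taylor_graph TYPE('k) (2 * m + 2) us"
    using taylor_graph_eq by (simp add: relabel_def taylor_graph_def)
  then show ?L
    using lab minimal_generators cohen_macaulay_I height_I linear_resolution_I unfolding bij_betw_def by blast
qed

end
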